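(* Let $\mathbb{K}$ be a field with $\mathrm{char}\,\mathbb{K}\neq 3$. For every $(p,q,r)\in\mathbb{K}^3$ the Sklyanin algebra $Q^{p,q,r}$ is Koszul. Moreover, $Q^{p,q,r}$ is a PHS-algebra (that is, its Hilbert series equals $(1-t)^{-3}$) if and only if at least two of $p$, $q$ and $r$ are non-zero and the equality $p^3=q^3=r^3$ fails.
   Context: For $(p,q,r)\in\mathbb{K}^3$, the Sklyanin algebra $Q^{p,q,r}$ is the associative unital $\mathbb{K}$-algebra with generators $x,y,z$ and the three relations $pyz+qzy+rxx=0$, $pzx+qxz+ryy=0$, $pxy+qyx+rzz=0$. For a finite-dimensional vector space $V$ over $\mathbb{K}$ and a subspace $R\subseteq V\otimes V$, the quadratic algebra $A(V,R)$ is the quotient of the tensor algebra of $V$ by the two-sided ideal generated by $R$; it is graded by degree, with $m$-th graded component denoted $A_m$. Its Hilbert series is $H_A(t)=\sum_{j\geq 0}\dim_{\mathbb{K}}A_j\,t^j$. With $n=\dim V$, $A$ is called a PHS-algebra if $H_A(t)=(1-t)^{-n}$; for $Q^{p,q,r}$, $V$ is the 3-dimensional space with basis $x,y,z$. A quadratic algebra $A$ is called Koszul if $\mathbb{K}$, regarded as a graded right $A$-module via the augmentation map $A\to\mathbb{K}$ (killing $V$), has a free graded resolution $\dots\to M_m\to\dots\to M_1\to A\to\mathbb{K}\to 0$ in which $A\to\mathbb{K}$ is the augmentation map and each $M_m$ is generated in degree $m$. *)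

theory Defs
  imports
    "HOL-Algebra.Algebraic_Closure_Type"
    "HOL-Algebra.Embedded_Algebras"
    "HOL-Computational_Algebra.Formal_Power_Series"
    "HOL-Library.Cardinality"
    "HOL-Library.Poly_Mapping"
begin

section \<open>The tensor algebra of a space with a finite basis\<close>

text \<open>
  Lists form the free monoid.  Written additively, they make the finitely supported functions
  \<open>'x list \<Rightarrow>\<^sub>0 'k\<close>, with the convolution product of \<^theory>\<open>HOL-Library.Poly_Mapping\<close>, the free
  algebra on \<open>'x\<close>, i.e. the tensor algebra of the vector space with basis \<open>'x\<close>.
\<close>

instantiation list :: (type) monoid_add
begin

definition zero_list :: "'a list" where "zero_list = []"

definition plus_list :: "'a list \<Rightarrow> 'a list \<Rightarrow> 'a list" where "plus_list = (@)"

instance by standard (simp_all add: zero_list_def plus_list_def)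

end

type_synonym ('x, 'k) free_alg = "'x list \<Rightarrow>\<^sub>0 'k"

definition free_algebra :: "('x, 'k::field) free_alg ring" where
  "free_algebra = ring_of_type_algebra"

definition homogeneous :: "nat \<Rightarrow> ('x, 'k::field) free_alg set" where
  "homogeneous m = {f. \<forall>w \<in> Poly_Mapping.keys f. length w = m}"


section \<open>Quadratic algebras\<close>

text \<open>
  Below, \<open>R\<close> is a set of elements of degree 2.  It may be any spanning set of the subspace of
  \<open>V \<otimes> V\<close> in question, since the ideal it generates contains its span.
\<close>

definition rel_ideal :: "('x, 'k::field) free_alg set \<Rightarrow> ('x, 'k) free_alg set" where
  "rel_ideal R = Idl\<^bsub>free_algebra\<^esub> R"

definition quad_alg :: "('x, 'k::field) free_alg set \<Rightarrow> ('x, 'k) free_alg set ring" where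
  "quad_alg R = free_algebra Quot (rel_ideal R)"

definition quad_class :: "('x, 'k::field) free_alg set \<Rightarrow> ('x, 'k) free_alg \<Rightarrow> ('x, 'k) free_alg set" where
  "quad_class R f = rel_ideal R +>\<^bsub>free_algebra\<^esub> f"

definition quad_component ::
    "('x, 'k::field) free_alg set \<Rightarrow> nat \<Rightarrow> ('x, 'k) free_alg set set" where
  "quad_component R m = quad_class R ` homogeneous m"

definition quad_scalars :: "('x, 'k::field) free_alg set \<Rightarrow> ('x, 'k) free_alg set set" where
  "quad_scalars R = range (\<lambda>c. quad_class R (Poly_Mapping.single [] c))"

text \<open>
  Elements of the ideal generated by quadratic relations have no constant term, so all
  representatives of a class have the same one.
\<close>

definition augmentation :: "('x, 'k::field) free_alg set \<Rightarrow> 'k" where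
  "augmentation a = the_elem ((\<lambda>f. Poly_Mapping.lookup f []) ` a)"

definition hilbert_series :: "('x::finite, 'k::field) free_alg set \<Rightarrow> rat fps" where
  "hilbert_series R =
     Abs_fps (\<lambda>j. of_nat (ring.dim (quad_alg R) (quad_scalars R) (quad_component R j)))"

definition PHS :: "('x::finite, 'k::field) free_alg set \<Rightarrow> bool" where
  "PHS (R :: ('x, 'k) free_alg set) \<longleftrightarrow> hilbert_series R = inverse ((1 - fps_X) ^ CARD('x))"


section \<open>Graded right modules\<close>

text \<open>
  As for the record \<^typ>\<open>('a, 'm) module\<close>, the multiplicative part of the underlying ring record
  plays no role.  Gradings over the natural numbers suffice for resolutions: a graded module
  generated in degree \<open>m \<ge> 0\<close> over a nonnegatively graded algebra vanishes in negative degrees.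
\<close>

record ('a, 'm) gr_module = "'m ring" +
  ract :: "'m \<Rightarrow> 'a \<Rightarrow> 'm" (infixl \<open>\<lhd>\<index>\<close> 70)
  component :: "nat \<Rightarrow> 'm set"

locale graded_right_module = A?: ring A + M?: abelian_group M
  for A :: "('a, 'r) ring_scheme" (structure)
    and G :: "nat \<Rightarrow> 'a set"
    and M :: "('a, 'm, 's) gr_module_scheme" (structure) +
  assumes act_closed: "\<lbrakk>x \<in> carrier M; a \<in> carrier A\<rbrakk> \<Longrightarrow> ract M x a \<in> carrier M"
    and act_one: "x \<in> carrier M \<Longrightarrow> ract M x \<one>\<^bsub>A\<^esub> = x"
    and act_assoc: "\<lbrakk>x \<in> carrier M; a \<in> carrier A; b \<in> carrier A\<rbrakk> \<Longrightarrow>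
      ract M x (a \<otimes>\<^bsub>A\<^esub> b) = ract M (ract M x a) b"
    and act_distr_l: "\<lbrakk>x \<in> carrier M; y \<in> carrier M; a \<in> carrier A\<rbrakk> \<Longrightarrow>
      ract M (x \<oplus>\<^bsub>M\<^esub> y) a = ract M x a \<oplus>\<^bsub>M\<^esub> ract M y a"
    and act_distr_r: "\<lbrakk>x \<in> carrier M; a \<in> carrier A; b \<in> carrier A\<rbrakk> \<Longrightarrow>
      ract M x (a \<oplus>\<^bsub>A\<^esub> b) = ract M x a \<oplus>\<^bsub>M\<^esub> ract M x b"
    and component_subgroup: "additive_subgroup (component M i) M"
    and component_act: "\<lbrakk>x \<in> component M i; a \<in> G j\<rbrakk> \<Longrightarrow> ract M x a \<in> component M (i + j)"
    and decomposition: "x \<in> carrier M \<Longrightarrow>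
      \<exists>!c. (\<forall>i. c i \<in> component M i) \<and> finite {i. c i \<noteq> \<zero>\<^bsub>M\<^esub>} \<and>
        x = finsum M c {i. c i \<noteq> \<zero>\<^bsub>M\<^esub>}"

definition is_right_comb ::
    "('a, 'r) ring_scheme \<Rightarrow> ('a, 'm, 's) gr_module_scheme \<Rightarrow> 'm set \<Rightarrow> 'm \<Rightarrow> ('m \<Rightarrow> 'a) \<Rightarrow> bool" where
  "is_right_comb A M S x c \<longleftrightarrow>
     (\<forall>b. c b \<in> carrier A) \<and> finite {b. c b \<noteq> \<zero>\<^bsub>A\<^esub>} \<and> {b. c b \<noteq> \<zero>\<^bsub>A\<^esub>} \<subseteq> S \<and>
     x = finsum M (\<lambda>b. ract M b (c b)) {b. c b \<noteq> \<zero>\<^bsub>A\<^esub>}"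

text \<open>A graded free module is one with a basis of homogeneous elements.\<close>

definition graded_free :: "('a, 'r) ring_scheme \<Rightarrow> ('a, 'm, 's) gr_module_scheme \<Rightarrow> bool" where
  "graded_free A M \<longleftrightarrow>
     (\<exists>B \<subseteq> (\<Union>i. component M i). \<forall>x \<in> carrier M. \<exists>!c. is_right_comb A M B x c)"

definition generated_in_degree ::
    "('a, 'r) ring_scheme \<Rightarrow> ('a, 'm, 's) gr_module_scheme \<Rightarrow> nat \<Rightarrow> bool" where
  "generated_in_degree A M m \<longleftrightarrow>
     (\<forall>x \<in> carrier M. \<exists>c. is_right_comb A M (component M m) x c)"

definition graded_hom ::
    "('a, 'r) ring_scheme \<Rightarrow> ('a, 'm, 's) gr_module_scheme \<Rightarrow> ('a, 'n, 't) gr_module_scheme \<Rightarrow>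
      ('m \<Rightarrow> 'n) \<Rightarrow> bool" where
  "graded_hom A M N f \<longleftrightarrow>
     f \<in> carrier M \<rightarrow> carrier N \<and>
     (\<forall>x \<in> carrier M. \<forall>y \<in> carrier M. f (x \<oplus>\<^bsub>M\<^esub> y) = f x \<oplus>\<^bsub>N\<^esub> f y) \<and>
     (\<forall>x \<in> carrier M. \<forall>a \<in> carrier A. f (ract M x a) = ract N (f x) a) \<and>
     (\<forall>i. f ` component M i \<subseteq> component N i)"

definition exact_pair ::
    "('m, 's) ring_scheme \<Rightarrow> ('m \<Rightarrow> 'n) \<Rightarrow> ('n, 't) ring_scheme \<Rightarrow> ('n \<Rightarrow> 'l) \<Rightarrow>
      ('l, 'u) ring_scheme \<Rightarrow> bool" where
  "exact_pair L f M g N \<longleftrightarrow> f ` carrier L = {y \<in> carrier M. g y = \<zero>\<^bsub>N\<^esub>}"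


section \<open>Koszul algebras\<close>

definition regular_module ::
    "('x, 'k::field) free_alg set \<Rightarrow> (('x, 'k) free_alg set, ('x, 'k) free_alg set) gr_module" where
  "regular_module R = (let A = quad_alg R in
     \<lparr>carrier = carrier A, monoid.mult = monoid.mult A, one = one A, zero = zero A, add = add A,
      ract = monoid.mult A, component = quad_component R\<rparr>)"

definition residue_module :: "(('x, 'k::field) free_alg set, 'k) gr_module" where
  "residue_module =
     \<lparr>carrier = UNIV, monoid.mult = (*), one = 1, zero = 0, add = (+),
      ract = (\<lambda>s a. s * augmentation a), component = (\<lambda>i. if i = 0 then UNIV else {0})\<rparr>"

text \<open>
  \<open>d1\<close> is the map from \<open>M 1\<close> to the algebra, and \<open>d m\<close> is the map from \<open>M (m + 1)\<close> to \<open>M m\<close>.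
  \<open>M 0\<close> and \<open>d 0\<close> are not used.
\<close>

definition linear_free_resolution ::
    "('x, 'k::field) free_alg set \<Rightarrow> (nat \<Rightarrow> (('x, 'k) free_alg set, 'm) gr_module) \<Rightarrow>
      ('m \<Rightarrow> ('x, 'k) free_alg set) \<Rightarrow> (nat \<Rightarrow> 'm \<Rightarrow> 'm) \<Rightarrow> bool" where
  "linear_free_resolution R M d1 d \<longleftrightarrow>
     (\<forall>m\<ge>1. graded_right_module (quad_alg R) (quad_component R) (M m) \<and>
        graded_free (quad_alg R) (M m) \<and> generated_in_degree (quad_alg R) (M m) m) \<and>
     graded_hom (quad_alg R) (regular_module R) residue_module augmentation \<and>
     graded_hom (quad_alg R) (M 1) (regular_module R) d1 \<and>
     (\<forall>m\<ge>1. graded_hom (quad_alg R) (M (m + 1)) (M m) (d m)) \<and>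
     augmentation ` carrier (quad_alg R) = UNIV \<and>
     exact_pair (M 1) d1 (regular_module R) augmentation
       (residue_module :: (('x, 'k) free_alg set, 'k) gr_module) \<and>
     exact_pair (M 2) (d 1) (M 1) d1 (regular_module R) \<and>
     (\<forall>m\<ge>1. exact_pair (M (m + 2)) (d (m + 1)) (M (m + 1)) (d m) (M m))"

text \<open>
  HOL cannot quantify over the carrier types of the modules here.  Taking sequences of elements of
  the algebra loses nothing: a resolution with \<open>M m\<close> generated in degree \<open>m\<close> is minimal, so every
  \<open>M m\<close> has finite rank, and free modules of finite rank consist of tuples of algebra elements.
\<close>

definition koszul :: "('x::finite, 'k::field) free_alg set \<Rightarrow> bool" where
  "koszul (R :: ('x, 'k) free_alg set) \<longleftrightarrow>
     (\<exists>(M :: nat \<Rightarrow> (('x, 'k) free_alg set, nat \<Rightarrow> ('x, 'k) free_alg set) gr_module) d1 d.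
        linear_free_resolution R M d1 d)"


section \<open>Sklyanin algebras\<close>

datatype gen = Gx | Gy | Gz

lemma UNIV_gen: "UNIV = {Gx, Gy, Gz}"
  by (auto intro: gen.exhaust)

instance gen :: finite
  by standard (simp add: UNIV_gen)

lemma card_gen: "CARD(gen) = 3"
  by (simp add: UNIV_gen)

definition sklyanin :: "'k::field \<Rightarrow> 'k \<Rightarrow> 'k \<Rightarrow> (gen, 'k) free_alg set" where
  "sklyanin p q r =
     {Poly_Mapping.single [Gy, Gz] p + Poly_Mapping.single [Gz, Gy] q + Poly_Mapping.single [Gx, Gx] r,
      Poly_Mapping.single [Gz, Gx] p + Poly_Mapping.single [Gx, Gz] q + Poly_Mapping.single [Gy, Gy] r,
      Poly_Mapping.single [Gx, Gy] p + Poly_Mapping.single [Gy, Gx] q + Poly_Mapping.single [Gz, Gz] r}"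

lemma sklyanin_quadratic: "sklyanin p q r \<subseteq> homogeneous 2"
  unfolding sklyanin_def homogeneous_def
  by (auto dest!: subsetD[OF Poly_Mapping.keys_add] split: if_splits)

end

theory Submission
  imports Defs
begin

text \<open>
  Write \<open>A = T/I\<close> for the algebra, where \<open>T\<close> is the free algebra. Linear maps between free modules are lifted to matrices over \<open>T\<close>, so that
  Koszulness follows from a sequence of matrices of linear forms that is exact modulo \<open>I\<close>.

  In the nondegenerate case let first the field be algebraically closed. The relations, evaluated at
  a point in their first factor, form a matrix that has rank at least 2 at every point. Therefore
  every module \<open>A/(hA + kA)\<close> with independent linear forms \<open>h\<close>, \<open>k\<close> has dimension at most 1 in every
  degree. The matrix is singular at some point of the line \<open>h = 0\<close>, since its determinant is a cubic
  form. This gives a relation \<open>h s + k h'\<close> with \<open>h' \<noteq> 0\<close>, so that \<open>A/hA\<close> is an extension of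
  \<open>A/(hA + kA)\<close> by a quotient of \<open>A/h'A\<close>, and by induction \<open>dim (A/hA)\<^sub>n \<le> n + 1\<close> for all \<open>h \<noteq> 0\<close>.
  Thus \<open>dim A\<^sub>n \<le> dim A\<^sub>n\<^sub>-\<^sub>1 + n + 1\<close>, and equality means that left multiplication by \<open>h\<close> is
  injective. Conversely, if no element is annihilated by all letters from the left, the inclusion of
  boundaries into cycles in \<open>0 \<rightarrow> A \<rightarrow> A\<^sup>3 \<rightarrow> A\<^sup>3 \<rightarrow> A\<close> bounds \<open>dim A\<^sub>n\<close> from below by the same
  numbers. So both bounds are attained, and the complex is exact. The upper bound and the injectivity
  descend to the original field along a linear retraction of its algebraic closure.

  In the remaining cases \<open>A\<close> is free, or the relations are monomial, or \<open>p\<^sup>3 = q\<^sup>3 = r\<^sup>3 \<noteq> 0\<close> and the relations form a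
  Groebner basis with leading words \<open>xx\<close>, \<open>xy\<close>, \<open>xz\<close>. In the latter two cases there is a
  resolution with constant ranks 3, and \<open>dim A\<^sub>3 > 10\<close>.
\<close>

section \<open>The free algebra\<close>

text \<open>The symmetry behind all matrices is that of \<open>cubic_tensor\<close>, which equals
  both the sum of the \<open>r_j v_j\<close> and the sum of the \<open>v_j r_j\<close>, with
  relations \<open>r_j\<close> and letters \<open>v_j\<close>. Hence one matrix \<open>smat\<close>
  gives the relations when multiplied by the row of letters from the left and by the column of
  letters from the right. The conditions on \<open>p\<close>, \<open>q\<close>, \<open>r\<close>
  enter through the 2x2 minors of the matrix of relations at a point: in the nondegenerate case they
  have no common zero. The closed field is used for a single purpose, to let every line meet the
  cubic \<open>det3\<close>. The two bounds depend on each other. The lower bound in degree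
  \<open>n + 1\<close> uses that no element of degree at most \<open>n - 2\<close> is annihilated by
  all letters; this follows from injectivity of left multiplication by \<open>x\<close>, which in
  degree \<open>n\<close> is read off from the equality of the bounds in degree
  \<open>n + 1\<close>. The gap between these degrees permits one simultaneous induction. Dimensions
  are counted for the components of \<open>I\<close> inside \<open>T\<close>. An upper bound for
  \<open>A\<close> therefore appears as a lower bound for \<open>I\<close>, and tuples are encoded
  as elements of \<open>T\<close>.\<close>

abbreviation cst :: "'k::field \<Rightarrow> ('x, 'k) free_alg" where
  "cst c \<equiv> Poly_Mapping.single [] c"

definition var :: "'x \<Rightarrow> ('x, 'k::field) free_alg" where
  "var a = Poly_Mapping.single [a] 1"

definition word :: "'x list \<Rightarrow> ('x, 'k::field) free_alg" where
  "word w = Poly_Mapping.single w 1"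

lemma single_mult_single [simp]:
  "Poly_Mapping.single u a * Poly_Mapping.single v b =
    Poly_Mapping.single (u @ v) (a * b :: 'k::field)"
  by (simp add: mult_single plus_list_def)

lemma cst_1 [simp]: "cst (1 :: 'k::field) = 1"
  by (metis single_one zero_list_def)

lemma word_Nil [simp]: "word [] = 1"
  by (simp add: word_def)

lemma word_Cons: "word (a # w) = var a * word w"
  by (simp add: word_def var_def)

lemma free_alg_induct [case_names zero add]:
  fixes f :: "('x, 'k::field) free_alg"
  assumes "P 0" and "\<And>w c f. P f \<Longrightarrow> P (Poly_Mapping.single w c + f)"
  shows "P f"
proof (induction f rule: update_induct)
  case const
  show ?case using assms(1) .
next
  case (update f a b)
  have "Poly_Mapping.update a b f = Poly_Mapping.single a b + f"
    using update(1) by (intro poly_mapping_eqI)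
      (auto simp: lookup_update lookup_add lookup_single when_def in_keys_iff)
  then show ?case using assms(2) update by simp
qed

lemma cst_commute: "f * cst c = cst c * (f :: ('x, 'k::field) free_alg)"
  by (induction f rule: free_alg_induct) (simp_all add: algebra_simps)

lemma single_eq_cst_mult: "Poly_Mapping.single w c = cst c * word w"
  by (simp add: word_def)

lemma cst_left_commute: "f * (cst c * g) = cst c * (f * g :: ('x, 'k::field) free_alg)"
  by (metis cst_commute mult.assoc)

interpretation fa: vector_space "\<lambda>(c::'k::field) (f::('x, 'k) free_alg). cst c * f"
  by unfold_locales (simp_all add: algebra_simps single_add mult.assoc[symmetric])

section \<open>Linear maps given on words, and left division by letters\<close>

definition lin_ext :: "('x list \<Rightarrow> ('y, 'k::field) free_alg) \<Rightarrow> ('x, 'k) free_alg \<Rightarrow> ('y, 'k) free_alg"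
  where "lin_ext \<phi> f = (\<Sum>w \<in> Poly_Mapping.keys f. cst (Poly_Mapping.lookup f w) * \<phi> w)"

lemma lin_ext_superset:
  assumes "finite S" "Poly_Mapping.keys f \<subseteq> S"
  shows "lin_ext \<phi> f = (\<Sum>w \<in> S. cst (Poly_Mapping.lookup f w) * \<phi> w)"
  unfolding lin_ext_def using assms
  by (intro sum.mono_neutral_left) (auto simp: in_keys_iff)

lemma lin_ext_0 [simp]: "lin_ext \<phi> 0 = 0"
  by (simp add: lin_ext_def)

lemma lin_ext_single [simp]: "lin_ext \<phi> (Poly_Mapping.single w c) = cst c * \<phi> w"
  by (simp add: lin_ext_def)

lemma lin_ext_add [simp]: "lin_ext \<phi> (f + g) = lin_ext \<phi> f + lin_ext \<phi> g"
proof -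
  let ?S = "Poly_Mapping.keys f \<union> Poly_Mapping.keys g"
  have "Poly_Mapping.keys (f + g) \<subseteq> ?S" by (rule keys_add)
  then show ?thesis
    by (simp add: lin_ext_superset[of ?S] lookup_add single_add algebra_simps sum.distrib)
qed

lemma lin_ext_cst [simp]: "lin_ext \<phi> (cst c * f) = cst c * lin_ext \<phi> f"
  by (induction f rule: free_alg_induct) (simp_all add: algebra_simps flip: mult.assoc)

lemma lin_ext_uminus [simp]: "lin_ext \<phi> (- f) = - lin_ext \<phi> f"
  by (metis add.right_inverse lin_ext_0 lin_ext_add neg_eq_iff_add_eq_0)

lemma lin_ext_diff [simp]: "lin_ext \<phi> (f - g) = lin_ext \<phi> f - lin_ext \<phi> g"
  by (metis lin_ext_add lin_ext_uminus diff_conv_add_uminus)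

lemma lin_ext_sum: "lin_ext \<phi> (sum f A) = (\<Sum>a\<in>A. lin_ext \<phi> (f a))"
  by (induction A rule: infinite_finite_induct) simp_all

lemma lin_ext_word [simp]: "lin_ext \<phi> (word w) = \<phi> w"
  by (simp add: word_def)

lemma lin_ext_1 [simp]: "lin_ext \<phi> 1 = \<phi> []"
  by (metis lin_ext_word word_Nil)

lemma lin_ext_word_id [simp]: "lin_ext word f = f"
  by (induction f rule: free_alg_induct) (simp_all add: word_def)

lemma lin_ext_var_mult: "lin_ext \<phi> (var a * f) = lin_ext (\<lambda>w. \<phi> (a # w)) f"
  by (induction f rule: free_alg_induct) (simp_all add: algebra_simps var_def)

lemma mult_lin_ext: "g * lin_ext \<phi> f = lin_ext (\<lambda>w. g * \<phi> w) f"
  by (induction f rule: free_alg_induct) (simp_all add: algebra_simps cst_left_commute)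

lemma lin_ext_comp: "lin_ext \<phi> (lin_ext \<psi> f) = lin_ext (\<lambda>w. lin_ext \<phi> (\<psi> w)) f"
  by (induction f rule: free_alg_induct) (simp_all add: algebra_simps)

lemma lin_ext_zero [simp]: "lin_ext (\<lambda>w. 0) f = 0"
  by (simp add: lin_ext_def)

lemma lin_ext_closed:
  assumes "0 \<in> S" "\<And>f g. f \<in> S \<Longrightarrow> g \<in> S \<Longrightarrow> f + g \<in> S" "\<And>c f. f \<in> S \<Longrightarrow> cst c * f \<in> S"
    "\<And>w. w \<in> Poly_Mapping.keys f \<Longrightarrow> \<phi> w \<in> S"
  shows "lin_ext \<phi> f \<in> S"
  proof -
  have "(\<Sum>w\<in>T. cst (Poly_Mapping.lookup f w) * \<phi> w) \<in> S" if "finite T" "T \<subseteq> Poly_Mapping.keys f" for T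
    using that by induction (auto intro!: assms)
  then show ?thesis by (simp add: lin_ext_def)
qed

text \<open>\<open>T\<close> is the direct sum of the constants and the right ideals generated by
  the letters, each free of rank one. \<open>left_quot a\<close> is the coordinate at
  \<open>a\<close>; identities between combinations of letters are split by comparing these
  coordinates.\<close>

definition left_quot :: "'x \<Rightarrow> ('x, 'k::field) free_alg \<Rightarrow> ('x, 'k) free_alg" where
  "left_quot a = lin_ext (\<lambda>w. case w of [] \<Rightarrow> 0 | b # v \<Rightarrow> if a = b then word v else 0)"

lemma left_quot_add [simp]: "left_quot a (f + g) = left_quot a f + left_quot a g"
  by (simp add: left_quot_def)

lemma left_quot_0 [simp]: "left_quot a 0 = 0"
  by (simp add: left_quot_def)

lemma left_quot_sum [simp]: "left_quot a (sum f A) = (\<Sum>x\<in>A. left_quot a (f x))"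
  by (simp add: left_quot_def lin_ext_sum)

lemma left_quot_cst_mult [simp]: "left_quot a (cst c * f) = cst c * left_quot a f"
  by (simp add: left_quot_def)

lemma left_quot_var_mult [simp]: "left_quot a (var b * f) = (if a = b then f else 0)"
  by (simp add: left_quot_def lin_ext_var_mult)

lemma left_quot_cst [simp]: "left_quot a (cst c) = 0"
  by (simp add: left_quot_def)

lemma var_mult_inj [simp]: "var a * f = var a * g \<longleftrightarrow> f = (g :: ('x, 'k::field) free_alg)"
  by (metis left_quot_var_mult)

lemma free_alg_expand:
  fixes f :: "('x::finite, 'k::field) free_alg"
  shows "f = cst (Poly_Mapping.lookup f []) + (\<Sum>a\<in>UNIV. var a * left_quot a f)"
proof (induction f rule: free_alg_induct)
  case (add w c f)
  have "Poly_Mapping.single w c = cst (Poly_Mapping.lookup (Poly_Mapping.single w c) []) +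
     (\<Sum>a\<in>UNIV. var a * left_quot a (Poly_Mapping.single w c :: ('x, 'k) free_alg))"
  proof (cases w)
    case (Cons b v)
    have "Poly_Mapping.single w c = var b * Poly_Mapping.single v c"
      by (simp add: Cons var_def)
    then have "var a * left_quot a (Poly_Mapping.single w c :: ('x, 'k) free_alg) =
      (if a = b then Poly_Mapping.single w c else 0)" for a
      by simp
    then show ?thesis by (simp add: Cons lookup_single)
  qed simp
  then show ?case
    using add by (simp add: lookup_add single_add algebra_simps sum.distrib)
qed simp

section \<open>Homogeneous components\<close>

definition hcomp :: "nat \<Rightarrow> ('x, 'k::field) free_alg \<Rightarrow> ('x, 'k) free_alg" where
  "hcomp n = lin_ext (\<lambda>w. if length w = n then word w else 0)"

lemma hcomp_0 [simp]: "hcomp n 0 = 0"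
  by (simp add: hcomp_def)

lemma hcomp_add [simp]: "hcomp n (f + g) = hcomp n f + hcomp n g"
  by (simp add: hcomp_def)

lemma hcomp_diff [simp]: "hcomp n (f - g) = hcomp n f - hcomp n g"
  by (simp add: hcomp_def)

lemma hcomp_uminus [simp]: "hcomp n (- f) = - hcomp n f"
  by (simp add: hcomp_def)

lemma hcomp_sum: "hcomp n (sum f A) = (\<Sum>a\<in>A. hcomp n (f a))"
  by (simp add: hcomp_def lin_ext_sum)

lemma hcomp_cst_mult [simp]: "hcomp n (cst c * f) = cst c * hcomp n f"
  by (simp add: hcomp_def)

lemma hcomp_single: "hcomp n (Poly_Mapping.single w c) = (if length w = n then Poly_Mapping.single w c else 0)"
  by (simp add: hcomp_def word_def)

lemma lookup_hcomp: "Poly_Mapping.lookup (hcomp n f) w = (if length w = n then Poly_Mapping.lookup f w else 0)"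
  by (induction f rule: free_alg_induct)
    (auto simp: algebra_simps lookup_add hcomp_single lookup_single when_def)

lemma homogeneous_iff_hcomp: "f \<in> homogeneous n \<longleftrightarrow> hcomp n f = f"
proof -
  have "hcomp n f = f \<longleftrightarrow> (\<forall>w. length w \<noteq> n \<longrightarrow> Poly_Mapping.lookup f w = 0)"
    by (auto simp: poly_mapping_eq_iff fun_eq_iff lookup_hcomp)
  then show ?thesis by (auto simp: homogeneous_def in_keys_iff)
qed

lemma hcomp_in_homogeneous [simp, intro]: "hcomp n f \<in> homogeneous n"
  by (auto simp: homogeneous_def in_keys_iff lookup_hcomp split: if_splits)

lemma hcomp_homogeneous: "f \<in> homogeneous m \<Longrightarrow> hcomp n f = (if m = n then f else 0)"
  by (intro poly_mapping_eqI) (auto simp: homogeneous_def in_keys_iff lookup_hcomp)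

lemma homogeneous_0 [simp, intro]: "0 \<in> homogeneous n"
  by (simp add: homogeneous_iff_hcomp)

lemma homogeneous_add [intro]: "f \<in> homogeneous n \<Longrightarrow> g \<in> homogeneous n \<Longrightarrow> f + g \<in> homogeneous n"
  by (simp add: homogeneous_iff_hcomp)

lemma homogeneous_uminus [intro]: "f \<in> homogeneous n \<Longrightarrow> - f \<in> homogeneous n"
  by (simp add: homogeneous_iff_hcomp)

lemma homogeneous_sum [intro]: "(\<And>a. a \<in> A \<Longrightarrow> f a \<in> homogeneous n) \<Longrightarrow> sum f A \<in> homogeneous n"
  by (simp add: homogeneous_iff_hcomp hcomp_sum)

lemma homogeneous_mult [intro]:
  "f \<in> homogeneous m \<Longrightarrow> g \<in> homogeneous n \<Longrightarrow> f * g \<in> homogeneous (m + n)"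
  unfolding homogeneous_def using keys_mult[of f g] by (fastforce simp: plus_list_def)

lemma homogeneous_cst [simp]: "cst c \<in> homogeneous 0"
  by (simp add: homogeneous_def)

lemma homogeneous_1 [simp]: "1 \<in> homogeneous 0"
  using homogeneous_cst[of 1] by simp

lemma homogeneous_var [simp]: "var a \<in> homogeneous 1"
  by (simp add: homogeneous_def var_def)

lemma homogeneous_word [simp]: "word w \<in> homogeneous (length w)"
  by (simp add: homogeneous_def word_def)

lemma homogeneous_cst_mult [intro]: "f \<in> homogeneous n \<Longrightarrow> cst c * f \<in> homogeneous n"
  by (simp add: homogeneous_iff_hcomp)

lemma homogeneous_var_mult [intro]: "f \<in> homogeneous n \<Longrightarrow> var a * f \<in> homogeneous (Suc n)"
  using homogeneous_mult[OF homogeneous_var[of a], of f n] by simp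

lemma hcomp_homogeneous_mult:
  assumes "g \<in> homogeneous m"
  shows "hcomp (m + n) (g * f) = g * hcomp n f" "hcomp (n + m) (f * g) = hcomp n f * g"
proof -
  show "hcomp (m + n) (g * f) = g * hcomp n f"
  proof (induction f rule: free_alg_induct)
    case (add w c f)
    have "g * Poly_Mapping.single w c \<in> homogeneous (m + length w)"
      using assms by (rule homogeneous_mult) (simp add: homogeneous_def)
    then show ?case
      using add by (auto simp: algebra_simps hcomp_homogeneous hcomp_single)
  qed simp
  show "hcomp (n + m) (f * g) = hcomp n f * g"
  proof (induction f rule: free_alg_induct)
    case (add w c f)
    have "Poly_Mapping.single w c * g \<in> homogeneous (length w + m)"
      using assms by (intro homogeneous_mult) (simp add: homogeneous_def)
    then show ?case
      using add by (auto simp: algebra_simps hcomp_homogeneous hcomp_single)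
  qed simp
qed

lemma hcomp_homogeneous_mult_less:
  assumes "g \<in> homogeneous m" "n < m"
  shows "hcomp n (g * f) = 0" "hcomp n (f * g) = 0"
proof -
  have "length v \<noteq> n" if "v \<in> Poly_Mapping.keys (g * f)" for v
    using that keys_mult[of g f] assms by (fastforce simp: homogeneous_def plus_list_def)
  then show "hcomp n (g * f) = 0"
    by (intro poly_mapping_eqI) (auto simp: lookup_hcomp in_keys_iff)
  have "length v \<noteq> n" if "v \<in> Poly_Mapping.keys (f * g)" for v
    using that keys_mult[of f g] assms by (fastforce simp: homogeneous_def plus_list_def)
  then show "hcomp n (f * g) = 0"
    by (intro poly_mapping_eqI) (auto simp: lookup_hcomp in_keys_iff)
qed

lemma hcomp_Suc_var_mult [simp]: "hcomp (Suc n) (var a * f) = var a * hcomp n f"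
  using hcomp_homogeneous_mult(1)[OF homogeneous_var[of a], of n f] by simp

lemma hcomp_0_var_mult [simp]: "hcomp 0 (var a * f) = 0"
  using hcomp_homogeneous_mult_less(1)[OF homogeneous_var[of a], of 0 f] by simp

lemma hcomp_vanish: "finite {n. hcomp n f \<noteq> 0}"
proof -
  have "{n. hcomp n f \<noteq> 0} \<subseteq> length ` Poly_Mapping.keys f"
    by (force simp: poly_mapping_eq_iff fun_eq_iff lookup_hcomp in_keys_iff split: if_splits)
  then show ?thesis by (rule finite_subset) simp
qed

lemma sum_hcomp:
  assumes "finite S" "{n. hcomp n f \<noteq> 0} \<subseteq> S"
  shows "(\<Sum>n\<in>S. hcomp n f) = f"
proof (rule poly_mapping_eqI)
  fix w
  have "Poly_Mapping.lookup (\<Sum>n\<in>S. hcomp n f) w =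
      (if length w \<in> S then Poly_Mapping.lookup f w else 0)"
    by (simp add: lookup_sum lookup_hcomp assms(1))
  moreover have "Poly_Mapping.lookup f w = 0" if "length w \<notin> S"
  proof -
    have "hcomp (length w) f = 0" using that assms(2) by blast
    then show ?thesis by (metis lookup_hcomp lookup_zero)
  qed
  ultimately show "Poly_Mapping.lookup (\<Sum>n\<in>S. hcomp n f) w = Poly_Mapping.lookup f w" by auto
qed

lemma homogeneous_Suc_expand:
  fixes f :: "('x::finite, 'k::field) free_alg"
  assumes "f \<in> homogeneous (Suc n)"
  shows "f = (\<Sum>a\<in>UNIV. var a * left_quot a f)" "\<And>a. left_quot a f \<in> homogeneous n"
proof -
  have "Poly_Mapping.lookup f [] = 0"
    using assms by (force simp: homogeneous_def in_keys_iff)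
  then show eq: "f = (\<Sum>a\<in>UNIV. var a * left_quot a f)"
    using free_alg_expand[of f] by simp
  have "left_quot a f = left_quot a (hcomp (Suc n) f)" for a
    using assms by (simp add: homogeneous_iff_hcomp)
  also have "\<dots> a = left_quot a (hcomp (Suc n) (\<Sum>b\<in>UNIV. var b * left_quot b f))" for a
    using eq by simp
  also have "\<dots> a = hcomp n (left_quot a f)" for a
    by (simp add: hcomp_sum)
  finally show "left_quot a f \<in> homogeneous n" for a by (metis hcomp_in_homogeneous)
qed

lemma homogeneous_0_cst: "f \<in> homogeneous 0 \<Longrightarrow> f = cst (Poly_Mapping.lookup f [])"
  by (simp add: homogeneous_iff_hcomp poly_mapping_eq_iff fun_eq_iff lookup_hcomp lookup_single when_def)
    (metis length_0_conv)

section \<open>Ideals of relations and quotients\<close>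

lemma free_algebra_simps [simp]:
  "carrier free_algebra = UNIV" "monoid.mult free_algebra = (*)" "one free_algebra = 1"
  "zero free_algebra = 0" "add free_algebra = (+)"
  by (simp_all add: free_algebra_def ring_of_type_algebra_def)

lemma ring_free_algebra: "ring (free_algebra :: ('x, 'k::field) free_alg ring)"
proof (rule ringI)
  have "\<exists>y. y + x = 0" for x :: "('x, 'k) free_alg" by (rule exI[of _ "- x"]) simp
  then show "abelian_group (free_algebra :: ('x, 'k) free_alg ring)"
    by (intro abelian_groupI) (simp_all add: ac_simps)
  show "monoid (free_algebra :: ('x, 'k) free_alg ring)"
    by (rule monoidI) (simp_all add: mult.assoc)
qed (simp_all add: algebra_simps)

context
  fixes R :: "('x, 'k::field) free_alg set"
begin

lemma ideal_rel_ideal: "ideal (rel_ideal R) free_algebra"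
  unfolding rel_ideal_def by (rule ring.genideal_ideal[OF ring_free_algebra]) simp

lemma rel_ideal_gen: "f \<in> R \<Longrightarrow> f \<in> rel_ideal R"
  unfolding rel_ideal_def using ring.genideal_self[OF ring_free_algebra, of R] by auto

lemma rel_ideal_0 [simp, intro]: "0 \<in> rel_ideal R"
  using additive_subgroup.zero_closed[OF ideal.axioms(1)[OF ideal_rel_ideal]] by simp

lemma rel_ideal_add [intro]: "f \<in> rel_ideal R \<Longrightarrow> g \<in> rel_ideal R \<Longrightarrow> f + g \<in> rel_ideal R"
  using additive_subgroup.a_closed[OF ideal.axioms(1)[OF ideal_rel_ideal]] by simp

lemma rel_ideal_mult_left [intro]: "f \<in> rel_ideal R \<Longrightarrow> g * f \<in> rel_ideal R"
  using ideal.I_l_closed[OF ideal_rel_ideal] by simp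

lemma rel_ideal_mult_right [intro]: "f \<in> rel_ideal R \<Longrightarrow> f * g \<in> rel_ideal R"
  using ideal.I_r_closed[OF ideal_rel_ideal] by simp

lemma rel_ideal_uminus [intro]: "f \<in> rel_ideal R \<Longrightarrow> - f \<in> rel_ideal R"
  using rel_ideal_mult_left[of f "-1"] by simp

lemma rel_ideal_diff [intro]: "f \<in> rel_ideal R \<Longrightarrow> g \<in> rel_ideal R \<Longrightarrow> f - g \<in> rel_ideal R"
  using rel_ideal_add[OF _ rel_ideal_uminus, of f g] by simp

lemma rel_ideal_sum [intro]: "(\<And>a. a \<in> A \<Longrightarrow> f a \<in> rel_ideal R) \<Longrightarrow> sum f A \<in> rel_ideal R"
  by (induction A rule: infinite_finite_induct) auto

lemma rel_ideal_diff_trans: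
  "f - g \<in> rel_ideal R \<Longrightarrow> g - h \<in> rel_ideal R \<Longrightarrow> f - h \<in> rel_ideal R"
  using rel_ideal_add[of "f - g" "g - h"] by simp

lemma rel_ideal_diff_sym: "f - g \<in> rel_ideal R \<Longrightarrow> g - f \<in> rel_ideal R"
  using rel_ideal_uminus[of "f - g"] by simp

text \<open>Central scalars and letters generate the free algebra, so closure under them already
  makes \<open>J\<close> a two-sided ideal. This serves as the induction rule for membership in
  \<open>rel_ideal R\<close>.\<close>

lemma rel_ideal_minimal:
  assumes "f \<in> rel_ideal R" "R \<subseteq> J" "0 \<in> J"
    and add: "\<And>f g. f \<in> J \<Longrightarrow> g \<in> J \<Longrightarrow> f + g \<in> J"
    and left: "\<And>f c. f \<in> J \<Longrightarrow> cst c * f \<in> J" "\<And>f a. f \<in> J \<Longrightarrow> var a * f \<in> J"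
    and right: "\<And>f a. f \<in> J \<Longrightarrow> f * var a \<in> J"
  shows "f \<in> J"
proof -
  have left_word: "word w * f \<in> J" if "f \<in> J" for w f
    using that by (induction w) (simp_all add: word_Cons mult.assoc left)
  have l: "g * f \<in> J" if f: "f \<in> J" for g f
  proof (induction g rule: free_alg_induct)
    case (add w c g)
    have "(Poly_Mapping.single w c + g) * f = cst c * (word w * f) + g * f"
      unfolding single_eq_cst_mult[of w c] by (simp only: distrib_right mult.assoc)
    also have "\<dots> \<in> J"
      by (intro assms(4) left(1) left_word f add)
    finally show ?case .
  qed (use assms(3) in simp)
  have right_word: "f * word w \<in> J" if "f \<in> J" for w f
    using that by (induction w arbitrary: f) (simp_all add: word_Cons mult.assoc[symmetric] right)
  have r: "f * g \<in> J" if f: "f \<in> J" for g f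
  proof (induction g rule: free_alg_induct)
    case (add w c g)
    have "f * (Poly_Mapping.single w c + g) = cst c * (f * word w) + f * g"
      unfolding single_eq_cst_mult[of w c] by (simp only: distrib_left cst_left_commute)
    also have "\<dots> \<in> J"
      by (intro assms(4) left(1) right_word f add)
    finally show ?case .
  qed (use assms(3) in simp)
  interpret F: ring "free_algebra :: ('x, 'k) free_alg ring" by (rule ring_free_algebra)
  have "ideal J free_algebra"
  proof (rule idealI[OF ring_free_algebra])
    show "subgroup J (add_monoid (free_algebra :: ('x, 'k) free_alg ring))"
    proof (rule F.add.subgroupI)
      fix f assume "f \<in> J"
      have "\<ominus>\<^bsub>free_algebra\<^esub> f = - f" by (rule F.minus_equality) simp_all
      then show "\<ominus>\<^bsub>free_algebra\<^esub> f \<in> J"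
        using l[OF \<open>f \<in> J\<close>, of "-1"] by simp
    qed (use assms(3) add in auto)
  qed (use l r in simp_all)
  then have "rel_ideal R \<subseteq> J"
    unfolding rel_ideal_def using ring.genideal_minimal[OF ring_free_algebra] assms(2) by blast
  then show ?thesis using assms(1) by blast
qed

lemma quad_class_eq: "quad_class R f = {i + f | i. i \<in> rel_ideal R}"
  by (auto simp: quad_class_def a_r_coset_def r_coset_def)

lemma quad_class_eq_iff: "quad_class R f = quad_class R g \<longleftrightarrow> f - g \<in> rel_ideal R"
proof
  assume "quad_class R f = quad_class R g"
  moreover have "f \<in> quad_class R f"
    unfolding quad_class_eq by (rule CollectI, rule exI[of _ 0]) simp
  ultimately show "f - g \<in> rel_ideal R" by (auto simp: quad_class_eq)
next
  assume fg: "f - g \<in> rel_ideal R"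
  have "i + f \<in> quad_class R g" if "i \<in> rel_ideal R" for i
    unfolding quad_class_eq by (rule CollectI, rule exI[of _ "i + (f - g)"]) (use that fg in auto)
  moreover have "i + g \<in> quad_class R f" if "i \<in> rel_ideal R" for i
    unfolding quad_class_eq by (rule CollectI, rule exI[of _ "i - (f - g)"]) (use that fg in auto)
  ultimately show "quad_class R f = quad_class R g"
    by (auto simp: quad_class_eq)
qed

lemma carrier_quad_alg: "carrier (quad_alg R) = range (quad_class R)"
  by (auto simp: quad_alg_def FactRing_def A_RCOSETS_def RCOSETS_def quad_class_def a_r_coset_def)

lemma quad_class_carrier [simp, intro]: "quad_class R f \<in> carrier (quad_alg R)"
  by (simp add: carrier_quad_alg)

lemma quad_alg_add [simp]:
  "quad_class R f \<oplus>\<^bsub>quad_alg R\<^esub> quad_class R g = quad_class R (f + g)"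
proof -
  interpret ideal "rel_ideal R" free_algebra by (rule ideal_rel_ideal)
  show ?thesis using a_rcos_sum[of f g] by (simp add: quad_alg_def FactRing_def quad_class_def)
qed

lemma quad_alg_mult [simp]:
  "quad_class R f \<otimes>\<^bsub>quad_alg R\<^esub> quad_class R g = quad_class R (f * g)"
  using ideal.rcoset_mult_add[OF ideal_rel_ideal, of f g]
  by (simp add: quad_alg_def FactRing_def quad_class_def)

lemma quad_alg_one: "\<one>\<^bsub>quad_alg R\<^esub> = quad_class R 1"
  by (simp add: quad_alg_def FactRing_def quad_class_def)

lemma quad_alg_zero: "\<zero>\<^bsub>quad_alg R\<^esub> = quad_class R 0"
  by (simp add: quad_alg_def FactRing_def quad_class_eq)

lemma quad_class_eq_zero_iff: "quad_class R f = \<zero>\<^bsub>quad_alg R\<^esub> \<longleftrightarrow> f \<in> rel_ideal R"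
  by (simp add: quad_alg_zero quad_class_eq_iff)

lemma ring_quad_alg: "ring (quad_alg R)"
  unfolding quad_alg_def by (rule ideal.quotient_is_ring[OF ideal_rel_ideal])

definition quad_rep :: "('x, 'k) free_alg set \<Rightarrow> ('x, 'k) free_alg" where
  "quad_rep a = (SOME f. quad_class R f = a)"

lemma quad_class_rep [simp]: "a \<in> carrier (quad_alg R) \<Longrightarrow> quad_class R (quad_rep a) = a"
  unfolding quad_rep_def by (rule someI_ex) (auto simp: carrier_quad_alg)

lemma quad_rep_class: "quad_rep (quad_class R f) - f \<in> rel_ideal R"
  by (simp flip: quad_class_eq_iff)

end

text \<open>In short \<open>I = V I + R T\<close>, where \<open>V\<close> is the span of the
  letters: in a product \<open>u r v\<close> either the word \<open>u\<close> is empty, or it begins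
  with a letter that is followed by an element of \<open>I\<close>. Exactness at the first step and
  the recursion for the components of \<open>I\<close> rest on this.\<close>

lemma rel_ideal_decomp:
  fixes r :: "nat \<Rightarrow> ('x::finite, 'k::field) free_alg"
  assumes "f \<in> rel_ideal (r ` {..<m})"
  shows "\<exists>g h. (\<forall>a. g a \<in> rel_ideal (r ` {..<m})) \<and>
    f = (\<Sum>a\<in>UNIV. var a * g a) + (\<Sum>j<m. r j * h j)"
proof -
  let ?I = "rel_ideal (r ` {..<m})"
  define J where "J = {f. \<exists>g h. (\<forall>a. g a \<in> ?I) \<and> f = (\<Sum>a\<in>UNIV. var a * g a) + (\<Sum>j<m. r j * h j)}"
  have JI: "f \<in> ?I" if "f \<in> J" for f
    proof -
    obtain g h where *: "\<And>a. g a \<in> ?I" "f = (\<Sum>a\<in>UNIV. var a * g a) + (\<Sum>j<m. r j * h j)"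
      using \<open>f \<in> J\<close> unfolding J_def by auto
    show ?thesis unfolding *(2)
      by (intro rel_ideal_add rel_ideal_sum rel_ideal_mult_left rel_ideal_mult_right *(1))
        (auto intro: rel_ideal_gen)
  qed
  have J_I: "f \<in> J" if "\<And>a. g a \<in> ?I" "f = (\<Sum>a\<in>UNIV. var a * g a) + (\<Sum>j<m. r j * h j)" for f g h
    unfolding J_def using that by blast
  from assms have "f \<in> J"
  proof (rule rel_ideal_minimal)
    show "0 \<in> J" by (rule J_I[of "\<lambda>_. 0" _ "\<lambda>_. 0"]) simp_all
    show "r ` {..<m} \<subseteq> J"
    proof
      fix f assume "f \<in> r ` {..<m}"
      then obtain j where j: "j < m" "f = r j" by auto
      have "(\<Sum>i<m. r i * (if i = j then 1 else 0)) = (\<Sum>i<m. if i = j then r j else 0)"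
        by (rule sum.cong) auto
      also have "\<dots> = f" using j by simp
      finally show "f \<in> J"
        by (intro J_I[of "\<lambda>_. 0" _ "\<lambda>i. if i = j then 1 else 0"]) simp_all
    qed
    fix f g assume "f \<in> J" "g \<in> J"
    then obtain g1 h1 g2 h2 where "\<And>a. g1 a \<in> ?I" "\<And>a. g2 a \<in> ?I"
      "f = (\<Sum>a\<in>UNIV. var a * g1 a) + (\<Sum>j<m. r j * h1 j)"
      "g = (\<Sum>a\<in>UNIV. var a * g2 a) + (\<Sum>j<m. r j * h2 j)"
      unfolding J_def by auto
    then show "f + g \<in> J"
      by (intro J_I[of "\<lambda>a. g1 a + g2 a" _ "\<lambda>j. h1 j + h2 j"])
        (auto simp: algebra_simps sum.distrib)
  next
    fix f c assume "f \<in> J"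
    then obtain g h where "\<And>a. g a \<in> ?I" "f = (\<Sum>a\<in>UNIV. var a * g a) + (\<Sum>j<m. r j * h j)"
      unfolding J_def by auto
    then show "cst c * f \<in> J"
      by (intro J_I[of "\<lambda>a. cst c * g a" _ "\<lambda>j. cst c * h j"])
        (auto simp: distrib_left sum_distrib_left cst_left_commute)
  next
    \<comment> \<open>Since \<open>f\<close> lies in \<open>I\<close>, the product
      \<open>var a * f\<close> is already a summand of the first kind.\<close>
    fix f a assume "f \<in> J"
    have "(\<Sum>b\<in>UNIV. var b * (if b = a then f else 0)) = (\<Sum>b\<in>UNIV. if b = a then var a * f else 0)"
      by (rule sum.cong) auto
    then show "var a * f \<in> J"
      using JI[OF \<open>f \<in> J\<close>] by (intro J_I[of "\<lambda>b. if b = a then f else 0" _ "\<lambda>_. 0"]) auto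
  next
    fix f a assume "f \<in> J"
    then obtain g h where "\<And>a. g a \<in> ?I" "f = (\<Sum>a\<in>UNIV. var a * g a) + (\<Sum>j<m. r j * h j)"
      unfolding J_def by auto
    then show "f * var a \<in> J"
      by (intro J_I[of "\<lambda>b. g b * var a" _ "\<lambda>j. h j * var a"])
        (auto simp: distrib_right sum_distrib_right mult.assoc)
  qed
  then show ?thesis by (simp add: J_def)
qed

lemma hcomp_rel_ideal:
  assumes R: "R \<subseteq> homogeneous d" and "f \<in> rel_ideal R"
  shows "hcomp n f \<in> rel_ideal R"
proof -
  have "f \<in> {f. \<forall>n. hcomp n f \<in> rel_ideal R}"
    using assms(2)
  proof (rule rel_ideal_minimal)
    show "R \<subseteq> {f. \<forall>n. hcomp n f \<in> rel_ideal R}"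
      using R by (auto simp: hcomp_homogeneous rel_ideal_gen subset_iff)
    fix f :: "('a, 'b) free_alg" and a assume f: "f \<in> {f. \<forall>n. hcomp n f \<in> rel_ideal R}"
    have "hcomp n (var a * f) \<in> rel_ideal R" for n
      using f by (cases n) auto
    then show "var a * f \<in> {f. \<forall>n. hcomp n f \<in> rel_ideal R}" by simp
    have "hcomp n (f * var a) \<in> rel_ideal R" for n
    proof (cases n)
      case 0
      then show ?thesis using hcomp_homogeneous_mult_less(2)[OF homogeneous_var[of a], of 0 f] by simp
    next
      case (Suc k)
      then show ?thesis using f hcomp_homogeneous_mult(2)[OF homogeneous_var[of a], of k f] by auto
    qed
    then show "f * var a \<in> {f. \<forall>n. hcomp n f \<in> rel_ideal R}" by simp
  qed auto
  then show ?thesis by simp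
qed

lemma hcomp_rel_ideal_less:
  assumes R: "R \<subseteq> homogeneous d" and "f \<in> rel_ideal R" "n < d"
  shows "hcomp n f = 0"
proof -
  have "f \<in> {f. \<forall>n<d. hcomp n f = 0}"
    using assms(2)
  proof (rule rel_ideal_minimal)
    show "R \<subseteq> {f. \<forall>n<d. hcomp n f = 0}"
      using R by (auto simp: hcomp_homogeneous subset_iff)
    fix f :: "('a, 'b) free_alg" and a assume f: "f \<in> {f. \<forall>n<d. hcomp n f = 0}"
    have "hcomp n (var a * f) = 0" if "n < d" for n
      using f that by (cases n) auto
    then show "var a * f \<in> {f. \<forall>n<d. hcomp n f = 0}" by simp
    have "hcomp n (f * var a) = 0" if "n < d" for n
    proof (cases n)
      case 0
      then show ?thesis using hcomp_homogeneous_mult_less(2)[OF homogeneous_var[of a], of 0 f] by simp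
    next
      case (Suc k)
      then show ?thesis using that f hcomp_homogeneous_mult(2)[OF homogeneous_var[of a], of k f] by auto
    qed
    then show "f * var a \<in> {f. \<forall>n<d. hcomp n f = 0}" by simp
  qed auto
  then show ?thesis using assms by simp
qed

lemma rel_ideal_iff_hcomp:
  assumes R: "R \<subseteq> homogeneous d"
  shows "f \<in> rel_ideal R \<longleftrightarrow> (\<forall>n. hcomp n f \<in> rel_ideal R)"
proof
  assume "\<forall>n. hcomp n f \<in> rel_ideal R"
  then have "(\<Sum>n\<in>{n. hcomp n f \<noteq> 0}. hcomp n f) \<in> rel_ideal R" by blast
  then show "f \<in> rel_ideal R" by (simp add: sum_hcomp[OF hcomp_vanish])
qed (use hcomp_rel_ideal[OF R] in blast)

section \<open>Koszulness from matrices of linear forms\<close>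

lemma augmentation_class:
  assumes R: "R \<subseteq> homogeneous 2"
  shows "augmentation (quad_class R f) = Poly_Mapping.lookup f []"
proof -
  have "Poly_Mapping.lookup i [] = 0" if "i \<in> rel_ideal R" for i
  proof -
    have "Poly_Mapping.lookup (hcomp 0 i) [] = 0"
      using hcomp_rel_ideal_less[OF R that, of 0] by simp
    then show ?thesis by (simp add: lookup_hcomp)
  qed
  then have "(\<lambda>f. Poly_Mapping.lookup f []) ` quad_class R f = {Poly_Mapping.lookup f []}"
    unfolding quad_class_eq by (force simp: lookup_add)
  then show ?thesis by (simp add: augmentation_def)
qed

text \<open>This is degree \<open>k\<close> of a copy of the algebra whose generator sits in degree
  \<open>m\<close>. Subtraction of naturals truncates, so without the test the degrees below
  \<open>m\<close> would receive the constants.\<close>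

definition shifted_hom :: "nat \<Rightarrow> nat \<Rightarrow> ('x, 'k::field) free_alg set" where
  "shifted_hom m k = (if m \<le> k then homogeneous (k - m) else {0})"

definition shifted_hcomp :: "nat \<Rightarrow> nat \<Rightarrow> ('x, 'k::field) free_alg \<Rightarrow> ('x, 'k) free_alg" where
  "shifted_hcomp m k f = (if m \<le> k then hcomp (k - m) f else 0)"

lemma shifted_hcomp_in [simp]: "shifted_hcomp m k f \<in> shifted_hom m k"
  by (simp add: shifted_hcomp_def shifted_hom_def)

lemma shifted_hom_0 [simp]: "0 \<in> shifted_hom m k"
  by (simp add: shifted_hom_def)

lemma shifted_hom_add: "f \<in> shifted_hom m k \<Longrightarrow> g \<in> shifted_hom m k \<Longrightarrow> f + g \<in> shifted_hom m k"
  by (auto simp: shifted_hom_def split: if_splits)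

lemma shifted_hom_uminus: "f \<in> shifted_hom m k \<Longrightarrow> - f \<in> shifted_hom m k"
  by (auto simp: shifted_hom_def split: if_splits)

lemma shifted_hom_mult: "f \<in> shifted_hom m k \<Longrightarrow> g \<in> homogeneous j \<Longrightarrow> f * g \<in> shifted_hom m (k + j)"
  by (auto simp: shifted_hom_def homogeneous_mult split: if_splits dest: homogeneous_mult[of f "k - m" g j])

lemma shifted_hcomp_diff: "shifted_hcomp m k (f - g) = shifted_hcomp m k f - shifted_hcomp m k g"
  by (simp add: shifted_hcomp_def)

lemma shifted_hcomp_rel_ideal:
  "R \<subseteq> homogeneous d \<Longrightarrow> f \<in> rel_ideal R \<Longrightarrow> shifted_hcomp m k f \<in> rel_ideal R"
  by (simp add: shifted_hcomp_def hcomp_rel_ideal)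

lemma shifted_hcomp_sum:
  assumes "finite S" "\<And>k. g k \<in> shifted_hom m k"
  shows "shifted_hcomp m k (sum g S) = (if k \<in> S then g k else 0)"
proof -
  have "shifted_hcomp m k (sum g S) = (\<Sum>j\<in>S. shifted_hcomp m k (g j))"
    by (simp add: shifted_hcomp_def hcomp_sum)
  also have "\<dots> = (\<Sum>j\<in>S. if j = k then g k else 0)"
  proof (rule sum.cong)
    fix j
    show "shifted_hcomp m k (g j) = (if j = k then g k else 0)"
      using assms(2)[of j] hcomp_homogeneous[of "g j" "j - m" "k - m"]
      by (auto simp: shifted_hcomp_def shifted_hom_def split: if_splits)
  qed simp
  finally show ?thesis using assms(1) by simp
qed

lemma shifted_hcomp_vanish: "finite {k. shifted_hcomp m k f \<noteq> 0}"
proof -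
  have "{k. shifted_hcomp m k f \<noteq> 0} \<subseteq> (+) m ` {n. hcomp n f \<noteq> 0}"
    by (force simp: shifted_hcomp_def split: if_splits intro: image_eqI[of _ _ "_ - m"])
  then show ?thesis by (rule finite_subset) (simp add: hcomp_vanish)
qed

lemma sum_shifted_hcomp:
  assumes "finite S" "{k. shifted_hcomp m k f \<noteq> 0} \<subseteq> S"
  shows "(\<Sum>k\<in>S. shifted_hcomp m k f) = f"
proof -
  have "shifted_hcomp m k f = 0" if "k \<notin> (+) m ` {n. hcomp n f \<noteq> 0}" for k
  proof (cases "m \<le> k")
    case True
    then have "k = m + (k - m)" by simp
    then have "hcomp (k - m) f = 0" using that by blast
    then show ?thesis by (simp add: shifted_hcomp_def)
  qed (simp add: shifted_hcomp_def)
  then have "(\<Sum>k\<in>S. shifted_hcomp m k f) = (\<Sum>k\<in>(+) m ` {n. hcomp n f \<noteq> 0}. shifted_hcomp m k f)"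
    by (intro sum.mono_neutral_right)
      (use assms in \<open>auto simp: shifted_hcomp_def\<close>)
  also have "\<dots> = (\<Sum>n\<in>{n. hcomp n f \<noteq> 0}. hcomp n f)"
    by (subst sum.reindex) (auto simp: shifted_hcomp_def)
  also have "\<dots> = f" by (simp add: sum_hcomp[OF hcomp_vanish])
  finally show ?thesis .
qed

section \<open>Free graded modules of finite rank and maps given by matrices\<close>

context
  fixes R :: "('x, 'k::field) free_alg set"
begin

text \<open>Tuples of length \<open>n\<close> are padded with the zero class, so that equality of
  functions is equality of tuples. They are given by representatives in \<open>T\<close>, where all
  computations take place.\<close>

definition vec_class :: "nat \<Rightarrow> (nat \<Rightarrow> ('x, 'k) free_alg) \<Rightarrow> nat \<Rightarrow> ('x, 'k) free_alg set" where
  "vec_class n f = (\<lambda>i. quad_class R (if i < n then f i else 0))"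

definition free_mod :: "nat \<Rightarrow> nat \<Rightarrow> (('x, 'k) free_alg set, nat \<Rightarrow> ('x, 'k) free_alg set) gr_module"
  where "free_mod m n =
    \<lparr>carrier = range (vec_class n), monoid.mult = undefined, one = undefined,
     zero = vec_class n (\<lambda>_. 0), add = (\<lambda>\<phi> \<psi> i. \<phi> i \<oplus>\<^bsub>quad_alg R\<^esub> \<psi> i),
     ract = (\<lambda>\<phi> a i. \<phi> i \<otimes>\<^bsub>quad_alg R\<^esub> a),
     component = (\<lambda>k. vec_class n ` {f. \<forall>i. f i \<in> shifted_hom m k})\<rparr>"

lemma vec_class_eq_iff: "vec_class n f = vec_class n g \<longleftrightarrow> (\<forall>i<n. f i - g i \<in> rel_ideal R)"
  by (auto simp: vec_class_def fun_eq_iff quad_class_eq_iff)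

lemma free_mod_simps [simp]:
  "carrier (free_mod m n) = range (vec_class n)"
  "\<zero>\<^bsub>free_mod m n\<^esub> = vec_class n (\<lambda>_. 0)"
  "vec_class n f \<oplus>\<^bsub>free_mod m n\<^esub> vec_class n g = vec_class n (\<lambda>i. f i + g i)"
  "ract (free_mod m n) (vec_class n f) (quad_class R a) = vec_class n (\<lambda>i. f i * a)"
  "component (free_mod m n) k = vec_class n ` {f. \<forall>i. f i \<in> shifted_hom m k}"
  by (simp_all add: free_mod_def vec_class_def fun_eq_iff)

lemma abelian_group_free_mod: "abelian_group (free_mod m n)"
proof (rule abelian_groupI)
  fix x assume "x \<in> carrier (free_mod m n)"
  then obtain f where x: "x = vec_class n f" by auto
  have "vec_class n (\<lambda>i. - f i) \<oplus>\<^bsub>free_mod m n\<^esub> x = \<zero>\<^bsub>free_mod m n\<^esub>"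
    by (simp add: x)
  then show "\<exists>y\<in>carrier (free_mod m n). y \<oplus>\<^bsub>free_mod m n\<^esub> x = \<zero>\<^bsub>free_mod m n\<^esub>"
    by auto
qed (auto simp: ac_simps)

lemma finsum_free_mod:
  assumes "finite S"
  shows "finsum (free_mod m n) (\<lambda>k. vec_class n (F k)) S = vec_class n (\<lambda>i. \<Sum>k\<in>S. F k i)"
proof -
  interpret abelian_group "free_mod m n" by (rule abelian_group_free_mod)
  show ?thesis using assms
    by induction (simp_all add: Pi_def)
qed

lemma graded_right_module_free_mod:
  assumes R: "R \<subseteq> homogeneous d"
  shows "graded_right_module (quad_alg R) (quad_component R) (free_mod m n)"
proof (intro graded_right_module.intro graded_right_module_axioms.intro)
  let ?M = "free_mod m n"
  interpret M: abelian_group ?M by (rule abelian_group_free_mod)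
  show "ring (quad_alg R)" by (rule ring_quad_alg)
  show "abelian_group ?M" by (rule abelian_group_free_mod)
  fix x y a b
  assume x: "x \<in> carrier ?M" and a: "a \<in> carrier (quad_alg R)"
  then obtain f a' where f: "x = vec_class n f" "a = quad_class R a'"
    by (auto simp: carrier_quad_alg)
  show "ract ?M x a \<in> carrier ?M" by (simp add: f)
  {
    assume b: "b \<in> carrier (quad_alg R)"
    then obtain b' where b: "b = quad_class R b'" by (auto simp: carrier_quad_alg)
    show "ract ?M x (a \<otimes>\<^bsub>quad_alg R\<^esub> b) = ract ?M (ract ?M x a) b"
      by (simp add: f b mult.assoc)
    show "ract ?M x (a \<oplus>\<^bsub>quad_alg R\<^esub> b) = ract ?M x a \<oplus>\<^bsub>?M\<^esub> ract ?M x b"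
      by (simp add: f b distrib_left)
  }
  assume "y \<in> carrier ?M"
  then obtain g where g: "y = vec_class n g" by auto
  show "ract ?M (x \<oplus>\<^bsub>?M\<^esub> y) a = ract ?M x a \<oplus>\<^bsub>?M\<^esub> ract ?M y a"
    by (simp add: f g distrib_right)
next
  fix x assume "x \<in> carrier (free_mod m n)"
  then show "ract (free_mod m n) x \<one>\<^bsub>quad_alg R\<^esub> = x" by (auto simp: quad_alg_one)
next
  let ?M = "free_mod m n"
  interpret M: abelian_group ?M by (rule abelian_group_free_mod)
  fix i
  show "additive_subgroup (component ?M i) ?M"
  proof (rule additive_subgroupI, rule M.add.subgroupI)
    show "component ?M i \<noteq> {}"
    proof -
      have "vec_class n (\<lambda>_. 0) \<in> component ?M i"
        unfolding free_mod_simps by (rule imageI) simp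
      then show ?thesis by blast
    qed
    fix a assume "a \<in> component ?M i"
    then obtain f where f: "a = vec_class n f" "\<forall>j. f j \<in> shifted_hom m i" by auto
    have "\<ominus>\<^bsub>?M\<^esub> a = vec_class n (\<lambda>j. - f j)"
      by (rule M.minus_equality) (simp_all add: f)
    moreover have "\<forall>j. - f j \<in> shifted_hom m i" using f(2) by (simp add: shifted_hom_uminus)
    ultimately show "\<ominus>\<^bsub>?M\<^esub> a \<in> component ?M i" unfolding free_mod_simps by blast
    fix a b assume "a \<in> component ?M i" "b \<in> component ?M i"
    then obtain f g where "a = vec_class n f" "\<forall>j. f j \<in> shifted_hom m i"
      "b = vec_class n g" "\<forall>j. g j \<in> shifted_hom m i" by auto
    then have "a \<oplus>\<^bsub>?M\<^esub> b = vec_class n (\<lambda>j. f j + g j)" "\<forall>j. f j + g j \<in> shifted_hom m i"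
      by (simp_all add: shifted_hom_add)
    then show "a \<oplus>\<^bsub>?M\<^esub> b \<in> component ?M i" unfolding free_mod_simps by blast
  qed auto
next
  let ?M = "free_mod m n"
  fix x i a j
  assume "x \<in> component ?M i" "a \<in> quad_component R j"
  then obtain f g where "x = vec_class n f" "\<forall>l. f l \<in> shifted_hom m i" "a = quad_class R g" "g \<in> homogeneous j"
    by (auto simp: quad_component_def)
  then have "ract ?M x a = vec_class n (\<lambda>l. f l * g)" "\<forall>l. f l * g \<in> shifted_hom m (i + j)"
    by (simp_all add: shifted_hom_mult)
  then show "ract ?M x a \<in> component ?M (i + j)" unfolding free_mod_simps by blast
next
  let ?M = "free_mod m n"
  fix x assume "x \<in> carrier ?M"
  then obtain f where f: "x = vec_class n f" by auto
  define c where "c k = vec_class n (\<lambda>i. shifted_hcomp m k (f i))" for k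
  define T where "T = (\<Union>i<n. {k. shifted_hcomp m k (f i) \<noteq> 0})"
  have finT: "finite T" by (auto simp: T_def shifted_hcomp_vanish)
  have cT: "{i. c i \<noteq> \<zero>\<^bsub>?M\<^esub>} \<subseteq> T"
  proof -
    have "c k = \<zero>\<^bsub>?M\<^esub>" if "k \<notin> T" for k
      using that by (simp add: c_def T_def vec_class_eq_iff)
    then show ?thesis by blast
  qed
  show "\<exists>!c. (\<forall>i. c i \<in> component ?M i) \<and> finite {i. c i \<noteq> \<zero>\<^bsub>?M\<^esub>} \<and>
      x = finsum ?M c {i. c i \<noteq> \<zero>\<^bsub>?M\<^esub>}"
  proof (rule ex1I[of _ c], intro conjI allI)
    show "c i \<in> component ?M i" for i by (auto simp: c_def)
    show fin: "finite {i. c i \<noteq> \<zero>\<^bsub>?M\<^esub>}" using cT finT by (rule finite_subset)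
    have "f i - (\<Sum>k\<in>{i. c i \<noteq> \<zero>\<^bsub>?M\<^esub>}. shifted_hcomp m k (f i)) \<in> rel_ideal R" if "i < n" for i
    proof -
      have "f i = (\<Sum>k\<in>T. shifted_hcomp m k (f i))"
        by (rule sum_shifted_hcomp[symmetric]) (use finT that in \<open>auto simp: T_def\<close>)
      also have "\<dots> = (\<Sum>k\<in>{i. c i \<noteq> \<zero>\<^bsub>?M\<^esub>}. shifted_hcomp m k (f i)) +
          (\<Sum>k\<in>T - {i. c i \<noteq> \<zero>\<^bsub>?M\<^esub>}. shifted_hcomp m k (f i))"
        by (metis add.commute cT finT sum.subset_diff)
      finally have eq: "f i - (\<Sum>k\<in>{i. c i \<noteq> \<zero>\<^bsub>?M\<^esub>}. shifted_hcomp m k (f i)) =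
          (\<Sum>k\<in>T - {i. c i \<noteq> \<zero>\<^bsub>?M\<^esub>}. shifted_hcomp m k (f i))" by (metis add_diff_cancel_left')
      show ?thesis unfolding eq
        by (rule rel_ideal_sum) (use that in \<open>auto simp: c_def vec_class_eq_iff\<close>)
    qed
    then show "x = finsum ?M c {i. c i \<noteq> \<zero>\<^bsub>?M\<^esub>}"
      unfolding c_def finsum_free_mod[OF fin[unfolded c_def]] f by (simp add: vec_class_eq_iff)
  next
    fix c' assume c': "(\<forall>i. c' i \<in> component ?M i) \<and> finite {i. c' i \<noteq> \<zero>\<^bsub>?M\<^esub>} \<and>
      x = finsum ?M c' {i. c' i \<noteq> \<zero>\<^bsub>?M\<^esub>}"
    define S where "S = {i. c' i \<noteq> \<zero>\<^bsub>?M\<^esub>}"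
    have "\<forall>k. \<exists>g. c' k = vec_class n g \<and> (\<forall>i. g i \<in> shifted_hom m k)" using c' by auto
    then obtain g where g: "\<And>k. c' k = vec_class n (g k)" "\<And>k i. g k i \<in> shifted_hom m k"
      by metis
    have finS: "finite S" using c' by (simp add: S_def)
    have "x = finsum ?M c' S" using c' by (simp add: S_def)
    also have "finsum ?M c' S = vec_class n (\<lambda>i. \<Sum>k\<in>S. g k i)"
      using finsum_free_mod[OF finS, of m n g] g(1) by presburger
    finally have fI: "(\<Sum>k\<in>S. g k i) - f i \<in> rel_ideal R" if "i < n" for i
      using that by (simp add: f vec_class_eq_iff rel_ideal_diff_sym)
    \<comment> \<open>The ideal is graded, so taking components in \<open>fI\<close> isolates the
      summand of degree \<open>k\<close>. For \<open>k\<close> outside \<open>S\<close> the vector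
      \<open>c' k\<close> is zero, so that \<open>g k i\<close> lies in the ideal anyway.\<close>
    have "g k i - shifted_hcomp m k (f i) \<in> rel_ideal R" if i: "i < n" for i k
    proof -
      have 1: "(if k \<in> S then g k i else 0) - shifted_hcomp m k (f i) \<in> rel_ideal R"
        using shifted_hcomp_rel_ideal[OF R fI[OF i], of m k]
          shifted_hcomp_sum[OF finS, of "\<lambda>k. g k i" m k] g(2)
        by (simp add: shifted_hcomp_diff)
      have 2: "g k i - (if k \<in> S then g k i else 0) \<in> rel_ideal R"
        using g(1)[of k] i by (auto simp: S_def vec_class_eq_iff)
      show ?thesis by (rule rel_ideal_diff_trans[OF 2 1])
    qed
    then show "c' = c" by (auto simp: g(1) c_def fun_eq_iff[of c' c] vec_class_eq_iff)
  qed
qed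

definition unit_vec :: "nat \<Rightarrow> nat \<Rightarrow> nat \<Rightarrow> ('x, 'k) free_alg set" where
  "unit_vec n j = vec_class n (\<lambda>i. if i = j then 1 else 0)"

lemma unit_vec_eq_iff:
  assumes "1 \<notin> rel_ideal R" "i < n" "j < n"
  shows "unit_vec n i = unit_vec n j \<longleftrightarrow> i = j"
proof
  assume "unit_vec n i = unit_vec n j"
  then have "(if i = i then 1 else 0) - (if i = j then 1 else 0 :: ('x, 'k) free_alg) \<in> rel_ideal R"
    using assms(2) unfolding unit_vec_def vec_class_eq_iff by blast
  then show "i = j" using assms(1) by (auto split: if_splits)
qed simp

text \<open>\<open>is_right_comb\<close> indexes coefficients by the basis vectors themselves, so
  these have to be distinct; this is where \<open>1 \<notin> rel_ideal R\<close> enters. In each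
  coordinate the sum over the support then collapses to one coefficient.\<close>

lemma right_comb_unit_vec:
  assumes one: "1 \<notin> rel_ideal R"
  shows "is_right_comb (quad_alg R) (free_mod m n) (unit_vec n ` {..<n}) x c \<longleftrightarrow>
    (\<forall>b. c b \<in> carrier (quad_alg R)) \<and> (\<forall>b. b \<notin> unit_vec n ` {..<n} \<longrightarrow> c b = \<zero>\<^bsub>quad_alg R\<^esub>) \<and>
    x = vec_class n (\<lambda>i. quad_rep R (c (unit_vec n i)))"
proof (cases "(\<forall>b. c b \<in> carrier (quad_alg R)) \<and> (\<forall>b. b \<notin> unit_vec n ` {..<n} \<longrightarrow> c b = \<zero>\<^bsub>quad_alg R\<^esub>)")
  case False
  then show ?thesis unfolding is_right_comb_def by blast
next
  case True
  let ?T = "{b. c b \<noteq> \<zero>\<^bsub>quad_alg R\<^esub>}" and ?B = "unit_vec n ` {..<n}"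
  interpret M: abelian_group "free_mod m n" by (rule abelian_group_free_mod)
  have TB: "?T \<subseteq> ?B" using True by auto
  then have fin: "finite ?T" by (rule finite_subset) simp
  define \<delta> where "\<delta> b i = (if i < n \<and> b = unit_vec n i then 1 else 0 :: ('x, 'k) free_alg)" for b i
  have \<delta>: "b = vec_class n (\<delta> b)" if b: "b \<in> ?B" for b
  proof -
    from b obtain j where j: "j < n" "b = unit_vec n j" by auto
    then have "\<delta> b i = (if i = j then 1 else 0)" if "i < n" for i
      using that unit_vec_eq_iff[OF one] by (auto simp: \<delta>_def)
    then show ?thesis by (simp add: j unit_vec_def vec_class_def fun_eq_iff)
  qed
  have "finsum (free_mod m n) (\<lambda>b. ract (free_mod m n) b (c b)) ?T =
    finsum (free_mod m n) (\<lambda>b. vec_class n (\<lambda>i. \<delta> b i * quad_rep R (c b))) ?T"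
  proof (rule M.finsum_cong')
    fix b assume "b \<in> ?T"
    then have "b = vec_class n (\<delta> b)" using \<delta> TB by blast
    moreover have "c b = quad_class R (quad_rep R (c b))" using True by simp
    ultimately have "ract (free_mod m n) b (c b) =
       ract (free_mod m n) (vec_class n (\<delta> b)) (quad_class R (quad_rep R (c b)))"
      by (rule arg_cong2[where f = "ract (free_mod m n)"])
    then show "ract (free_mod m n) b (c b) = vec_class n (\<lambda>i. \<delta> b i * quad_rep R (c b))" by simp
  qed auto
  also have "\<dots> = vec_class n (\<lambda>i. \<Sum>b\<in>?T. \<delta> b i * quad_rep R (c b))"
    by (rule finsum_free_mod[OF fin])
  also have "\<dots> = vec_class n (\<lambda>i. quad_rep R (c (unit_vec n i)))"
    unfolding vec_class_eq_iff
  proof (intro allI impI)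
    fix i assume i: "i < n"
    have "(\<Sum>b\<in>?T. \<delta> b i * quad_rep R (c b)) =
      (\<Sum>b\<in>?T. if b = unit_vec n i then quad_rep R (c (unit_vec n i)) else 0)"
      by (rule sum.cong) (auto simp: \<delta>_def i)
    also have "\<dots> = (if unit_vec n i \<in> ?T then quad_rep R (c (unit_vec n i)) else 0)"
      using fin by simp
    also have "\<dots> - quad_rep R (c (unit_vec n i)) \<in> rel_ideal R"
    proof (cases "unit_vec n i \<in> ?T")
      case False
      then have "c (unit_vec n i) = quad_class R 0" by (simp add: quad_alg_zero)
      then show ?thesis using quad_rep_class[of R 0] False by (auto intro: rel_ideal_uminus)
    qed auto
    finally show "(\<Sum>b\<in>?T. \<delta> b i * quad_rep R (c b)) - quad_rep R (c (unit_vec n i)) \<in> rel_ideal R" .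
  qed
  finally have eq: "finsum (free_mod m n) (\<lambda>b. ract (free_mod m n) b (c b)) ?T =
    vec_class n (\<lambda>i. quad_rep R (c (unit_vec n i)))" .
  show ?thesis unfolding is_right_comb_def eq using True TB fin by blast
qed

lemma right_comb_unit_vec_ex1:
  assumes one: "1 \<notin> rel_ideal R"
  shows "\<exists>!c. is_right_comb (quad_alg R) (free_mod m n) (unit_vec n ` {..<n}) (vec_class n f) c"
proof -
  let ?B = "unit_vec n ` {..<n}"
  define ix where "ix = the_inv_into {..<n} (unit_vec n)"
  have ix: "ix (unit_vec n i) = i" if "i < n" for i
    unfolding ix_def by (rule the_inv_into_f_f)
      (use that unit_vec_eq_iff[OF one] in \<open>auto simp: inj_on_def\<close>)
  define c where "c b = (if b \<in> ?B then quad_class R (f (ix b)) else \<zero>\<^bsub>quad_alg R\<^esub>)" for b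
  show ?thesis unfolding right_comb_unit_vec[OF one]
  proof (rule ex1I[of _ c], intro conjI allI impI)
    show "c b \<in> carrier (quad_alg R)" for b by (auto simp: c_def quad_alg_zero)
    show "c b = \<zero>\<^bsub>quad_alg R\<^esub>" if "b \<notin> ?B" for b using that by (auto simp: c_def)
    show "vec_class n f = vec_class n (\<lambda>i. quad_rep R (c (unit_vec n i)))"
      by (auto simp: vec_class_eq_iff c_def ix intro: rel_ideal_diff_sym quad_rep_class)
  next
    fix c' assume c': "(\<forall>b. c' b \<in> carrier (quad_alg R)) \<and> (\<forall>b. b \<notin> ?B \<longrightarrow> c' b = \<zero>\<^bsub>quad_alg R\<^esub>) \<and>
      vec_class n f = vec_class n (\<lambda>i. quad_rep R (c' (unit_vec n i)))"
    show "c' = c"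
    proof
      fix b
      show "c' b = c b"
      proof (cases "b \<in> ?B")
        case True
        then obtain i where i: "i < n" "b = unit_vec n i" by auto
        have "quad_class R (f i) = quad_class R (quad_rep R (c' b))"
          using c' i unfolding vec_class_eq_iff quad_class_eq_iff by blast
        also have "\<dots> = c' b" using c' by simp
        finally show ?thesis using True i ix by (simp add: c_def)
      qed (use c' in \<open>simp add: c_def\<close>)
    qed
  qed
qed

lemma unit_vec_component: "unit_vec n ` {..<n} \<subseteq> component (free_mod m n) m"
  by (auto simp: unit_vec_def shifted_hom_def)

lemma graded_free_free_mod:
  assumes "1 \<notin> rel_ideal R"
  shows "graded_free (quad_alg R) (free_mod m n)"
  unfolding graded_free_def
proof (rule exI[of _ "unit_vec n ` {..<n}"], intro conjI ballI)
  show "unit_vec n ` {..<n} \<subseteq> (\<Union>i. component (free_mod m n) i)"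
    using unit_vec_component[of n m] by blast
  fix x assume "x \<in> carrier (free_mod m n)"
  then obtain f where "x = vec_class n f" by auto
  then show "\<exists>!c. is_right_comb (quad_alg R) (free_mod m n) (unit_vec n ` {..<n}) x c"
    using right_comb_unit_vec_ex1[OF assms] by simp
qed

lemma generated_in_degree_free_mod:
  assumes "1 \<notin> rel_ideal R"
  shows "generated_in_degree (quad_alg R) (free_mod m n) m"
  unfolding generated_in_degree_def
proof
  fix x assume "x \<in> carrier (free_mod m n)"
  then obtain f where "x = vec_class n f" by auto
  then obtain c where c: "is_right_comb (quad_alg R) (free_mod m n) (unit_vec n ` {..<n}) x c"
    using right_comb_unit_vec_ex1[OF assms, of m n f] by auto
  then show "\<exists>c. is_right_comb (quad_alg R) (free_mod m n) (component (free_mod m n) m) x c"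
    using unit_vec_component[of n m] unfolding is_right_comb_def by blast
qed

text \<open>Multiplication by a matrix from the left commutes with the right action. The matrix is
  applied to representatives in \<open>T\<close>; their choice is immaterial since the ideal is
  closed under left multiplication.\<close>

definition mat_map :: "nat \<Rightarrow> nat \<Rightarrow> (nat \<Rightarrow> nat \<Rightarrow> ('x, 'k) free_alg) \<Rightarrow>
    (nat \<Rightarrow> ('x, 'k) free_alg set) \<Rightarrow> nat \<Rightarrow> ('x, 'k) free_alg set" where
  "mat_map n l D \<phi> = vec_class n (\<lambda>i. \<Sum>j<l. D i j * quad_rep R (\<phi> j))"

lemma mat_map_vec: "mat_map n l D (vec_class l f) = vec_class n (\<lambda>i. \<Sum>j<l. D i j * f j)"
proof -
  have "(\<Sum>j<l. D i j * quad_rep R (vec_class l f j)) - (\<Sum>j<l. D i j * f j) =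
    (\<Sum>j<l. D i j * (quad_rep R (vec_class l f j) - f j))" for i
    by (simp only: sum_subtractf right_diff_distrib)
  moreover have "(\<Sum>j<l. D i j * (quad_rep R (vec_class l f j) - f j)) \<in> rel_ideal R" for i
    by (intro rel_ideal_sum rel_ideal_mult_left) (simp add: vec_class_def quad_rep_class)
  ultimately show ?thesis
    unfolding mat_map_def vec_class_eq_iff by metis
qed

lemma graded_hom_mat_map:
  assumes "\<And>i j. D i j \<in> homogeneous 1"
  shows "graded_hom (quad_alg R) (free_mod (Suc m) l) (free_mod m n) (mat_map n l D)"
  unfolding graded_hom_def
proof (intro conjI ballI allI)
  show "mat_map n l D \<in> carrier (free_mod (Suc m) l) \<rightarrow> carrier (free_mod m n)"
    by (auto simp: mat_map_vec)
  fix x assume "x \<in> carrier (free_mod (Suc m) l)"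
  then obtain f where f: "x = vec_class l f" by auto
  {
    fix y assume "y \<in> carrier (free_mod (Suc m) l)"
    then obtain g where g: "y = vec_class l g" by auto
    show "mat_map n l D (x \<oplus>\<^bsub>free_mod (Suc m) l\<^esub> y) = mat_map n l D x \<oplus>\<^bsub>free_mod m n\<^esub> mat_map n l D y"
      by (simp add: f g mat_map_vec distrib_left sum.distrib)
  }
  fix a assume "a \<in> carrier (quad_alg R)"
  then obtain g where g: "a = quad_class R g" by (auto simp: carrier_quad_alg)
  show "mat_map n l D (ract (free_mod (Suc m) l) x a) = ract (free_mod m n) (mat_map n l D x) a"
    by (simp add: f g mat_map_vec sum_distrib_right mult.assoc)
next
  fix k
  show "mat_map n l D ` component (free_mod (Suc m) l) k \<subseteq> component (free_mod m n) k"
  proof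
    fix x assume "x \<in> mat_map n l D ` component (free_mod (Suc m) l) k"
    then obtain f where f: "\<forall>i. f i \<in> shifted_hom (Suc m) k" "x = vec_class n (\<lambda>i. \<Sum>j<l. D i j * f j)"
      by (auto simp: mat_map_vec)
    have "(\<Sum>j<l. D i j * f j) \<in> shifted_hom m k" for i
    proof (cases "Suc m \<le> k")
      case True
      then have "D i j * f j \<in> homogeneous (1 + (k - Suc m))" for j
        using f(1) assms by (intro homogeneous_mult) (auto simp: shifted_hom_def)
      moreover have "1 + (k - Suc m) = k - m" using True by simp
      ultimately have "D i j * f j \<in> homogeneous (k - m)" for j by metis
      then show ?thesis using True by (auto simp: shifted_hom_def)
    next
      case False
      then have "f j = 0" for j using f(1) by (auto simp: shifted_hom_def)
      then show ?thesis by simp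
    qed
    then show "x \<in> component (free_mod m n) k" by (auto simp: f(2))
  qed
qed

end

text \<open>\<open>n m\<close> is the rank of step \<open>m\<close>, and \<open>D m\<close> is the
  matrix of the map from step \<open>m + 1\<close> to step \<open>m\<close>; \<open>cover\<close>
  says that the image of \<open>D 0\<close> is the whole augmentation ideal. Since the entries are
  linear, placing the basis of step \<open>m\<close> in degree \<open>m\<close> makes every map
  preserve degrees.\<close>

lemma koszul_matrices:
  fixes R :: "('x::finite, 'k::field) free_alg set" and D :: "nat \<Rightarrow> nat \<Rightarrow> nat \<Rightarrow> ('x, 'k) free_alg"
  assumes R: "R \<subseteq> homogeneous 2"
    and lin: "\<And>m i j. D m i j \<in> homogeneous 1"
    and n0: "n 0 = 1"
    and cover: "\<And>f. Poly_Mapping.lookup f [] = 0 \<Longrightarrow> \<exists>g. f - (\<Sum>j<n 1. D 0 0 j * g j) \<in> rel_ideal R"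
    and cplx: "\<And>m i k. i < n m \<Longrightarrow> k < n (m + 2) \<Longrightarrow>
      (\<Sum>j<n (m + 1). D m i j * D (m + 1) j k) \<in> rel_ideal R"
    and exact: "\<And>m f. (\<And>i. i < n m \<Longrightarrow> (\<Sum>j<n (m + 1). D m i j * f j) \<in> rel_ideal R) \<Longrightarrow>
      \<exists>g. \<forall>j<n (m + 1). f j - (\<Sum>k<n (m + 2). D (m + 1) j k * g k) \<in> rel_ideal R"
  shows "koszul R"
proof -
  let ?A = "quad_alg R" and ?Q = "quad_class R"
  define M where "M m = free_mod R m (n m)" for m
  define d where "d m = mat_map R (n m) (n (m + 1)) (D m)" for m
  \<comment> \<open>Step 0 consists of 1-tuples because \<open>n 0 = 1\<close>; coordinate 0
    identifies it with the regular module.\<close>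
  define d1 where "d1 = (\<lambda>\<phi>. d 0 \<phi> 0)"
  have one: "1 \<notin> rel_ideal R"
  proof
    assume "1 \<in> rel_ideal R"
    then have "hcomp 0 1 = (0 :: ('x, 'k) free_alg)" by (rule hcomp_rel_ideal_less[OF R]) simp
    then show False by (simp add: hcomp_homogeneous[OF homogeneous_1])
  qed
  have d_vec: "d m (vec_class R (n (m + 1)) f) = vec_class R (n m) (\<lambda>i. \<Sum>j<n (m + 1). D m i j * f j)" for m f
    by (simp add: d_def mat_map_vec)
  have d1_vec: "d1 (vec_class R (n 1) f) = ?Q (\<Sum>j<n 1. D 0 0 j * f j)" for f
    using d_vec[of 0 f] by (simp add: d1_def vec_class_def n0)
  have d_hom: "graded_hom ?A (M (m + 1)) (M m) (d m)" for m
    unfolding M_def d_def using graded_hom_mat_map[OF lin] by simp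
  have dd: "(\<Sum>j<n (m + 1). D m i j * (\<Sum>k<n (m + 2). D (m + 1) j k * g k)) \<in> rel_ideal R"
    if "i < n m" for m i g
  proof -
    have "(\<Sum>j<n (m + 1). D m i j * (\<Sum>k<n (m + 2). D (m + 1) j k * g k)) =
      (\<Sum>k<n (m + 2). (\<Sum>j<n (m + 1). D m i j * D (m + 1) j k) * g k)"
      unfolding sum_distrib_left sum_distrib_right mult.assoc by (rule sum.swap)
    also have "\<dots> \<in> rel_ideal R"
      by (rule rel_ideal_sum, rule rel_ideal_mult_right, rule cplx) (use that in auto)
    finally show ?thesis .
  qed
  have ker_d: "\<exists>g. vec_class R (n (m + 1)) f = vec_class R (n (m + 1)) (\<lambda>j. \<Sum>k<n (m + 2). D (m + 1) j k * g k)"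
    if "\<And>i. i < n m \<Longrightarrow> (\<Sum>j<n (m + 1). D m i j * f j) \<in> rel_ideal R" for m f
    using exact[OF that] unfolding vec_class_eq_iff by simp
  have M_carrier: "carrier (M m) = range (vec_class R (n m))" for m by (simp add: M_def)
  have d_exact: "exact_pair (M (m + 2)) (d (m + 1)) (M (m + 1)) (d m) (M m)" for m
    unfolding exact_pair_def
  proof (intro equalityI subsetI)
    fix x assume "x \<in> d (m + 1) ` carrier (M (m + 2))"
    then obtain g where g: "x = vec_class R (n (m + 1)) (\<lambda>j. \<Sum>k<n (m + 2). D (m + 1) j k * g k)"
      using d_vec[of "m + 1"] by (auto simp: M_carrier)
    show "x \<in> {y \<in> carrier (M (m + 1)). d m y = \<zero>\<^bsub>M m\<^esub>}"
      unfolding g mem_Collect_eq d_vec M_carrier using dd by (intro conjI rangeI) (simp add: M_def vec_class_eq_iff)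
  next
    fix y assume "y \<in> {y \<in> carrier (M (m + 1)). d m y = \<zero>\<^bsub>M m\<^esub>}"
    then obtain f where f: "y = vec_class R (n (m + 1)) f" "d m y = \<zero>\<^bsub>M m\<^esub>" by (auto simp: M_carrier)
    then have "\<And>i. i < n m \<Longrightarrow> (\<Sum>j<n (m + 1). D m i j * f j) \<in> rel_ideal R"
      unfolding f(1) d_vec by (simp add: M_def vec_class_eq_iff)
    then obtain g where "y = vec_class R (n (m + 1)) (\<lambda>j. \<Sum>k<n (m + 2). D (m + 1) j k * g k)"
      using ker_d[of m f] f(1) by auto
    then have "y = d (m + 1) (vec_class R (n (m + 2)) g)" using d_vec[of "m + 1" g] by simp
    then show "y \<in> d (m + 1) ` carrier (M (m + 2))" by (simp add: M_carrier)
  qed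
  have reg: "carrier (regular_module R) = carrier ?A" "add (regular_module R) = add ?A"
    "zero (regular_module R) = zero ?A" "ract (regular_module R) = monoid.mult ?A"
    "component (regular_module R) = quad_component R"
    by (simp_all add: regular_module_def Let_def)
  let ?K = "residue_module :: (('x, 'k) free_alg set, 'k) gr_module"
  have res: "carrier ?K = UNIV" "add ?K = (+)" "zero ?K = 0" "ract ?K = (\<lambda>s a. s * augmentation a)"
    "component ?K = (\<lambda>i. if i = 0 then UNIV else {0})"
    by (simp_all add: residue_module_def)
  have aug: "augmentation (?Q f) = Poly_Mapping.lookup f []" for f
    by (rule augmentation_class[OF R])
  have lookup_mult_Nil: "Poly_Mapping.lookup (f * g) [] = Poly_Mapping.lookup f [] * Poly_Mapping.lookup g []"
    for f g :: "('x, 'k) free_alg"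
  proof (induction f rule: free_alg_induct)
    case (add w c f)
    have "Poly_Mapping.lookup (Poly_Mapping.single w c * g) [] =
      Poly_Mapping.lookup (Poly_Mapping.single w c) [] * Poly_Mapping.lookup g []"
      by (induction g rule: free_alg_induct)
        (auto simp: algebra_simps lookup_add lookup_single when_def)
    then show ?case using add by (simp add: distrib_right lookup_add)
  qed simp
  have const: "Poly_Mapping.lookup f [] = 0" if "f \<in> homogeneous i" "0 < i" for f :: "('x, 'k) free_alg" and i
  proof -
    have "[] \<notin> Poly_Mapping.keys f" using that by (auto simp: homogeneous_def)
    then show ?thesis by (simp add: in_keys_iff)
  qed
  have "linear_free_resolution R M d1 d"
    unfolding linear_free_resolution_def
  proof (intro conjI allI impI)
    show "graded_right_module ?A (quad_component R) (M m)" "graded_free ?A (M m)"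
      "generated_in_degree ?A (M m) m" for m
      unfolding M_def using graded_right_module_free_mod[OF R] graded_free_free_mod[OF one]
        generated_in_degree_free_mod[OF one] by auto
    show "graded_hom ?A (regular_module R) ?K augmentation"
      unfolding graded_hom_def reg res
      by (auto simp: carrier_quad_alg aug lookup_add lookup_mult_Nil quad_component_def const)
    show "graded_hom ?A (M 1) (regular_module R) d1"
    proof -
      have "d1 (vec_class R (n 1) f) \<in> quad_component R k"
        if "\<forall>i. f i \<in> shifted_hom 1 k" for f k
      proof -
        have "(\<Sum>j<n 1. D 0 0 j * f j) \<in> homogeneous k"
        proof (cases k)
          case 0
          then show ?thesis using that by (simp add: shifted_hom_def)
        next
          case (Suc l)
          have "D 0 0 j * f j \<in> homogeneous (1 + l)" for j
            using that Suc by (intro homogeneous_mult lin) (simp add: shifted_hom_def)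
          then show ?thesis using Suc by auto
        qed
        then show ?thesis unfolding d1_vec quad_component_def by (rule imageI)
      qed
      moreover have "carrier (M 1) = range (vec_class R (n 1))" by (simp add: M_def)
      ultimately show ?thesis
        unfolding graded_hom_def reg M_def
        by (auto simp: d1_vec carrier_quad_alg distrib_left sum.distrib sum_distrib_right mult.assoc
            simp del: One_nat_def)
    qed
    show "graded_hom ?A (M (m + 1)) (M m) (d m)" for m by (rule d_hom)
    have "x \<in> augmentation ` carrier ?A" for x
      by (rule image_eqI[of _ _ "?Q (cst x)"]) (simp_all add: aug)
    then show "augmentation ` carrier ?A = UNIV" by auto
    show "exact_pair (M 1) d1 (regular_module R) augmentation ?K"
      unfolding exact_pair_def reg res
    proof (intro equalityI subsetI)
      fix x assume "x \<in> d1 ` carrier (M 1)"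
      then obtain f where f: "x = ?Q (\<Sum>j<n 1. D 0 0 j * f j)"
        by (auto simp: M_def d1_vec simp del: One_nat_def)
      have "Poly_Mapping.lookup (D 0 0 j) [] = 0" for j
        using const[OF lin] by simp
      then show "x \<in> {y \<in> carrier ?A. augmentation y = 0}"
        by (simp add: f aug lookup_sum lookup_mult_Nil)
    next
      fix x assume "x \<in> {y \<in> carrier ?A. augmentation y = 0}"
      then obtain f where f: "x = ?Q f" "Poly_Mapping.lookup f [] = 0" by (auto simp: carrier_quad_alg aug)
      then obtain g where "f - (\<Sum>j<n 1. D 0 0 j * g j) \<in> rel_ideal R" using cover by blast
      then have "x = d1 (vec_class R (n 1) g)" by (simp add: f d1_vec quad_class_eq_iff del: One_nat_def)
      then show "x \<in> d1 ` carrier (M 1)" unfolding M_carrier by blast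
    qed
    have "d1 y = \<zero>\<^bsub>?A\<^esub> \<longleftrightarrow> d 0 y = \<zero>\<^bsub>M 0\<^esub>" if y: "y \<in> carrier (M 1)" for y
    proof -
      obtain f where f: "y = vec_class R (n 1) f" using y unfolding M_carrier by blast
      show ?thesis using d_vec[of 0 f]
        by (simp add: f d1_vec quad_class_eq_zero_iff M_def vec_class_eq_iff n0 del: One_nat_def)
    qed
    then show "exact_pair (M 2) (d 1) (M 1) d1 (regular_module R)"
      using d_exact[of 0] unfolding exact_pair_def reg
      by (auto simp: numeral_2_eq_2)
    show "exact_pair (M (m + 2)) (d (m + 1)) (M (m + 1)) (d m) (M m)" for m by (rule d_exact)
  qed
  then show ?thesis unfolding koszul_def by blast
qed

section \<open>Dimensions\<close>

context vector_space
begin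

lemma span_disjoint:
  assumes "finite A" "independent (A \<union> B)" "A \<inter> B = {}" "x \<in> span A" "x \<in> span B"
  shows "x = 0"
  using assms
proof (induction A arbitrary: x)
  case (insert a A)
  obtain k where k: "x - scale k a \<in> span A" using insert.prems(3) span_breakdown_eq by blast
  have ind: "independent (A \<union> B)" "a \<notin> span (A \<union> B)"
    using insert.prems(1,2) insert.hyps(2) by (auto simp: independent_insert split: if_splits)
  have "k = 0"
  proof (rule ccontr)
    assume "k \<noteq> 0"
    have "x \<in> span (A \<union> B)" "x - scale k a \<in> span (A \<union> B)"
      using k insert.prems(4) span_mono[of A "A \<union> B"] span_mono[of B "A \<union> B"] by auto
    then have "x - (x - scale k a) \<in> span (A \<union> B)" by (rule span_diff)
    then have "scale k a \<in> span (A \<union> B)" by simp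
    then have "scale (inverse k) (scale k a) \<in> span (A \<union> B)" by (rule span_scale)
    then show False using ind(2) \<open>k \<noteq> 0\<close> by simp
  qed
  then show ?case using insert.IH[OF ind(1)] insert.prems k by auto
qed simp

lemma independent_UnI:
  assumes "finite B" "independent A" "independent B" "\<And>x. x \<in> span A \<Longrightarrow> x \<in> span B \<Longrightarrow> x = 0"
  shows "independent (A \<union> B)"
  using assms
proof (induction B)
  case (insert b B)
  have sub: "span B \<subseteq> span (insert b B)" by (rule span_mono) auto
  have B: "independent B" "b \<notin> span B"
    using insert.prems(2) insert.hyps(2) by (auto simp: independent_insert split: if_splits)
  have IH: "independent (A \<union> B)" using insert.IH B insert.prems sub by blast
  have "b \<notin> span (A \<union> B)"
  proof
    assume "b \<in> span (A \<union> B)"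
    then obtain u v where uv: "u \<in> span A" "v \<in> span B" "b = u + v" by (auto simp: span_Un)
    have "v \<in> span (insert b B)" using uv(2) sub by blast
    then have "b - v \<in> span (insert b B)" by (intro span_diff[OF span_base]) simp_all
    then have "u \<in> span (insert b B)" using uv(3) by simp
    then have "u = 0" using uv(1) insert.prems(3) by blast
    then have "b = v" using uv(3) by simp
    then show False using uv(2) B(2) by blast
  qed
  then show ?case using IH by (simp add: independent_insert)
qed simp

text \<open>The free algebra is infinite-dimensional, so finite dimension is witnessed by a finite
  set \<open>F\<close> whose span contains the spaces concerned. \<open>C\<close> is what extends a
  basis of \<open>U\<close> to a basis of \<open>W\<close>.\<close>

lemma complement_exists:
  assumes U: "subspace U" and W: "subspace W" and "U \<subseteq> W" "W \<subseteq> span F" "finite F"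
  obtains C where "finite C" "independent C" "span C \<subseteq> W"
    "\<And>x. x \<in> U \<Longrightarrow> x \<in> span C \<Longrightarrow> x = 0" "W = {x + y | x y. x \<in> U \<and> y \<in> span C}"
    "dim W = dim U + card C"
proof -
  obtain A where A: "A \<subseteq> U" "independent A" "U \<subseteq> span A" "card A = dim U"
    by (rule basis_exists)
  obtain B where B: "A \<subseteq> B" "B \<subseteq> W" "independent B" "W \<subseteq> span B"
    using maximal_independent_subset_extend[OF subset_trans[OF A(1) \<open>U \<subseteq> W\<close>] A(2)] by metis
  have finB: "finite B" using independent_span_bound[OF \<open>finite F\<close> B(3)] B(2) assms(4) by auto
  have UA: "span A = U" using A(1,3) U by (simp add: span_minimal subset_antisym)
  have WB: "span B = W" using B(2,4) W by (simp add: span_minimal subset_antisym)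
  have AB: "A \<union> (B - A) = B" using B(1) by auto
  show thesis
  proof (rule that[of "B - A"])
    show "finite (B - A)" using finB by simp
    show "independent (B - A)" using B(3) by (rule independent_mono) auto
    show "span (B - A) \<subseteq> W" using WB span_mono[of "B - A" B] by auto
    show "x = 0" if "x \<in> U" "x \<in> span (B - A)" for x
    proof (rule span_disjoint)
      show "finite A" using B(1) finB by (rule finite_subset)
      show "independent (A \<union> (B - A))" unfolding AB by (rule B(3))
      show "x \<in> span A" using that(1) UA by simp
    qed (use that(2) in auto)
    show "W = {x + y | x y. x \<in> U \<and> y \<in> span (B - A)}"
      using span_Un[of A "B - A"] AB WB UA by simp
    have "dim W = card B" using basis_card_eq_dim[of B W] B by simp
    then show "dim W = dim U + card (B - A)"
      using A(4) B(1) finB by (metis card_Diff_subset card_mono finite_subset le_add_diff_inverse)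
  qed
qed

lemma dim_mono_fin:
  assumes "V \<subseteq> span W" "W \<subseteq> span F" "finite F"
  shows "dim V \<le> dim W"
proof -
  obtain B where B: "B \<subseteq> W" "independent B" "W \<subseteq> span B" "card B = dim W"
    by (rule basis_exists)
  have "finite B" using independent_span_bound[OF assms(3) B(2)] B(1) assms(2) by auto
  moreover have "V \<subseteq> span B" using assms(1) B(3) by (meson order_trans span_minimal subspace_span)
  ultimately show ?thesis using dim_le_card[of V B] B(4) by simp
qed

lemma subspace_dim_eq_fin:
  assumes "subspace U" "subspace W" "U \<subseteq> W" "W \<subseteq> span F" "finite F" "dim W \<le> dim U"
  shows "U = W"
proof -
  obtain C where C: "finite C" "W = {x + y | x y. x \<in> U \<and> y \<in> span C}" "dim W = dim U + card C"
    by (rule complement_exists[OF assms(1-5)], rule that; assumption)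
  then have "C = {}" using assms(6) by auto
  then show ?thesis using C(2) by auto
qed

text \<open>A complement of the intersection in \<open>W\<close> is at the same time a complement of
  \<open>U\<close> in the sum.\<close>

lemma dim_sum_Int_fin:
  assumes U: "subspace U" and W: "subspace W" and "U \<subseteq> span F" "W \<subseteq> span F" "finite F"
  shows "dim {x + y | x y. x \<in> U \<and> y \<in> W} + dim (U \<inter> W) = dim U + dim W"
proof -
  have I: "subspace (U \<inter> W)" using U W by (rule subspace_inter)
  obtain C where C: "finite C" "independent C" "span C \<subseteq> W"
    "\<And>x. x \<in> U \<inter> W \<Longrightarrow> x \<in> span C \<Longrightarrow> x = 0" "W = {x + y | x y. x \<in> U \<inter> W \<and> y \<in> span C}"
    "dim W = dim (U \<inter> W) + card C"
    by (rule complement_exists[OF I W Int_lower2 assms(4,5)], rule that; assumption)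
  obtain A where A: "A \<subseteq> U" "independent A" "U \<subseteq> span A" "card A = dim U"
    by (rule basis_exists)
  have UA: "span A = U" using A(1,3) U by (simp add: span_minimal subset_antisym)
  have finA: "finite A" using independent_span_bound[OF assms(5) A(2)] A(1) assms(3) by auto
  have dis: "x = 0" if "x \<in> span A" "x \<in> span C" for x
    using that C(3,4) UA by blast
  have ind: "independent (A \<union> C)" by (rule independent_UnI[OF C(1) A(2) C(2) dis])
  have AC: "A \<inter> C = {}"
    using dis span_base A(2) dependent_zero by (metis disjoint_iff)
  have "{x + y | x y. x \<in> U \<and> y \<in> W} = {x + y | x y. x \<in> U \<and> y \<in> span C}"
  proof (intro equalityI subsetI)
    fix z assume "z \<in> {x + y | x y. x \<in> U \<and> y \<in> W}"
    then obtain x y where xy: "x \<in> U" "y \<in> W" "z = x + y" by auto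
    then obtain a b where ab: "a \<in> U" "b \<in> span C" "y = a + b" using C(5) by blast
    have "z = (x + a) + b" "x + a \<in> U" using xy ab U by (auto simp: add.assoc subspace_add)
    then show "z \<in> {x + y | x y. x \<in> U \<and> y \<in> span C}" using ab by blast
  qed (use C(3) in auto)
  also have "\<dots> = span (A \<union> C)" by (simp add: span_Un UA)
  finally have "dim {x + y | x y. x \<in> U \<and> y \<in> W} = card A + card C"
    using dim_span_eq_card_independent[OF ind] card_Un_disjoint[OF finA C(1) AC] by simp
  then show ?thesis using A(4) C(6) by simp
qed

lemma dim_direct_sum:
  assumes "subspace U" "subspace W" "U \<subseteq> span F" "W \<subseteq> span F" "finite F" "U \<inter> W \<subseteq> {0}"
  shows "dim {x + y | x y. x \<in> U \<and> y \<in> W} = dim U + dim W"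
proof -
  have "dim (U \<inter> W) = 0" using dim_le_card[of "U \<inter> W" "{}"] assms(6) by auto
  then show ?thesis using dim_sum_Int_fin[OF assms(1-5)] by simp
qed

lemma dim_inj_image:
  assumes f: "Vector_Spaces.linear scale scale f" and inj: "inj f" and "subspace U" "U \<subseteq> span F" "finite F"
  shows "dim (f ` U) = dim U"
proof -
  interpret f: Vector_Spaces.linear scale scale f by (rule f)
  interpret p: vector_space_pair scale scale by unfold_locales
  obtain A where A: "A \<subseteq> U" "independent A" "U \<subseteq> span A" "card A = dim U"
    by (rule basis_exists)
  have "independent (f ` A)"
    by (rule p.linear_independent_injective_image[OF f A(2) inj_on_subset[OF inj subset_UNIV]])
  moreover have "f ` U \<subseteq> span (f ` A)" using A(3) by (simp add: f.span_image image_mono)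
  moreover have "f ` A \<subseteq> f ` U" using A(1) by auto
  ultimately have "dim (f ` U) = card (f ` A)" using basis_card_eq_dim by metis
  also have "\<dots> = card A" using inj by (intro card_image) (auto intro: inj_on_subset)
  finally show ?thesis using A(4) by simp
qed

end

section \<open>Components of the ideal and the Hilbert series\<close>

lemma homogeneous_subspace: "fa.subspace (homogeneous n :: ('x, 'k::field) free_alg set)"
  by (rule fa.subspaceI) auto

lemma rel_ideal_subspace: "fa.subspace (rel_ideal R)"
  by (rule fa.subspaceI) auto

definition words :: "nat \<Rightarrow> 'x list set" where
  "words n = {w. length w = n}"

lemma finite_words: "finite (words n :: 'x::finite list set)"
  using finite_lists_length_eq[of "UNIV :: 'x set" n] by (simp add: words_def)

lemma card_words: "card (words n :: 'x::finite list set) = CARD('x) ^ n"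
  using card_lists_length_eq[of "UNIV :: 'x set" n] by (simp add: words_def)

lemma inj_word: "inj (word :: 'x list \<Rightarrow> ('x, 'k::field) free_alg)"
proof (rule injI)
  fix v w assume "word v = (word w :: ('x, 'k) free_alg)"
  then have "Poly_Mapping.keys (word v :: ('x, 'k) free_alg) = Poly_Mapping.keys (word w :: ('x, 'k) free_alg)"
    by simp
  then show "v = w" by (simp add: word_def)
qed

lemma independent_words:
  assumes "finite L"
  shows "fa.independent (word ` L :: ('x, 'k::field) free_alg set)"
proof (rule fa.independent_if_scalars_zero)
  fix c :: "('x, 'k) free_alg \<Rightarrow> 'k" and x :: "('x, 'k) free_alg"
  assume 0: "(\<Sum>x\<in>word ` L. cst (c x) * x) = 0" and "x \<in> word ` L"
  then obtain w where w: "w \<in> L" "x = word w" by auto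
  have "0 = Poly_Mapping.lookup (\<Sum>v\<in>L. cst (c (word v)) * word v :: ('x, 'k) free_alg) w"
    using 0 by (simp add: sum.reindex inj_on_subset[OF inj_word])
  also have "\<dots> = (\<Sum>v\<in>L. if v = w then c (word w) else 0)"
    unfolding lookup_sum by (rule sum.cong) (auto simp: word_def lookup_single when_def)
  also have "\<dots> = c x" using assms w by simp
  finally show "c x = 0" by simp
qed (use assms in simp)

lemma span_words: "fa.span (word ` words n) = (homogeneous n :: ('x::finite, 'k::field) free_alg set)"
proof (intro equalityI)
  show "fa.span (word ` words n) \<subseteq> (homogeneous n :: ('x, 'k) free_alg set)"
    by (rule fa.span_minimal) (auto simp: words_def homogeneous_subspace)
  show "homogeneous n \<subseteq> fa.span (word ` words n :: ('x, 'k) free_alg set)"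
  proof
    fix f :: "('x, 'k) free_alg" assume f: "f \<in> homogeneous n"
    have "lin_ext word f \<in> fa.span (word ` words n)"
      by (rule lin_ext_closed)
        (use f in \<open>auto simp: homogeneous_def words_def intro: fa.span_zero fa.span_add fa.span_scale fa.span_base\<close>)
    then show "f \<in> fa.span (word ` words n)" by simp
  qed
qed

lemma dim_homogeneous: "fa.dim (homogeneous n :: ('x::finite, 'k::field) free_alg set) = CARD('x) ^ n"
proof -
  have "fa.dim (homogeneous n :: ('x, 'k) free_alg set) = card (word ` words n :: ('x, 'k) free_alg set)"
    unfolding span_words[symmetric]
    by (rule fa.dim_span_eq_card_independent[OF independent_words[OF finite_words]])
  also have "\<dots> = CARD('x) ^ n"
    by (simp add: card_image inj_on_subset[OF inj_word] card_words)
  finally show ?thesis .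
qed

lemma homogeneous_subset_span: "W \<subseteq> homogeneous n \<Longrightarrow>
    W \<subseteq> fa.span (word ` words n :: ('x::finite, 'k::field) free_alg set)"
  by (simp add: span_words)

lemmas finite_word_words = finite_imageI[OF finite_words, of word]

lemma dim_mono_homogeneous:
  fixes U W :: "('x::finite, 'k::field) free_alg set"
  assumes "U \<subseteq> W" "W \<subseteq> homogeneous n"
  shows "fa.dim U \<le> fa.dim W"
  by (rule fa.dim_mono_fin[OF subset_trans[OF assms(1) fa.span_superset]
        homogeneous_subset_span[OF assms(2)] finite_word_words])

definition ideal_comp :: "('x, 'k::field) free_alg set \<Rightarrow> nat \<Rightarrow> ('x, 'k) free_alg set" where
  "ideal_comp R n = rel_ideal R \<inter> homogeneous n"

lemma ideal_comp_subspace: "fa.subspace (ideal_comp R n)"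
  unfolding ideal_comp_def by (intro fa.subspace_inter rel_ideal_subspace homogeneous_subspace)

lemma ideal_comp_homogeneous: "ideal_comp R n \<subseteq> homogeneous n"
  by (simp add: ideal_comp_def)

lemma dim_ideal_comp_le:
  "fa.dim (ideal_comp R n :: ('x::finite, 'k::field) free_alg set) \<le> CARD('x) ^ n"
proof -
  have "fa.dim (ideal_comp R n) \<le> fa.dim (homogeneous n :: ('x, 'k) free_alg set)"
    by (rule dim_mono_homogeneous[OF ideal_comp_homogeneous subset_refl])
  then show ?thesis by (simp add: dim_homogeneous)
qed

lemma subfield_quad_scalars:
  assumes R: "R \<subseteq> homogeneous 2"
  shows "subfield (quad_scalars R) (quad_alg (R :: ('x, 'k::field) free_alg set))"
proof -
  let ?A = "quad_alg R" and ?Q = "quad_class R"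
  interpret A: ring ?A by (rule ring_quad_alg)
  have inj: "?Q (cst c) = ?Q (cst d) \<longleftrightarrow> c = d" for c d
  proof
    assume "?Q (cst c) = ?Q (cst d)"
    then have "hcomp 0 (cst c - cst d) = (0 :: ('x, 'k) free_alg)"
      unfolding quad_class_eq_iff by (rule hcomp_rel_ideal_less[OF R]) simp
    then have "cst c = (cst d :: ('x, 'k) free_alg)"
      by (simp add: hcomp_single)
    then show "c = d" by (metis lookup_single_eq)
  qed simp
  have one: "\<one>\<^bsub>?A\<^esub> = ?Q (cst 1)" and zero: "\<zero>\<^bsub>?A\<^esub> = ?Q (cst 0)"
    by (simp_all add: quad_alg_one quad_alg_zero)
  have K: "quad_scalars R = range (\<lambda>c. ?Q (cst c))" by (simp add: quad_scalars_def)
  have minus: "\<ominus>\<^bsub>?A\<^esub> ?Q (cst c) = ?Q (cst (- c))" for c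
    by (rule A.minus_equality) (simp_all add: quad_alg_zero flip: single_add)
  have sub: "subring (quad_scalars R) ?A"
  proof (rule A.subringI)
    show "quad_scalars R \<subseteq> carrier ?A" by (auto simp: K)
    show "\<one>\<^bsub>?A\<^esub> \<in> quad_scalars R" unfolding K one by blast
    fix h1 h2 assume "h1 \<in> quad_scalars R" "h2 \<in> quad_scalars R"
    then obtain c d where "h1 = ?Q (cst c)" "h2 = ?Q (cst d)" by (auto simp: K)
    then show "h1 \<otimes>\<^bsub>?A\<^esub> h2 \<in> quad_scalars R" "h1 \<oplus>\<^bsub>?A\<^esub> h2 \<in> quad_scalars R"
      "\<ominus>\<^bsub>?A\<^esub> h1 \<in> quad_scalars R"
      by (auto simp: K minus simp flip: single_add)
  qed
  show ?thesis
  proof (rule A.subfieldI)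
    show "subcring (quad_scalars R) ?A"
      by (rule A.subcringI[OF sub]) (auto simp: K mult.commute)
    show "Units (?A \<lparr>carrier := quad_scalars R\<rparr>) = quad_scalars R - {\<zero>\<^bsub>?A\<^esub>}"
    proof (intro equalityI subsetI)
      fix u assume "u \<in> Units (?A \<lparr>carrier := quad_scalars R\<rparr>)"
      then obtain v where uv: "u \<in> quad_scalars R" "v \<in> quad_scalars R" "v \<otimes>\<^bsub>?A\<^esub> u = \<one>\<^bsub>?A\<^esub>"
        by (auto simp: Units_def)
      then obtain c d where cd: "u = ?Q (cst c)" "v = ?Q (cst d)" by (auto simp: K)
      then have "d * c = 1" using uv(3) unfolding one by (simp add: inj del: cst_1)
      then have "u \<noteq> \<zero>\<^bsub>?A\<^esub>" unfolding cd zero inj by auto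
      then show "u \<in> quad_scalars R - {\<zero>\<^bsub>?A\<^esub>}" using uv(1) by blast
    next
      fix u assume u: "u \<in> quad_scalars R - {\<zero>\<^bsub>?A\<^esub>}"
      then obtain c where c: "u = ?Q (cst c)" by (auto simp: K)
      then have "c \<noteq> 0" using u unfolding zero by auto
      then have "?Q (cst (inverse c)) \<otimes>\<^bsub>?A\<^esub> u = \<one>\<^bsub>?A\<^esub>" "u \<otimes>\<^bsub>?A\<^esub> ?Q (cst (inverse c)) = \<one>\<^bsub>?A\<^esub>"
        by (simp_all add: c quad_alg_one)
      moreover have "?Q (cst (inverse c)) \<in> quad_scalars R" unfolding K by blast
      ultimately show "u \<in> Units (?A \<lparr>carrier := quad_scalars R\<rparr>)"
        using u by (auto simp: Units_def)
    qed
  qed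
qed

text \<open>The dimension predicate grows by line extensions, so the elements of \<open>B\<close>
  are adjoined one at a time. As the span of \<open>B\<close> meets the ideal only in 0, each new
  class lies outside the span of the earlier ones.\<close>

lemma dimension_quad_class_span:
  fixes R :: "('x, 'k::field) free_alg set"
  assumes "finite B" "fa.independent B" "\<And>x. x \<in> rel_ideal R \<Longrightarrow> x \<in> fa.span B \<Longrightarrow> x = 0"
  shows "ring.dimension (quad_alg R) (card B) (quad_scalars R) (quad_class R ` fa.span B)"
  using assms
proof (induction B)
  interpret A: ring "quad_alg R" by (rule ring_quad_alg)
  case empty
  have "quad_class R ` fa.span {} = {\<zero>\<^bsub>quad_alg R\<^esub>}" by (simp add: quad_alg_zero)
  then show ?case using A.zero_dim by simp
next
  interpret A: ring "quad_alg R" by (rule ring_quad_alg)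
  case (insert b B)
  have sub: "fa.span B \<subseteq> fa.span (insert b B)" by (rule fa.span_mono) auto
  have ind: "fa.independent B" "b \<notin> fa.span B"
    using insert.prems(1) insert.hyps(2) by (auto simp: fa.independent_insert split: if_splits)
  have IH: "A.dimension (card B) (quad_scalars R) (quad_class R ` fa.span B)"
    using insert.IH ind insert.prems(2) sub by blast
  have nin: "quad_class R b \<notin> quad_class R ` fa.span B"
  proof
    assume "quad_class R b \<in> quad_class R ` fa.span B"
    then obtain v where v: "v \<in> fa.span B" "b - v \<in> rel_ideal R" by (auto simp: quad_class_eq_iff)
    have "v \<in> fa.span (insert b B)" using v(1) sub by blast
    then have "b - v \<in> fa.span (insert b B)" by (intro fa.span_diff[OF fa.span_base]) simp_all
    then have "b = v" using insert.prems(2)[OF v(2)] by simp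
    then show False using v ind by simp
  qed
  have "A.line_extension (quad_scalars R) (quad_class R b) (quad_class R ` fa.span B) =
      quad_class R ` fa.span (insert b B)"
  proof (intro equalityI subsetI)
    fix u assume "u \<in> A.line_extension (quad_scalars R) (quad_class R b) (quad_class R ` fa.span B)"
    then obtain c v where "v \<in> fa.span B" "u = quad_class R (cst c * b + v)"
      unfolding A.line_extension_mem_iff quad_scalars_def by auto
    then show "u \<in> quad_class R ` fa.span (insert b B)"
      unfolding fa.span_insert by (intro image_eqI[of _ _ "cst c * b + v"]) (auto intro!: exI[of _ c])
  next
    fix u assume "u \<in> quad_class R ` fa.span (insert b B)"
    then obtain w k where w: "u = quad_class R w" "w - cst k * b \<in> fa.span B"
      unfolding fa.span_insert by auto
    have "u = quad_class R (cst k) \<otimes>\<^bsub>quad_alg R\<^esub> quad_class R b \<oplus>\<^bsub>quad_alg R\<^esub> quad_class R (w - cst k * b)"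
      by (simp add: w)
    then show "u \<in> A.line_extension (quad_scalars R) (quad_class R b) (quad_class R ` fa.span B)"
      unfolding A.line_extension_mem_iff quad_scalars_def using w(2) by blast
  qed
  then show ?case
    using A.Suc_dim[OF quad_class_carrier nin IH] insert.hyps by simp
qed

text \<open>A complement of the degree \<open>n\<close> part of the ideal maps bijectively onto the
  degree \<open>n\<close> part of the quotient. This moves all counting from the quotient to
  subspaces of \<open>T\<close>.\<close>

lemma hilbert_series_nth:
  fixes R :: "('x::finite, 'k::field) free_alg set"
  assumes R: "R \<subseteq> homogeneous 2"
  shows "fps_nth (hilbert_series R) n = of_nat (CARD('x) ^ n - fa.dim (ideal_comp R n))"
proof -
  interpret A: ring "quad_alg R" by (rule ring_quad_alg)
  obtain C where C: "finite C" "fa.independent C" "fa.span C \<subseteq> homogeneous n"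
    "\<And>x. x \<in> ideal_comp R n \<Longrightarrow> x \<in> fa.span C \<Longrightarrow> x = 0"
    "homogeneous n = {x + y | x y. x \<in> ideal_comp R n \<and> y \<in> fa.span C}"
    "fa.dim (homogeneous n :: ('x, 'k) free_alg set) = fa.dim (ideal_comp R n) + card C"
    by (rule fa.complement_exists[OF ideal_comp_subspace homogeneous_subspace
          ideal_comp_homogeneous homogeneous_subset_span[OF subset_refl] finite_word_words], rule that; assumption)
  have "quad_component R n = quad_class R ` fa.span C"
    unfolding quad_component_def
  proof (intro equalityI subsetI)
    fix u assume "u \<in> quad_class R ` homogeneous n"
    then obtain x y where "u = quad_class R (x + y)" "x \<in> ideal_comp R n" "y \<in> fa.span C"
      using C(5) by auto
    then have "u = quad_class R y" by (simp add: quad_class_eq_iff ideal_comp_def)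
    then show "u \<in> quad_class R ` fa.span C" using \<open>y \<in> fa.span C\<close> by blast
  qed (use C(3) in auto)
  moreover have "A.dimension (card C) (quad_scalars R) (quad_class R ` fa.span C)"
    by (rule dimension_quad_class_span[OF C(1,2)]) (use C(3,4) in \<open>auto simp: ideal_comp_def\<close>)
  ultimately have "A.dim (quad_scalars R) (quad_component R n) = card C"
    unfolding A.dim_def
    by (intro the_equality) (auto intro: A.dimension_is_inj[OF subfield_quad_scalars[OF R]])
  then show ?thesis using C(6) by (simp add: hilbert_series_def dim_homogeneous)
qed

lemma inverse_one_minus_X_cubed:
  "inverse ((1 - fps_X) ^ 3) = Abs_fps (\<lambda>n. of_nat ((n + 2) choose 2) :: rat)"
proof -
  have "(3 + n - 1) choose n = (n + 2) choose 2" for n :: nat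
    using binomial_symmetric[of n "n + 2"] by (simp add: add.commute)
  then show ?thesis
    using one_minus_const_fps_X_neg_power'[of 3 "1 :: rat"] by simp
qed

text \<open>The number \<open>(n + 2) choose 2\<close> is the coefficient of the inverse cube of
  \<open>1 - X\<close>. The additive form avoids truncated subtraction;
  \<open>dim_ideal_comp_le\<close> justifies the rearrangement.\<close>

lemma PHS_iff:
  fixes R :: "(gen, 'k::field) free_alg set"
  assumes R: "R \<subseteq> homogeneous 2"
  shows "PHS R \<longleftrightarrow> (\<forall>n. fa.dim (ideal_comp R n) + ((n + 2) choose 2) = 3 ^ n)"
proof -
  have "PHS R \<longleftrightarrow> (\<forall>n. (of_nat (3 ^ n - fa.dim (ideal_comp R n)) :: rat) = of_nat ((n + 2) choose 2))"
    by (simp only: PHS_def card_gen inverse_one_minus_X_cubed fps_eq_iff hilbert_series_nth[OF R] fps_nth_Abs_fps)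
  also have "\<dots> \<longleftrightarrow> (\<forall>n. 3 ^ n - fa.dim (ideal_comp R n) = ((n + 2) choose 2))"
    unfolding of_nat_eq_iff by (rule refl)
  also have "\<dots> \<longleftrightarrow> (\<forall>n. fa.dim (ideal_comp R n) + ((n + 2) choose 2) = 3 ^ n)"
    using dim_ideal_comp_le[of R] unfolding card_gen by (metis le_add_diff_inverse add_diff_cancel_left')
  finally show ?thesis .
qed

section \<open>Sklyanin algebras\<close>

abbreviation vx :: "(gen, 'k::field) free_alg" where "vx \<equiv> var Gx"
abbreviation vy :: "(gen, 'k::field) free_alg" where "vy \<equiv> var Gy"
abbreviation vz :: "(gen, 'k::field) free_alg" where "vz \<equiv> var Gz"

text \<open>Every index from 2 on gives the third relation, so that membership and degree facts hold
  without a bound on \<open>j\<close>.\<close>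

definition srel :: "'k::field \<Rightarrow> 'k \<Rightarrow> 'k \<Rightarrow> nat \<Rightarrow> (gen, 'k) free_alg" where
  "srel p q r j = (if j = 0 then cst p * (vy * vz) + cst q * (vz * vy) + cst r * (vx * vx)
     else if j = 1 then cst p * (vz * vx) + cst q * (vx * vz) + cst r * (vy * vy)
     else cst p * (vx * vy) + cst q * (vy * vx) + cst r * (vz * vz))"

definition gen_nth :: "nat \<Rightarrow> gen" where
  "gen_nth i = (if i = 0 then Gx else if i = 1 then Gy else Gz)"

text \<open>Column \<open>j\<close> holds the right factors of relation \<open>j\<close>: the row of
  letters times \<open>smat\<close> is the row of relations. Times the column of letters,
  \<open>smat\<close> gives the column of the same relations.\<close>

definition smat :: "'k::field \<Rightarrow> 'k \<Rightarrow> 'k \<Rightarrow> nat \<Rightarrow> nat \<Rightarrow> (gen, 'k) free_alg" where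
  "smat p q r i j =
    (if i = 0 then (if j = 0 then cst r * vx else if j = 1 then cst q * vz else cst p * vy)
     else if i = 1 then (if j = 0 then cst p * vz else if j = 1 then cst r * vy else cst q * vx)
     else (if j = 0 then cst q * vy else if j = 1 then cst p * vx else cst r * vz))"

lemma lessThan_3: "{..<3::nat} = {0, 1, 2}" by auto

lemma sum_lessThan_3: "(\<Sum>i<3::nat. f i) = f 0 + f 1 + (f 2 :: 'a::comm_monoid_add)"
  by (simp add: lessThan_3 add.assoc)

lemma less_3_cases: "(i::nat) < 3 \<Longrightarrow> i = 0 \<or> i = 1 \<or> i = 2" by auto

lemma all_less_3: "(\<forall>i<3. P i) \<longleftrightarrow> P 0 \<and> P 1 \<and> P (2 :: nat)"
  by (auto dest!: less_3_cases)

lemma gen_nth_simps [simp]: "gen_nth 0 = Gx" "gen_nth (Suc 0) = Gy" "gen_nth 2 = Gz"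
  by (simp_all add: gen_nth_def)

lemma sum_gen: "(\<Sum>a\<in>UNIV. f a) = f Gx + f Gy + (f Gz :: 'a::comm_monoid_add)"
  by (simp add: UNIV_gen add.assoc)

lemma sum_gen_nth: "(\<Sum>i<3::nat. f (gen_nth i)) = (\<Sum>a\<in>UNIV. f a :: 'a::comm_monoid_add)"
  by (simp add: sum_gen sum_lessThan_3)

lemma sklyanin_srel: "sklyanin p q r = srel p q r ` {..<3}"
  by (simp add: lessThan_3 sklyanin_def srel_def var_def insert_commute)

lemma srel_in_rel_ideal: "srel p q r j \<in> rel_ideal (sklyanin p q r)"
proof (cases "j < 3")
  case True
  then show ?thesis by (auto simp: sklyanin_srel intro: rel_ideal_gen)
next
  case False
  then have "srel p q r j = srel p q r 2" by (simp add: srel_def)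
  then show ?thesis by (auto simp: sklyanin_srel intro: rel_ideal_gen)
qed

lemma srel_homogeneous: "srel p q r j \<in> homogeneous 2"
proof (cases "j < 3")
  case True
  then show ?thesis using sklyanin_quadratic[of p q r] by (auto simp: sklyanin_srel)
next
  case False
  then have "srel p q r j = srel p q r 2" by (simp add: srel_def)
  then show ?thesis using sklyanin_quadratic[of p q r] by (auto simp: sklyanin_srel)
qed

lemma var_cst_left_commute: "var v * (cst c * g) = cst c * (var v * g)"
  by (rule cst_left_commute)

lemma var_cst_commute: "var v * cst c = cst c * var v"
  by (rule cst_commute)

lemma cst_cst_mult: "cst c * (cst d * g) = cst (c * d) * g"
  by (simp flip: mult.assoc)

lemmas free_alg_simps = distrib_left distrib_right mult.assoc var_cst_left_commute
  var_cst_commute cst_cst_mult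

lemma srel_smat: "j < 3 \<Longrightarrow> srel p q r j = (\<Sum>i<3. var (gen_nth i) * smat p q r i j)"
  by (auto simp: sum_lessThan_3 srel_def smat_def free_alg_simps dest!: less_3_cases)

lemma gen_nth_smat: "(\<Sum>i<3. \<Sum>j<3. var (gen_nth i) * (smat p q r i j * h j)) =
    (\<Sum>j<3. srel p q r j * h j)"
  by (simp add: srel_smat sum_distrib_right mult.assoc) (rule sum.swap)

lemma smat_homogeneous: "smat p q r i j \<in> homogeneous 1"
  using homogeneous_var by (auto simp: smat_def simp del: One_nat_def)

text \<open>By \<open>rel_ideal_decomp\<close> the given element is the sum of the
  \<open>v_i g_i\<close>, with \<open>g_i\<close> in \<open>I\<close>, and the
  \<open>r_j h_j\<close>; by \<open>smat\<close> the latter part is again a combination of letters.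
  Letters are independent in \<open>T\<close>, so coordinates can be compared.\<close>

lemma sklyanin_exact_first:
  assumes "(\<Sum>i<3. var (gen_nth i) * f i) \<in> rel_ideal (sklyanin p q r)"
  shows "\<exists>h. \<forall>i<3. f i - (\<Sum>j<3. smat p q r i j * h j) \<in> rel_ideal (sklyanin p q r)"
proof -
  let ?I = "rel_ideal (sklyanin p q r)"
  obtain g h where g: "\<And>a. g a \<in> ?I"
    and eq: "(\<Sum>i<3. var (gen_nth i) * f i) = (\<Sum>a\<in>UNIV. var a * g a) + (\<Sum>j<3. srel p q r j * h j)"
    using rel_ideal_decomp[OF assms[unfolded sklyanin_srel]] unfolding sklyanin_srel by blast
  have "(\<Sum>i<3. var (gen_nth i) * f i) =
    (\<Sum>i<3. var (gen_nth i) * (g (gen_nth i) + (\<Sum>j<3. smat p q r i j * h j)))"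
    unfolding eq gen_nth_smat[symmetric] sum_gen_nth[symmetric]
    by (simp add: distrib_left sum.distrib sum_distrib_left)
  then have "left_quot (gen_nth k) (\<Sum>i<3. var (gen_nth i) * f i) = left_quot (gen_nth k)
    (\<Sum>i<3. var (gen_nth i) * (g (gen_nth i) + (\<Sum>j<3. smat p q r i j * h j)))" for k
    by simp
  from this[of 0] this[of 1] this[of 2]
  have "f i = g (gen_nth i) + (\<Sum>j<3. smat p q r i j * h j)" if "i < 3" for i
    using less_3_cases[OF that] by (auto simp: sum_lessThan_3)
  then have "\<forall>i<3. f i - (\<Sum>j<3. smat p q r i j * h j) \<in> ?I" using g by simp
  then show ?thesis by blast
qed

lemma gen_cover:
  fixes f :: "(gen, 'k::field) free_alg"
  assumes "Poly_Mapping.lookup f [] = 0"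
  shows "\<exists>g. f - (\<Sum>j<3. var (gen_nth j) * g j) \<in> rel_ideal R"
proof -
  have "f = (\<Sum>j<3. var (gen_nth j) * left_quot (gen_nth j) f)"
    using free_alg_expand[of f] assms sum_gen_nth[of "\<lambda>a. var a * left_quot a f"] by simp
  then have "f - (\<Sum>j<3. var (gen_nth j) * left_quot (gen_nth j) f) = 0" by simp
  then show ?thesis by (metis rel_ideal_0)
qed

lemma ideal_comp_2_span:
  "ideal_comp (sklyanin p q r) 2 \<subseteq> fa.span (srel p q r ` {..<3})"
proof
  let ?R = "sklyanin p q r"
  fix f assume "f \<in> ideal_comp ?R 2"
  then have f: "f \<in> rel_ideal ?R" "hcomp 2 f = f"
    by (auto simp: ideal_comp_def homogeneous_iff_hcomp)
  obtain g h where g: "\<And>a. g a \<in> rel_ideal ?R"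
    and eq: "f = (\<Sum>a\<in>UNIV. var a * g a) + (\<Sum>j<3. srel p q r j * h j)"
    using rel_ideal_decomp[OF f(1)[unfolded sklyanin_srel]] unfolding sklyanin_srel by blast
  have "hcomp 1 (g a) = 0" for a
    by (rule hcomp_rel_ideal_less[OF sklyanin_quadratic g]) simp
  then have 1: "hcomp 2 (var a * g a) = 0" for a
    using hcomp_Suc_var_mult[of 1 a "g a"] by (simp add: numeral_2_eq_2)
  have 2: "hcomp 2 (srel p q r j * h j) = cst (Poly_Mapping.lookup (hcomp 0 (h j)) []) * srel p q r j" for j
  proof -
    have "hcomp 2 (srel p q r j * h j) = srel p q r j * hcomp 0 (h j)"
      using hcomp_homogeneous_mult(1)[OF srel_homogeneous, of 0] by simp
    also have "hcomp 0 (h j) = cst (Poly_Mapping.lookup (hcomp 0 (h j)) [])"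
      by (rule homogeneous_0_cst) simp
    finally show ?thesis by (metis cst_commute)
  qed
  have "f = (\<Sum>j<3. cst (Poly_Mapping.lookup (hcomp 0 (h j)) []) * srel p q r j)"
    using arg_cong[OF eq, of "hcomp 2"] by (simp add: f(2) hcomp_sum 1 2)
  also have "\<dots> \<in> fa.span (srel p q r ` {..<3})"
    by (intro fa.span_sum fa.span_scale fa.span_base imageI)
  finally show "f \<in> fa.span (srel p q r ` {..<3})" .
qed

lemma ideal_comp_3_span:
  assumes W: "fa.subspace W" "\<And>a j. j < 3 \<Longrightarrow> var a * srel p q r j \<in> W"
    "\<And>a j. j < 3 \<Longrightarrow> srel p q r j * var a \<in> W"
  shows "ideal_comp (sklyanin p q r) 3 \<subseteq> W"
proof
  let ?R = "sklyanin p q r"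
  fix f assume "f \<in> ideal_comp ?R 3"
  then have f: "f \<in> rel_ideal ?R" "hcomp 3 f = f"
    by (auto simp: ideal_comp_def homogeneous_iff_hcomp)
  obtain g h where g: "\<And>a. g a \<in> rel_ideal ?R"
    and eq: "f = (\<Sum>a\<in>UNIV. var a * g a) + (\<Sum>j<3. srel p q r j * h j)"
    using rel_ideal_decomp[OF f(1)[unfolded sklyanin_srel]] unfolding sklyanin_srel by blast
  have 1: "var a * u \<in> W" if "u \<in> fa.span (srel p q r ` {..<3})" for a u
    using that
  proof (induction rule: fa.span_induct_alt)
    case base
    then show ?case using W(1) by (simp add: fa.subspace_0)
  next
    case (step c x y)
    then show ?case using W
      by (auto simp: distrib_left cst_left_commute intro!: fa.subspace_add fa.subspace_scale)
  qed
  have 2: "hcomp 3 (var a * g a) \<in> W" for a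
  proof -
    have "hcomp 2 (g a) \<in> ideal_comp ?R 2"
      using hcomp_rel_ideal[OF sklyanin_quadratic g] by (simp add: ideal_comp_def)
    then have "var a * hcomp 2 (g a) \<in> W" using 1 ideal_comp_2_span by blast
    moreover have "hcomp 3 (var a * g a) = var a * hcomp 2 (g a)"
      using hcomp_Suc_var_mult[of 2 a "g a"] by (simp add: numeral_3_eq_3 numeral_2_eq_2)
    ultimately show ?thesis by simp
  qed
  have 3: "hcomp 3 (srel p q r j * h j) \<in> W" if "j < 3" for j
  proof -
    have u: "hcomp 1 (h j) \<in> homogeneous (Suc 0)"
      using hcomp_in_homogeneous[of 1 "h j"] by simp
    have "\<exists>c. left_quot a (hcomp 1 (h j)) = cst c" for a
      using homogeneous_0_cst[OF homogeneous_Suc_expand(2)[OF u]] by blast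
    then obtain c where c: "\<And>a. left_quot a (hcomp 1 (h j)) = cst (c a)" by metis
    have "hcomp 3 (srel p q r j * h j) = srel p q r j * hcomp 1 (h j)"
      using hcomp_homogeneous_mult(1)[OF srel_homogeneous, of 1] by (simp add: numeral_3_eq_3)
    also have "hcomp 1 (h j) = (\<Sum>a\<in>UNIV. var a * cst (c a))"
      using homogeneous_Suc_expand(1)[OF u] unfolding c .
    also have "srel p q r j * \<dots> = (\<Sum>a\<in>UNIV. cst (c a) * (srel p q r j * var a))"
      by (simp only: sum_distrib_left var_cst_commute cst_left_commute)
    also have "\<dots> \<in> W" using W that by (intro fa.subspace_sum fa.subspace_scale) auto
    finally show ?thesis .
  qed
  have "f = (\<Sum>a\<in>UNIV. hcomp 3 (var a * g a)) + (\<Sum>j<3. hcomp 3 (srel p q r j * h j))"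
    using arg_cong[OF eq, of "hcomp 3"] by (simp add: f(2) hcomp_sum)
  also have "\<dots> \<in> W" using W(1) 2 3
    by (intro fa.subspace_add fa.subspace_sum) auto
  finally show "f \<in> W" .
qed

text \<open>A PHS-algebra on three generators has dimension 10 in degree 3, so its ideal has
  dimension 27 - 10 = 17 there.\<close>

lemma not_PHS_if_span:
  assumes "\<And>a j. j < 3 \<Longrightarrow> var a * srel p q r j \<in> fa.span W"
    "\<And>a j. j < 3 \<Longrightarrow> srel p q r j * var a \<in> fa.span W"
    "finite W" "card W \<le> 16"
  shows "\<not> PHS (sklyanin p q r)"
proof -
  have "ideal_comp (sklyanin p q r) 3 \<subseteq> fa.span W"
    by (rule ideal_comp_3_span) (use assms in auto)
  then have "fa.dim (ideal_comp (sklyanin p q r) 3) \<le> card W"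
    using assms(3) by (rule fa.dim_le_card)
  then have "fa.dim (ideal_comp (sklyanin p q r) 3) + ((3 + 2) choose 2) \<noteq> 3 ^ 3"
    using assms(4) by (simp add: choose_two)
  then show ?thesis unfolding PHS_iff[OF sklyanin_quadratic] by blast
qed

lemma not_PHS_free: "\<not> PHS (sklyanin 0 0 (0 :: 'k::field))"
proof -
  have "srel 0 0 (0 :: 'k) j = 0" for j by (simp add: srel_def)
  then show ?thesis by (intro not_PHS_if_span[of _ _ _ "{}"]) simp_all
qed

section \<open>Monomial relations\<close>

lemma koszul_free: "koszul (sklyanin 0 0 (0 :: 'k::field))"
proof (rule koszul_matrices[where D = "\<lambda>m i j. var (gen_nth j)" and
      n = "\<lambda>m. if m = 0 then 1 else if m = 1 then 3 else 0"])
  let ?I = "rel_ideal (sklyanin 0 0 (0 :: 'k))"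
  show "\<exists>g. f - (\<Sum>j<if 1 = (0::nat) then 1 else if 1 = (1::nat) then 3 else 0. var (gen_nth j) * g j) \<in> ?I"
    if "Poly_Mapping.lookup f [] = 0" for f :: "(gen, 'k) free_alg"
    using gen_cover[OF that] by simp
  fix m :: nat and f :: "nat \<Rightarrow> (gen, 'k) free_alg"
  assume *: "\<And>i :: nat. i < (if m = 0 then 1 else if m = 1 then 3 else 0) \<Longrightarrow>
     (\<Sum>j<if m + 1 = 0 then 1 else if m + 1 = 1 then 3 else 0. var (gen_nth j) * f j) \<in> ?I"
  have s0: "smat 0 0 (0 :: 'k) i j = 0" for i j by (simp add: smat_def)
  show "\<exists>g. \<forall>j<if m + 1 = 0 then 1 else if m + 1 = 1 then 3 else 0. f j -
      (\<Sum>k<if m + 2 = 0 then 1 else if m + 2 = 1 then 3 else 0. var (gen_nth k) * g k) \<in> ?I"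
  proof (cases "m = 0")
    case True
    then show ?thesis using sklyanin_exact_first[of f 0 0 0] *[of 0] by (simp add: s0)
  qed simp
qed (use sklyanin_quadratic homogeneous_var in \<open>simp_all del: One_nat_def\<close>)

text \<open>Relations of the form \<open>a (s a)\<close> link into chains \<open>a\<close>,
  \<open>s a\<close>, \<open>s (s a)\<close> and so on. Each of the three summands of the resolution
  follows the chain that starts at its own letter.\<close>

definition diag_mat :: "(gen \<Rightarrow> gen) \<Rightarrow> nat \<Rightarrow> nat \<Rightarrow> nat \<Rightarrow> (gen, 'k::field) free_alg" where
  "diag_mat s m i j =
    (case m of 0 \<Rightarrow> var (gen_nth j) | Suc l \<Rightarrow> if i = j then var ((s ^^ m) (gen_nth i)) else 0)"

lemma diag_mat_sum:
  assumes "i < 3"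
  shows "(\<Sum>j<3. diag_mat s (Suc m) i j * f j) = var ((s ^^ Suc m) (gen_nth i)) * f i"
  using less_3_cases[OF assms] by (auto simp: sum_lessThan_3 diag_mat_def simp del: funpow.simps)

text \<open>The assumption \<open>ex\<close> serves twice: as it stands at the first step, and later
  for tuples with a single non-zero entry, where it says that whatever a letter \<open>a\<close>
  annihilates from the left is a right multiple of \<open>s a\<close>.\<close>

lemma monomial_koszul:
  fixes s :: "gen \<Rightarrow> gen"
  assumes ex: "\<And>f. (\<Sum>a\<in>UNIV. var a * f a) \<in> rel_ideal (sklyanin p q r) \<Longrightarrow>
      \<exists>h. \<forall>a. f a - var (s a) * h a \<in> rel_ideal (sklyanin p q r)"
    and s: "\<And>a. var a * var (s a) \<in> rel_ideal (sklyanin p q r)"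
  shows "koszul (sklyanin p q r)"
proof -
  let ?I = "rel_ideal (sklyanin p q r)"
  define n :: "nat \<Rightarrow> nat" where "n m = (if m = 0 then 1 else 3)" for m
  have n: "n 0 = 1" "n (m + 1) = 3" "n (Suc m) = 3" "n (m + 2) = 3" for m by (simp_all add: n_def)
  show ?thesis
  proof (rule koszul_matrices[where D = "diag_mat s" and n = n])
    show "sklyanin p q r \<subseteq> homogeneous 2" by (rule sklyanin_quadratic)
    show "diag_mat s m i j \<in> homogeneous 1" for m i j
      using homogeneous_var by (auto simp: diag_mat_def simp del: One_nat_def funpow.simps split: nat.split)
    show "n 0 = 1" by (rule n)
    show "\<exists>g. f - (\<Sum>j<n 1. diag_mat s 0 0 j * g j) \<in> ?I"
      if "Poly_Mapping.lookup f [] = 0" for f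
      using gen_cover[OF that] by (simp add: diag_mat_def n)
    show "(\<Sum>j<n (m + 1). diag_mat s m i j * diag_mat s (m + 1) j k) \<in> ?I"
      if i: "i < n m" and k: "k < n (m + 2)" for m i k
    proof (cases m)
      case 0
      have "(\<Sum>j<3. diag_mat s 0 i j * diag_mat s (Suc 0) j k) = var (gen_nth k) * (var (s (gen_nth k)) :: (gen, 'a) free_alg)"
        using less_3_cases[OF k[unfolded n]] by (auto simp: sum_lessThan_3 diag_mat_def)
      then show ?thesis using s[of "gen_nth k"] by (simp add: 0 n)
    next
      case (Suc l)
      have i3: "i < 3" using i by (simp add: Suc n)
      have "diag_mat s (m + 1) i k = (if i = k then var (s ((s ^^ m) (gen_nth i))) else 0 :: (gen, 'a) free_alg)"
        by (simp add: diag_mat_def)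
      then show ?thesis
        unfolding n Suc diag_mat_sum[OF i3] using s[of "(s ^^ Suc l) (gen_nth i)"]
        by (auto simp del: funpow.simps simp: Suc)
    qed
    fix m and f :: "nat \<Rightarrow> (gen, 'a) free_alg"
    assume *: "\<And>i. i < n m \<Longrightarrow> (\<Sum>j<n (m + 1). diag_mat s m i j * f j) \<in> ?I"
    have "\<exists>g. \<forall>j<3. f j - var ((s ^^ Suc m) (gen_nth j)) * g j \<in> ?I"
    proof (cases m)
      case 0
      define f' where "f' a = (case a of Gx \<Rightarrow> f 0 | Gy \<Rightarrow> f 1 | Gz \<Rightarrow> f 2)" for a
      have "(\<Sum>a\<in>UNIV. var a * f' a) \<in> ?I"
        using *[of 0] 0 by (simp add: n sum_gen sum_lessThan_3 f'_def diag_mat_def)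
      then obtain h where h: "\<And>a. f' a - var (s a) * h a \<in> ?I" using ex by blast
      show ?thesis
        by (rule exI[of _ "\<lambda>j. h (gen_nth j)"])
          (use h[of Gx] h[of Gy] h[of Gz] 0 in \<open>simp add: all_less_3 f'_def\<close>)
    next
      case (Suc l)
      have "\<exists>g. f j - var ((s ^^ Suc m) (gen_nth j)) * g \<in> ?I" if j: "j < 3" for j
      proof -
        define a where "a = (s ^^ m) (gen_nth j)"
        have "var a * f j \<in> ?I"
          using *[of j] j unfolding n Suc diag_mat_sum[OF j] a_def by simp
        moreover have "(\<Sum>b\<in>UNIV. var b * (if b = a then f j else 0)) = var a * f j"
          by (cases a) (simp_all add: sum_gen)
        ultimately obtain h where "\<And>b. (if b = a then f j else 0) - var (s b) * h b \<in> ?I"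
          using ex[of "\<lambda>b. if b = a then f j else 0"] by auto
        from this[of a] show ?thesis by (auto simp: a_def)
      qed
      then show ?thesis by metis
    qed
    then obtain g where g: "\<And>j. j < 3 \<Longrightarrow> f j - var ((s ^^ Suc m) (gen_nth j)) * g j \<in> ?I" by blast
    show "\<exists>g. \<forall>j<n (m + 1). f j - (\<Sum>k<n (m + 2). diag_mat s (m + 1) j k * g k) \<in> ?I"
    proof (intro exI[of _ g] allI impI)
      fix j assume "j < n (m + 1)"
      then have j: "j < 3" by (simp add: n)
      show "f j - (\<Sum>k<n (m + 2). diag_mat s (m + 1) j k * g k) \<in> ?I"
        using g[OF j] diag_mat_sum[OF j, of s m g] by (simp add: n del: funpow.simps)
    qed
  qed
qed

lemma cst_mult_rel_ideal_iff: "c \<noteq> 0 \<Longrightarrow> cst c * f \<in> rel_ideal R \<longleftrightarrow> f \<in> rel_ideal R"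
  by (metis cst_1 cst_cst_mult field_class.field_inverse mult_1 rel_ideal_mult_left)

text \<open>\<open>\<sigma> a\<close> is the index of the relation whose monomial starts with
  \<open>a\<close>. In degree 3 there are nine words \<open>b a (s a)\<close> and nine words
  \<open>a (s a) b\<close>, but the three words \<open>a (s a) (s (s a))\<close> are of both kinds.
  So at most 15 words span the ideal, which is below 17.\<close>

lemma monomial_case:
  fixes s :: "gen \<Rightarrow> gen" and \<sigma> :: "gen \<Rightarrow> nat"
  assumes c: "c \<noteq> 0" and bij: "\<sigma> ` UNIV = {..<3}"
    and S: "\<And>a. srel p q r (\<sigma> a) = cst c * (var a * var (s a))"
    and M: "\<And>i h. i < 3 \<Longrightarrow> (\<Sum>j<3. smat p q r i j * h j) = cst c * (var (s (gen_nth i)) * h (\<sigma> (gen_nth i)))"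
  shows "koszul (sklyanin p q r)" "\<not> PHS (sklyanin p q r)"
proof -
  let ?I = "rel_ideal (sklyanin p q r)"
  have s: "var a * var (s a) \<in> ?I" for a
    using srel_in_rel_ideal[of p q r "\<sigma> a"] c by (simp add: S cst_mult_rel_ideal_iff)
  show "koszul (sklyanin p q r)"
  proof (rule monomial_koszul[OF _ s])
    fix f assume "(\<Sum>a\<in>UNIV. var a * f a) \<in> ?I"
    then have "(\<Sum>i<3. var (gen_nth i) * f (gen_nth i)) \<in> ?I"
      by (simp add: sum_gen_nth[of "\<lambda>a. var a * f a"])
    then obtain h where "\<forall>i<3. f (gen_nth i) - (\<Sum>j<3. smat p q r i j * h j) \<in> ?I"
      using sklyanin_exact_first[of "\<lambda>i. f (gen_nth i)" p q r] by auto
    then have h: "f (gen_nth i) - var (s (gen_nth i)) * (cst c * h (\<sigma> (gen_nth i))) \<in> ?I" if "i < 3" for i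
      using that by (simp add: M var_cst_left_commute)
    show "\<exists>h. \<forall>a. f a - var (s a) * h a \<in> ?I"
    proof (intro exI allI)
      fix a
      show "f a - var (s a) * (cst c * h (\<sigma> a)) \<in> ?I"
        using h[of 0] h[of 1] h[of 2] by (cases a) simp_all
    qed
  qed
  define W1 where "W1 = (\<lambda>(a, b). var b * (var a * var (s a)) :: (gen, 'a) free_alg) ` UNIV"
  define W2 where "W2 = (\<lambda>(a, b). var a * (var (s a) * var b) :: (gen, 'a) free_alg) ` (SIGMA a:UNIV. UNIV - {s (s a)})"
  have "card W1 \<le> card (UNIV :: (gen \<times> gen) set)" unfolding W1_def by (rule card_image_le) simp
  also have "\<dots> = 9" unfolding UNIV_Times_UNIV[symmetric] card_cartesian_product card_gen by simp
  finally have card1: "card W1 \<le> 9" .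
  have "card W2 \<le> card (SIGMA a:(UNIV :: gen set). UNIV - {s (s a)})"
    unfolding W2_def by (rule card_image_le) simp
  also have "\<dots> = (\<Sum>a\<in>(UNIV :: gen set). card (UNIV - {s (s a)}))"
    by (rule card_SigmaI) auto
  also have "\<dots> = 6" by (simp add: card_gen card_Diff_singleton)
  finally have card2: "card W2 \<le> 6" .
  have W1: "var b * (var a * var (s a)) \<in> W1" for a b
    unfolding W1_def by (rule image_eqI[of _ _ "(a, b)"]) simp_all
  have W12: "var a * (var (s a) * var b) \<in> W1 \<union> W2" for a b
  proof (cases "b = s (s a)")
    case False
    then have "var a * (var (s a) * var b) \<in> W2"
      unfolding W2_def by (intro image_eqI[of _ _ "(a, b)"]) simp_all
    then show ?thesis by blast
  qed (use W1[of a "s a"] in simp)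
  show "\<not> PHS (sklyanin p q r)"
  proof (rule not_PHS_if_span[of _ _ _ "W1 \<union> W2"])
    fix b j assume "j < (3::nat)"
    then obtain a where j: "j = \<sigma> a" using bij by (metis imageE lessThan_iff)
    show "var b * srel p q r j \<in> fa.span (W1 \<union> W2)"
      unfolding j S var_cst_left_commute using W1 by (intro fa.span_scale fa.span_base) blast
    show "srel p q r j * var b \<in> fa.span (W1 \<union> W2)"
      unfolding j S mult.assoc using W12 by (intro fa.span_scale fa.span_base)
  next
    show "finite (W1 \<union> W2)" by (simp add: W1_def W2_def)
    show "card (W1 \<union> W2) \<le> 16" using card_Un_le[of W1 W2] card1 card2 by simp
  qed
qed

lemma monomial_case_p:
  assumes "(p :: 'k::field) \<noteq> 0"
  shows "koszul (sklyanin p 0 0)" "\<not> PHS (sklyanin p 0 0)"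
proof -
  let ?\<sigma> = "(\<lambda>a. case a of Gx \<Rightarrow> 2 | Gy \<Rightarrow> 0 | Gz \<Rightarrow> 1) :: gen \<Rightarrow> nat"
  let ?s = "\<lambda>a. case a of Gx \<Rightarrow> Gy | Gy \<Rightarrow> Gz | Gz \<Rightarrow> Gx"
  have 1: "?\<sigma> ` UNIV = {..<3}" by (auto simp: UNIV_gen lessThan_3)
  have 2: "srel p 0 0 (?\<sigma> a) = cst p * (var a * var (?s a))" for a
    by (cases a) (simp_all add: srel_def)
  have 3: "(\<Sum>j<3. smat p 0 0 i j * h j) = cst p * (var (?s (gen_nth i)) * h (?\<sigma> (gen_nth i)))"
    if "i < 3" for i h
    using less_3_cases[OF that] by (auto simp: sum_lessThan_3 smat_def mult.assoc)
  show "koszul (sklyanin p 0 0)" "\<not> PHS (sklyanin p 0 0)"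
    using monomial_case[OF assms 1 2 3] by blast+
qed

lemma monomial_case_q:
  assumes "(q :: 'k::field) \<noteq> 0"
  shows "koszul (sklyanin 0 q 0)" "\<not> PHS (sklyanin 0 q 0)"
proof -
  let ?\<sigma> = "(\<lambda>a. case a of Gx \<Rightarrow> 1 | Gy \<Rightarrow> 2 | Gz \<Rightarrow> 0) :: gen \<Rightarrow> nat"
  let ?s = "\<lambda>a. case a of Gx \<Rightarrow> Gz | Gy \<Rightarrow> Gx | Gz \<Rightarrow> Gy"
  have 1: "?\<sigma> ` UNIV = {..<3}" by (auto simp: UNIV_gen lessThan_3)
  have 2: "srel 0 q 0 (?\<sigma> a) = cst q * (var a * var (?s a))" for a
    by (cases a) (simp_all add: srel_def)
  have 3: "(\<Sum>j<3. smat 0 q 0 i j * h j) = cst q * (var (?s (gen_nth i)) * h (?\<sigma> (gen_nth i)))"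
    if "i < 3" for i h
    using less_3_cases[OF that] by (auto simp: sum_lessThan_3 smat_def mult.assoc)
  show "koszul (sklyanin 0 q 0)" "\<not> PHS (sklyanin 0 q 0)"
    using monomial_case[OF assms 1 2 3] by blast+
qed

lemma monomial_case_r:
  assumes "(r :: 'k::field) \<noteq> 0"
  shows "koszul (sklyanin 0 0 r)" "\<not> PHS (sklyanin 0 0 r)"
proof -
  let ?\<sigma> = "(\<lambda>a. case a of Gx \<Rightarrow> 0 | Gy \<Rightarrow> 1 | Gz \<Rightarrow> 2) :: gen \<Rightarrow> nat"
  let ?s = "\<lambda>a. case a of Gx \<Rightarrow> Gx | Gy \<Rightarrow> Gy | Gz \<Rightarrow> Gz"
  have 1: "?\<sigma> ` UNIV = {..<3}" by (auto simp: UNIV_gen lessThan_3)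
  have 2: "srel 0 0 r (?\<sigma> a) = cst r * (var a * var (?s a))" for a
    by (cases a) (simp_all add: srel_def)
  have 3: "(\<Sum>j<3. smat 0 0 r i j * h j) = cst r * (var (?s (gen_nth i)) * h (?\<sigma> (gen_nth i)))"
    if "i < 3" for i h
    using less_3_cases[OF that] by (auto simp: sum_lessThan_3 smat_def mult.assoc)
  show "koszul (sklyanin 0 0 r)" "\<not> PHS (sklyanin 0 0 r)"
    using monomial_case[OF assms 1 2 3] by blast+
qed

section \<open>Sklyanin algebras with equal cubes\<close>

lemma linear_eq_on_words:
  fixes F G :: "('x, 'k::field) free_alg \<Rightarrow> ('y, 'k) free_alg"
  assumes "\<And>f g. F (f + g) = F f + F g" "\<And>c f. F (cst c * f) = cst c * F f"
    and "\<And>f g. G (f + g) = G f + G g" "\<And>c f. G (cst c * f) = cst c * G f"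
    and "\<And>w. F (word w) = G (word w)"
  shows "F f = G f"
proof (induction f rule: free_alg_induct)
  case zero
  show ?case using assms(2)[of 0 0] assms(4)[of 0 0] by simp
next
  case (add w c f)
  then show ?case unfolding single_eq_cst_mult[of w c] by (simp only: assms)
qed

text \<open>
  The relations with parameters \<open>(a, b, 1)\<close>, \<open>a\<^sup>3 = b\<^sup>3 = 1\<close>, rewrite the words \<open>xx\<close>, \<open>xy\<close>, \<open>xz\<close>
  and form a Groebner basis. \<open>lmul_x_word\<close> is left multiplication by \<open>x\<close> on normal words, those
  with no letter after an \<open>x\<close>.
\<close>

fun lmul_x_word :: "'k::field \<Rightarrow> 'k \<Rightarrow> gen list \<Rightarrow> (gen, 'k) free_alg" where
  "lmul_x_word a b [] = vx"
| "lmul_x_word a b (Gx # w) = - (cst a * (vy * (vz * word w)) + cst b * (vz * (vy * word w)))"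
| "lmul_x_word a b (Gy # w) =
    - (cst (b * a^2) * (vy * lmul_x_word a b w)) - cst (a^2) * (vz * (vz * word w))"
| "lmul_x_word a b (Gz # w) =
    - (cst (a * b^2) * (vz * lmul_x_word a b w)) - cst (b^2) * (vy * (vy * word w))"

definition lmul_x :: "'k::field \<Rightarrow> 'k \<Rightarrow> (gen, 'k) free_alg \<Rightarrow> (gen, 'k) free_alg" where
  "lmul_x a b = lin_ext (lmul_x_word a b)"

text \<open>The letters of a word act on 1 one after the other, starting with the last:
  \<open>y\<close> and \<open>z\<close> by concatenation, \<open>x\<close> by \<open>lmul_x\<close>.
  What replaces confluence is the check that these operators satisfy the relations.\<close>

fun nform_word :: "'k::field \<Rightarrow> 'k \<Rightarrow> gen list \<Rightarrow> (gen, 'k) free_alg" where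
  "nform_word a b [] = 1"
| "nform_word a b (Gx # w) = lmul_x a b (nform_word a b w)"
| "nform_word a b (Gy # w) = vy * nform_word a b w"
| "nform_word a b (Gz # w) = vz * nform_word a b w"

definition nform :: "'k::field \<Rightarrow> 'k \<Rightarrow> (gen, 'k) free_alg \<Rightarrow> (gen, 'k) free_alg" where
  "nform a b = lin_ext (nform_word a b)"

fun normal_word :: "gen list \<Rightarrow> bool" where
  "normal_word [] = True"
| "normal_word (Gx # w) = (w = [])"
| "normal_word (Gy # w) = normal_word w"
| "normal_word (Gz # w) = normal_word w"

definition normal_space :: "(gen, 'k::field) free_alg set" where
  "normal_space = fa.span (word ` Collect normal_word)"

lemma lmul_x_simps:
  "lmul_x a b (f + g) = lmul_x a b f + lmul_x a b g"
  "lmul_x a b (f - g) = lmul_x a b f - lmul_x a b g"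
  "lmul_x a b (- f) = - lmul_x a b f"
  "lmul_x a b (cst c * f) = cst c * lmul_x a b f"
  "lmul_x a b 0 = 0"
  "lmul_x a b (word w) = lmul_x_word a b w"
  "lmul_x a b 1 = vx"
  by (simp_all add: lmul_x_def)

text \<open>The coefficients come from solving the third relation for \<open>xy\<close>, where
  \<open>a^2\<close> is the inverse of \<open>a\<close> once \<open>a^3 = 1\<close>. In the same way
  \<open>lmul_x_z\<close> stems from solving the second relation for \<open>xz\<close>.\<close>

lemma lmul_x_y: "lmul_x a b (vy * f) = - (cst (b * a^2) * (vy * lmul_x a b f)) - cst (a^2) * (vz * (vz * f))"
proof (rule linear_eq_on_words[where F = "\<lambda>f. lmul_x a b (vy * f)"])
  show "lmul_x a b (vy * word w) =
      - (cst (b * a^2) * (vy * lmul_x a b (word w))) - cst (a^2) * (vz * (vz * word w))" for w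
    unfolding word_Cons[symmetric] lmul_x_simps by (simp add: word_Cons)
qed (simp_all only: lmul_x_simps distrib_left var_cst_left_commute, simp_all add: algebra_simps cst_cst_mult)

lemma lmul_x_z: "lmul_x a b (vz * f) = - (cst (a * b^2) * (vz * lmul_x a b f)) - cst (b^2) * (vy * (vy * f))"
proof (rule linear_eq_on_words[where F = "\<lambda>f. lmul_x a b (vz * f)"])
  show "lmul_x a b (vz * word w) =
      - (cst (a * b^2) * (vz * lmul_x a b (word w))) - cst (b^2) * (vy * (vy * word w))" for w
    unfolding word_Cons[symmetric] lmul_x_simps by (simp add: word_Cons)
qed (simp_all only: lmul_x_simps distrib_left var_cst_left_commute, simp_all add: algebra_simps cst_cst_mult)

lemma normal_space_0: "0 \<in> normal_space"
  by (simp add: normal_space_def fa.span_zero)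

lemma normal_space_add: "f \<in> normal_space \<Longrightarrow> g \<in> normal_space \<Longrightarrow> f + g \<in> normal_space"
  by (simp add: normal_space_def fa.span_add)

lemma normal_space_diff: "f \<in> normal_space \<Longrightarrow> g \<in> normal_space \<Longrightarrow> f - g \<in> normal_space"
  by (simp add: normal_space_def fa.span_diff)

lemma normal_space_uminus: "f \<in> normal_space \<Longrightarrow> - f \<in> normal_space"
  by (simp add: normal_space_def fa.span_neg)

lemma normal_space_cst: "f \<in> normal_space \<Longrightarrow> cst c * f \<in> normal_space"
  by (simp add: normal_space_def fa.span_scale)

lemma normal_space_word: "normal_word w \<Longrightarrow> word w \<in> normal_space"
  by (simp add: normal_space_def fa.span_base)

lemma normal_space_induct [consumes 1, case_names zero add]:
  assumes "f \<in> normal_space" "P 0" "\<And>c w g. normal_word w \<Longrightarrow> P g \<Longrightarrow> P (cst c * word w + g)"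
  shows "P f"
  using assms(1) unfolding normal_space_def
  by (induction rule: fa.span_induct_alt) (use assms(2,3) in auto)

lemma normal_space_yz:
  assumes "f \<in> normal_space"
  shows "vy * f \<in> normal_space" "vz * f \<in> normal_space"
proof -
  have 1: "vy * word w \<in> normal_space" "vz * word w \<in> normal_space" if "normal_word w" for w
    using normal_space_word[of "Gy # w"] normal_space_word[of "Gz # w"] that by (simp_all add: word_Cons)
  show "vy * f \<in> normal_space"
    using assms by (induction rule: normal_space_induct)
      (simp_all add: distrib_left var_cst_left_commute 1 normal_space_0 normal_space_add normal_space_cst)
  show "vz * f \<in> normal_space"
    using assms by (induction rule: normal_space_induct)
      (simp_all add: distrib_left var_cst_left_commute 1 normal_space_0 normal_space_add normal_space_cst)
qed

lemma lmul_x_word_normal: "normal_word w \<Longrightarrow> lmul_x_word a b w \<in> normal_space"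
proof (induction w rule: normal_word.induct)
  case 1
  show ?case using normal_space_word[of "[Gx]"] by (simp add: word_Cons)
next
  case (2 w)
  have "vy * (vz * 1) \<in> normal_space" "vz * (vy * 1) \<in> normal_space"
    using normal_space_word[of "[]"] by (auto intro!: normal_space_yz simp del: mult_1_right)
  then show ?case using 2 by (auto intro!: normal_space_uminus normal_space_diff normal_space_cst)
qed (auto intro!: normal_space_uminus normal_space_diff normal_space_cst normal_space_yz normal_space_word)

lemma lmul_x_normal: "f \<in> normal_space \<Longrightarrow> lmul_x a b f \<in> normal_space"
  by (induction rule: normal_space_induct)
    (simp_all add: lmul_x_simps lmul_x_word_normal normal_space_0 normal_space_add normal_space_cst)

lemma nform_normal: "nform a b f \<in> normal_space"
proof -
  have "nform_word a b w \<in> normal_space" for w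
    by (induction a b w rule: nform_word.induct)
      (use normal_space_word[of "[]"] in \<open>simp_all add: lmul_x_normal normal_space_yz\<close>)
  then show ?thesis unfolding nform_def
    by (intro lin_ext_closed) (auto intro: normal_space_0 normal_space_add normal_space_cst)
qed

lemma nform_simps:
  "nform a b (f + g) = nform a b f + nform a b g"
  "nform a b (cst c * f) = cst c * nform a b f"
  "nform a b 0 = 0"
  "nform a b 1 = 1"
  "nform a b (vx * f) = lmul_x a b (nform a b f)"
  "nform a b (vy * f) = vy * nform a b f"
  "nform a b (vz * f) = vz * nform a b f"
  by (simp_all add: nform_def lin_ext_var_mult lmul_x_def lin_ext_comp mult_lin_ext)

context
  fixes a b :: "'k::field"
  assumes a3: "a ^ 3 = 1" and b3: "b ^ 3 = 1"
begin

lemma cube_powers: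
  "a * a\<^sup>2 = 1" "b * b\<^sup>2 = 1" "a * (a * a) = 1" "b * (b * b) = 1" "a * (a * (a * c)) = c" "b * (b * (b * c)) = c"
  using a3 b3 by (simp_all add: power3_eq_cube power2_eq_square flip: mult.assoc)

text \<open>These are the overlaps \<open>xxy\<close> and \<open>xxz\<close> of the rewriting rules;
  they resolve because \<open>a\<close> and \<open>b\<close> are cube roots of unity.\<close>

lemma lmul_x_twice_step:
  assumes "lmul_x a b (lmul_x a b f) = - (cst a * (vy * (vz * f)) + cst b * (vz * (vy * f)))"
  shows "lmul_x a b (lmul_x a b (vy * f)) = - (cst a * (vy * (vz * (vy * f))) + cst b * (vz * (vy * (vy * f))))"
    "lmul_x a b (lmul_x a b (vz * f)) = - (cst a * (vy * (vz * (vz * f))) + cst b * (vz * (vy * (vz * f))))"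
  by (simp_all add: lmul_x_y lmul_x_z lmul_x_simps assms var_cst_left_commute cst_cst_mult algebra_simps
      power2_eq_square cube_powers)

lemma lmul_x_twice_1: "lmul_x a b vx = - (cst a * (vy * vz) + cst b * (vz * vy))"
  using lmul_x_simps(6)[of a b "[Gx]"] by (simp add: word_Cons)

text \<open>This is the first relation as an identity of operators; the other two are
  \<open>lmul_x_y\<close> and \<open>lmul_x_z\<close>. The word \<open>x\<close> itself contributes
  the overlap \<open>xxx\<close>. The identity is confined to normal forms, since
  \<open>lmul_x\<close> treats a word \<open>xw\<close> as if \<open>xx\<close> could be rewritten
  in front of any \<open>w\<close>.\<close>

lemma lmul_x_twice:
  assumes "f \<in> normal_space"
  shows "lmul_x a b (lmul_x a b f) = - (cst a * (vy * (vz * f)) + cst b * (vz * (vy * f)))"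
  using assms
proof (induction rule: normal_space_induct)
  case zero
  show ?case by (simp add: lmul_x_simps)
next
  case (add c w g)
  have "lmul_x a b (lmul_x a b (word w)) = - (cst a * (vy * (vz * word w)) + cst b * (vz * (vy * word w)))"
    using add(1)
  proof (induction w rule: normal_word.induct)
    case 1
    show ?case using lmul_x_twice_1 by (simp add: lmul_x_simps)
  next
    case (2 w)
    have y: "lmul_x a b vy = - (cst (b * a\<^sup>2) * (vy * vx)) - cst (a\<^sup>2) * (vz * vz)"
      using lmul_x_y[of a b 1] unfolding mult_1_right lmul_x_simps .
    have z: "lmul_x a b vz = - (cst (a * b\<^sup>2) * (vz * vx)) - cst (b\<^sup>2) * (vy * vy)"
      using lmul_x_z[of a b 1] unfolding mult_1_right lmul_x_simps .
    have "lmul_x a b (lmul_x a b vx) = - (cst a * (vy * (vz * vx)) + cst b * (vz * (vy * vx)))"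
      by (simp add: lmul_x_twice_1 y z lmul_x_y lmul_x_z lmul_x_simps var_cst_left_commute cst_cst_mult algebra_simps
          power2_eq_square cube_powers var_cst_commute)
    then show ?case using 2 by (simp add: word_Cons)
  qed (simp_all add: word_Cons lmul_x_twice_step)
  then have w: "lmul_x a b (lmul_x_word a b w) = - (cst a * (vy * (vz * word w)) + cst b * (vz * (vy * word w)))"
    unfolding lmul_x_simps .
  show ?case
    by (simp add: lmul_x_simps w add(2) distrib_left var_cst_left_commute cst_cst_mult algebra_simps)
qed

lemma nform_rel_ideal:
  assumes "f \<in> rel_ideal (sklyanin a b 1)"
  shows "nform a b f = 0"
proof -
  \<comment> \<open>The quantified right factor makes this set closed under multiplication by
    letters from the right.\<close>
  have "f \<in> {f. \<forall>g. nform a b (f * g) = 0}"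
    using assms
  proof (rule rel_ideal_minimal)
    show "sklyanin a b 1 \<subseteq> {f. \<forall>g. nform a b (f * g) = 0}"
    proof -
      have "nform a b (srel a b 1 j * g) = 0" for j g
        by (simp add: srel_def distrib_right mult.assoc nform_simps lmul_x_twice[OF nform_normal]
            lmul_x_y lmul_x_z var_cst_left_commute cst_cst_mult algebra_simps power2_eq_square cube_powers)
      then show ?thesis by (auto simp: sklyanin_srel)
    qed
    fix f :: "(gen, 'k) free_alg" and v
    assume "f \<in> {f. \<forall>g. nform a b (f * g) = 0}"
    then show "var v * f \<in> {f. \<forall>g. nform a b (f * g) = 0}"
      by (cases v) (simp_all add: mult.assoc nform_simps lmul_x_simps)
  qed (auto simp: nform_simps distrib_right mult.assoc)
  then have "nform a b (f * 1) = 0" by blast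
  then show ?thesis by simp
qed

lemma lmul_x_diff_rel_ideal: "lmul_x a b f - vx * f \<in> rel_ideal (sklyanin a b 1)"
proof -
  let ?I = "rel_ideal (sklyanin a b 1)"
  have rel: "cst c * (srel a b 1 j * g) \<in> ?I" for c j g
    by (intro rel_ideal_mult_left rel_ideal_mult_right srel_in_rel_ideal)
  have "lmul_x_word a b w - vx * word w \<in> ?I" for w
  proof (induction w rule: normal_word.induct)
    case (2 w)
    have "lmul_x_word a b (Gx # w) - vx * word (Gx # w) = cst (- 1) * (srel a b 1 0 * word w)"
      by (simp add: srel_def word_Cons distrib_right mult.assoc single_uminus)
    then show ?case using rel by metis
  next
    case (3 w)
    have "lmul_x_word a b (Gy # w) - vx * word (Gy # w) =
      cst (- (b * a\<^sup>2)) * (vy * (lmul_x_word a b w - vx * word w)) + cst (- (a\<^sup>2)) * (srel a b 1 2 * word w)"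
      by (simp add: srel_def word_Cons mult.assoc single_uminus cst_cst_mult algebra_simps var_cst_left_commute
          power2_eq_square cube_powers)
    then show ?case using rel 3 by (metis rel_ideal_add rel_ideal_mult_left)
  next
    case (4 w)
    have "lmul_x_word a b (Gz # w) - vx * word (Gz # w) =
      cst (- (a * b\<^sup>2)) * (vz * (lmul_x_word a b w - vx * word w)) + cst (- (b\<^sup>2)) * (srel a b 1 1 * word w)"
      by (simp add: srel_def word_Cons mult.assoc single_uminus cst_cst_mult algebra_simps var_cst_left_commute
          power2_eq_square cube_powers)
    then show ?case using rel 4 by (metis rel_ideal_add rel_ideal_mult_left)
  qed simp
  then have "lin_ext (\<lambda>w. lmul_x_word a b w - vx * word w) f \<in> ?I"
    by (intro lin_ext_closed) auto
  moreover have "lmul_x a b f - vx * f = lin_ext (\<lambda>w. lmul_x_word a b w - vx * word w) f"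
    by (rule linear_eq_on_words[where F = "\<lambda>f. lmul_x a b f - vx * f"])
      (simp_all add: lmul_x_simps algebra_simps var_cst_left_commute)
  ultimately show ?thesis by simp
qed

lemma nform_diff_rel_ideal: "nform a b f - f \<in> rel_ideal (sklyanin a b 1)"
proof -
  let ?I = "rel_ideal (sklyanin a b 1)"
  have var_diff: "var v * g - var v * h \<in> ?I" if "g - h \<in> ?I" for v g h
    using rel_ideal_mult_left[OF that, of "var v"] by (simp add: right_diff_distrib)
  have "nform_word a b w - word w \<in> ?I" for w
  proof (induction w)
    case (Cons v w)
    then show ?case
      using var_diff[OF Cons, of v] rel_ideal_diff_trans[OF lmul_x_diff_rel_ideal]
      by (cases v) (simp_all add: word_Cons)
  qed simp
  then have "lin_ext (\<lambda>w. nform_word a b w - word w) f \<in> ?I"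
    by (intro lin_ext_closed) auto
  moreover have "nform a b f - f = lin_ext (\<lambda>w. nform_word a b w - word w) f"
    by (rule linear_eq_on_words[where F = "\<lambda>f. nform a b f - f"])
      (simp_all add: nform_simps algebra_simps, simp add: nform_def)
  ultimately show ?thesis by simp
qed

text \<open>No rewriting rule applies to a leading \<open>y\<close> or \<open>z\<close>, so normal
  forms keep these first letters. Hence \<open>y\<close> and \<open>z\<close> generate a free right
  ideal of rank 2 in the quotient.\<close>

lemma yz_independent:
  assumes "vy * u + vz * v \<in> rel_ideal (sklyanin a b 1)"
  shows "u \<in> rel_ideal (sklyanin a b 1)" "v \<in> rel_ideal (sklyanin a b 1)"
proof -
  have eq: "vy * nform a b u + vz * nform a b v = 0"
    using nform_rel_ideal[OF assms] by (simp add: nform_simps)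
  have "nform a b u = 0" "nform a b v = 0"
    using arg_cong[OF eq, of "left_quot Gy"] arg_cong[OF eq, of "left_quot Gz"] by simp_all
  then show "u \<in> rel_ideal (sklyanin a b 1)" "v \<in> rel_ideal (sklyanin a b 1)"
    using nform_diff_rel_ideal[of u] nform_diff_rel_ideal[of v] rel_ideal_uminus by fastforce+
qed

text \<open>These are the columns of \<open>smat a b 1\<close> with the last two exchanged, scaled
  by 1, \<open>a^2\<close>, \<open>b^2\<close> so that the first row becomes \<open>x\<close>,
  \<open>y\<close>, \<open>z\<close>. In this form the same matrix can be used at every later step
  of the resolution.\<close>

definition cubic_mat :: "nat \<Rightarrow> nat \<Rightarrow> (gen, 'k) free_alg" where
  "cubic_mat i j =
    (if i = 0 then (if j = 0 then vx else if j = 1 then vy else vz)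
     else if i = 1 then (if j = 0 then cst a * vz else if j = 1 then cst (b * a^2) * vx else cst (b^2) * vy)
     else (if j = 0 then cst b * vy else if j = 1 then cst (a^2) * vz else cst (a * b^2) * vx))"

lemma cubic_mat_0: "j < 3 \<Longrightarrow> cubic_mat 0 j = var (gen_nth j)"
  by (auto simp: cubic_mat_def dest!: less_3_cases)

lemma cubic_mat_homogeneous: "cubic_mat i j \<in> homogeneous 1"
  using homogeneous_var by (auto simp: cubic_mat_def simp del: One_nat_def)

lemma cubic_exact:
  assumes "(\<Sum>j<3. var (gen_nth j) * f j) \<in> rel_ideal (sklyanin a b 1)"
  shows "\<exists>g. \<forall>j<3. f j - (\<Sum>k<3. cubic_mat j k * g k) \<in> rel_ideal (sklyanin a b 1)"
proof -
  obtain h where h: "\<And>i. i < 3 \<Longrightarrow> f i - (\<Sum>j<3. smat a b 1 i j * h j) \<in> rel_ideal (sklyanin a b 1)"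
    using sklyanin_exact_first[OF assms] by blast
  \<comment> \<open>This undoes the exchange and the scaling of columns: \<open>a\<close> and
    \<open>b\<close> are inverse to \<open>a^2\<close> and \<open>b^2\<close>.\<close>
  define g where "g k = (if k = 0 then h 0 else if k = 1 then cst a * h 2 else cst b * h 1)" for k :: nat
  have "(\<Sum>k<3. cubic_mat i k * g k) = (\<Sum>j<3. smat a b 1 i j * h j)" if "i < 3" for i
    using less_3_cases[OF that]
    by (auto simp: sum_lessThan_3 cubic_mat_def smat_def g_def mult.assoc cst_cst_mult var_cst_left_commute
        power2_eq_square cube_powers algebra_simps)
  then have "\<forall>j<3. f j - (\<Sum>k<3. cubic_mat j k * g k) \<in> rel_ideal (sklyanin a b 1)"
    using h by simp
  then show ?thesis by blast
qed

definition cubic_rel :: "nat \<Rightarrow> (gen, 'k) free_alg" where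
  "cubic_rel k = (if k = 0 then srel a b 1 0 else if k = 1 then cst (a\<^sup>2) * srel a b 1 2 else cst (b\<^sup>2) * srel a b 1 1)"

lemma cubic_rel_eq:
  assumes "k < 3"
  shows "(\<Sum>j<3. var (gen_nth j) * cubic_mat j k) = cubic_rel k"
  using less_3_cases[OF assms]
  by (auto simp: sum_lessThan_3 cubic_rel_def cubic_mat_def srel_def cst_cst_mult var_cst_left_commute
      power2_eq_square cube_powers algebra_simps)

lemma cubic_rel_in: "cubic_rel k \<in> rel_ideal (sklyanin a b 1)"
  by (simp add: cubic_rel_def srel_in_rel_ideal rel_ideal_mult_left)

text \<open>Write \<open>N\<close> for the matrix. Row 0 of \<open>N N\<close> consists of multiples
  of relations. Multiplying \<open>N N\<close> by the row of letters gives the row of relations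
  times \<open>N\<close>, which lies in the ideal; after removing the contribution of row 0,
  \<open>yz_independent\<close> separates the other two rows.\<close>

lemma cubic_complex:
  assumes "i < 3" "k < 3"
  shows "(\<Sum>j<3. cubic_mat i j * cubic_mat j k) \<in> rel_ideal (sklyanin a b 1)"
proof -
  let ?I = "rel_ideal (sklyanin a b 1)"
  define c where "c i = (\<Sum>j<3. cubic_mat i j * cubic_mat j k)" for i
  have "c 0 = (\<Sum>j<3. var (gen_nth j) * cubic_mat j k)"
    unfolding c_def by (rule sum.cong) (simp_all add: cubic_mat_0)
  then have c0: "c 0 \<in> ?I" using cubic_rel_eq[OF assms(2)] cubic_rel_in by simp
  have "(\<Sum>i<3. var (gen_nth i) * c i) = (\<Sum>j<3. cubic_rel j * cubic_mat j k)"
    unfolding c_def sum_distrib_left mult.assoc[symmetric]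
    by (subst sum.swap) (auto simp: cubic_rel_eq simp flip: sum_distrib_right)
  also have "\<dots> \<in> ?I" by (intro rel_ideal_sum rel_ideal_mult_right cubic_rel_in)
  finally have "vx * c 0 + vy * c 1 + vz * c 2 - vx * c 0 \<in> ?I"
    using c0 by (intro rel_ideal_diff rel_ideal_mult_left) (simp_all add: sum_lessThan_3)
  then have "vy * c 1 + vz * c 2 \<in> ?I" by simp
  then have "c 1 \<in> ?I" "c 2 \<in> ?I" using yz_independent by blast+
  then show ?thesis using c0 less_3_cases[OF assms(1)] by (auto simp: c_def)
qed

text \<open>The kernel of the matrix is contained in the kernel of its first row, the row of
  letters, and by \<open>cubic_exact\<close> the latter is the image of the matrix. This settles all
  steps at once. \<open>R\<close> is only tied to the ideal so that \<open>r\<close> can be scaled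
  to 1.\<close>

lemma cubic_koszul:
  assumes R: "R \<subseteq> homogeneous 2" and I: "rel_ideal R = rel_ideal (sklyanin a b 1)"
  shows "koszul R"
proof -
  let ?I = "rel_ideal (sklyanin a b 1)"
  define n :: "nat \<Rightarrow> nat" where "n m = (if m = 0 then 1 else 3)" for m
  have n: "n 0 = 1" "n (m + 1) = 3" "n (Suc m) = 3" "n (m + 2) = 3" for m by (simp_all add: n_def)
  show ?thesis
  proof (rule koszul_matrices[OF R, where D = "\<lambda>m i j. cubic_mat i j" and n = n, unfolded I])
    show "cubic_mat i j \<in> homogeneous 1" for i j by (rule cubic_mat_homogeneous)
    show "n 0 = 1" by (rule n)
    show "\<exists>g. f - (\<Sum>j<n 1. cubic_mat 0 j * g j) \<in> ?I" if "Poly_Mapping.lookup f [] = 0" for f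
      using gen_cover[OF that] by (simp add: n cubic_mat_0)
    show "(\<Sum>j<n (m + 1). cubic_mat i j * cubic_mat j k) \<in> ?I" if "i < n m" "k < n (m + 2)" for m i k
    proof -
      have "i < 3" using that(1) by (simp add: n_def split: if_splits)
      then show ?thesis using cubic_complex[of i k] that(2) unfolding n by simp
    qed
    fix m f
    assume *: "\<And>i. i < n m \<Longrightarrow> (\<Sum>j<n (m + 1). cubic_mat i j * f j) \<in> ?I"
    have "(\<Sum>j<3. var (gen_nth j) * f j) \<in> ?I"
      using *[of 0] by (simp add: n_def cubic_mat_0 split: if_splits)
    then show "\<exists>g. \<forall>j<n (m + 1). f j - (\<Sum>k<n (m + 2). cubic_mat j k * g k) \<in> ?I"
      using cubic_exact unfolding n by blast
  qed
qed

text \<open>\<open>W\<close> has nine products of a letter with a relation and six products of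
  relations 1 and 2 with a letter. The remaining products of relation 0 with a letter come from
  associativity: letters times (\<open>N N\<close>), with \<open>N\<close> the matrix
  \<open>cubic_mat\<close>, is a combination of products of the first kind, and it equals relation 0
  times a letter plus products of the second kind. So 15 elements suffice.\<close>

lemma cubic_not_PHS: "\<not> PHS (sklyanin a b 1)"
proof -
  define W :: "(gen, 'k) free_alg set" where
    "W = (\<lambda>(v, j). var v * srel a b 1 j) ` (UNIV \<times> {..<3}) \<union> (\<lambda>(v, j). srel a b 1 j * var v) ` (UNIV \<times> {1, 2})"
  have fin: "finite W"
    unfolding W_def by (intro finite_UnI finite_imageI finite_cartesian_product) simp_all
  have "card W \<le> card (UNIV \<times> {..<3} :: (gen \<times> nat) set) + card (UNIV \<times> {1, 2} :: (gen \<times> nat) set)"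
    unfolding W_def by (rule order_trans[OF card_Un_le add_mono[OF card_image_le card_image_le]]) simp_all
  also have "\<dots> = 15" by (simp add: card_cartesian_product card_gen)
  finally have card: "card W \<le> 16" by simp
  have W1: "var v * srel a b 1 j \<in> fa.span W" if "j < 3" for v j
    unfolding W_def using that by (intro fa.span_base UnI1 image_eqI[of _ _ "(v, j)"]) auto
  have W2: "srel a b 1 j * var v \<in> fa.span W" if "j = 1 \<or> j = 2" for v j
    unfolding W_def using that by (intro fa.span_base UnI2 image_eqI[of _ _ "(v, j)"]) auto
  have var_span: "var v * u \<in> fa.span W" if "u \<in> fa.span (srel a b 1 ` {..<3})" for v u
    using that
  proof (induction rule: fa.span_induct_alt)
    case (step c x y)
    then show ?case using W1
      by (auto simp: distrib_left var_cst_left_commute intro!: fa.span_add fa.span_scale)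
  qed (simp add: fa.span_zero)
  have W0: "srel a b 1 0 * var (gen_nth k) \<in> fa.span W" if k: "k < 3" for k
  proof -
    define c where "c i = (\<Sum>j<3. cubic_mat i j * cubic_mat j k)" for i
    have hom: "c i \<in> homogeneous 2" for i
      unfolding c_def using homogeneous_mult[OF cubic_mat_homogeneous cubic_mat_homogeneous]
      by (intro homogeneous_sum) (simp add: numeral_2_eq_2)
    then have "c i \<in> fa.span (srel a b 1 ` {..<3})" if "i < 3" for i
      using cubic_complex[OF that k] ideal_comp_2_span[of a b 1] hom by (auto simp: c_def ideal_comp_def)
    then have "(\<Sum>i<3. var (gen_nth i) * c i) \<in> fa.span W"
      by (intro fa.span_sum var_span) simp
    also have "(\<Sum>i<3. var (gen_nth i) * c i) = (\<Sum>j<3. cubic_rel j * cubic_mat j k)"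
      unfolding c_def sum_distrib_left mult.assoc[symmetric]
      by (subst sum.swap) (auto simp: cubic_rel_eq simp flip: sum_distrib_right)
    finally have 1: "cubic_rel 0 * var (gen_nth k) + (cubic_rel 1 * cubic_mat 1 k + cubic_rel 2 * cubic_mat 2 k) \<in> fa.span W"
      by (simp add: sum_lessThan_3 cubic_mat_0[OF k] add.assoc)
    have 2: "cubic_rel j * cubic_mat j k \<in> fa.span W" if jk: "j = 1 \<or> j = 2" for j
    proof -
      have "\<exists>d v. cubic_mat j k = cst d * var v"
        using jk less_3_cases[OF k] by (auto simp: cubic_mat_def)
      then show ?thesis using jk W2
        by (auto simp: cubic_rel_def cst_left_commute mult.assoc intro!: fa.span_scale)
    qed
    have "cubic_rel 0 * var (gen_nth k) \<in> fa.span W"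
      using fa.span_diff[OF 1 fa.span_add[OF 2[of 1] 2[of 2]]] by simp
    then show ?thesis by (simp add: cubic_rel_def)
  qed
  show ?thesis
  proof (rule not_PHS_if_span[OF W1 _ _ card])
    fix v j assume "j < (3 :: nat)"
    have "\<exists>k<3. v = gen_nth k"
      by (cases v) (auto intro: exI[of _ 0] exI[of _ 1] exI[of _ 2])
    then show "srel a b 1 j * var v \<in> fa.span W"
      using W0 W2 less_3_cases[OF \<open>j < 3\<close>] by blast
  qed (simp_all add: fin)
qed

end

lemma rel_ideal_subset:
  assumes "R \<subseteq> rel_ideal R'"
  shows "rel_ideal R \<subseteq> rel_ideal R'"
proof
  fix f assume "f \<in> rel_ideal R"
  then show "f \<in> rel_ideal R'" by (rule rel_ideal_minimal) (use assms in auto)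
qed

lemma equal_cubes_case:
  assumes "(r :: 'k::field) \<noteq> 0" "p ^ 3 = q ^ 3" "q ^ 3 = r ^ 3"
  shows "koszul (sklyanin p q r)" "\<not> PHS (sklyanin p q r)"
proof -
  define a b where "a = p / r" and "b = q / r"
  have a3: "a ^ 3 = 1" and b3: "b ^ 3 = 1"
    using assms by (simp_all add: a_def b_def power_divide)
  have 1: "srel p q r j = cst r * srel a b 1 j" for j
    using assms(1) by (simp add: srel_def a_def b_def distrib_left cst_cst_mult)
  then have 2: "srel a b 1 j = cst (inverse r) * srel p q r j" for j
    using assms(1) by (simp add: cst_cst_mult)
  have I: "rel_ideal (sklyanin p q r) = rel_ideal (sklyanin a b 1)"
  proof
    show "rel_ideal (sklyanin p q r) \<subseteq> rel_ideal (sklyanin a b 1)"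
      by (rule rel_ideal_subset)
        (auto simp: sklyanin_srel[of p q r] 1 intro!: rel_ideal_mult_left srel_in_rel_ideal)
    show "rel_ideal (sklyanin a b 1) \<subseteq> rel_ideal (sklyanin p q r)"
      by (rule rel_ideal_subset)
        (auto simp: sklyanin_srel[of a b 1] 2 intro!: rel_ideal_mult_left srel_in_rel_ideal)
  qed
  show "koszul (sklyanin p q r)" by (rule cubic_koszul[OF a3 b3 sklyanin_quadratic I])
  show "\<not> PHS (sklyanin p q r)"
    using cubic_not_PHS[OF a3 b3] unfolding PHS_iff[OF sklyanin_quadratic] by (simp add: ideal_comp_def I)
qed

section \<open>Point and line modules\<close>

type_synonym 'k vec3 = "gen \<Rightarrow> 'k"

definition lform :: "'k::field vec3 \<Rightarrow> (gen, 'k) free_alg" where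
  "lform u = cst (u Gx) * vx + cst (u Gy) * vy + cst (u Gz) * vz"

definition dot3 :: "'k::field vec3 \<Rightarrow> 'k vec3 \<Rightarrow> 'k" where
  "dot3 u v = u Gx * v Gx + u Gy * v Gy + u Gz * v Gz"

definition cross3 :: "'k::field vec3 \<Rightarrow> 'k vec3 \<Rightarrow> 'k vec3" where
  "cross3 u v a = (case a of Gx \<Rightarrow> u Gy * v Gz - u Gz * v Gy
     | Gy \<Rightarrow> u Gz * v Gx - u Gx * v Gz | Gz \<Rightarrow> u Gx * v Gy - u Gy * v Gx)"

definition vec3 :: "'k \<Rightarrow> 'k \<Rightarrow> 'k \<Rightarrow> 'k vec3" where
  "vec3 a b c v = (case v of Gx \<Rightarrow> a | Gy \<Rightarrow> b | Gz \<Rightarrow> c)"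

lemma vec3_simps [simp]: "vec3 a b c Gx = a" "vec3 a b c Gy = b" "vec3 a b c Gz = c"
  by (simp_all add: vec3_def)

lemma cross3_simps:
  "cross3 u v Gx = u Gy * v Gz - u Gz * v Gy"
  "cross3 u v Gy = u Gz * v Gx - u Gx * v Gz"
  "cross3 u v Gz = u Gx * v Gy - u Gy * v Gx"
  by (simp_all add: cross3_def)

lemma vec3_eq_iff: "u = v \<longleftrightarrow> u Gx = v Gx \<and> u Gy = v Gy \<and> (u Gz :: 'k) = v Gz"
proof
  assume "u Gx = v Gx \<and> u Gy = v Gy \<and> u Gz = v Gz"
  then have "u a = v a" for a by (cases a) auto
  then show "u = v" by (rule ext)
qed simp

lemma vec3_nonzero_iff: "u \<noteq> (\<lambda>_. 0 :: 'k::zero) \<longleftrightarrow> u Gx \<noteq> 0 \<or> u Gy \<noteq> 0 \<or> u Gz \<noteq> 0"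
  by (auto simp: vec3_eq_iff)

lemma lform_homogeneous: "lform u \<in> homogeneous 1"
  unfolding lform_def by (intro homogeneous_add homogeneous_cst_mult homogeneous_var)

lemma hcomp_Suc_lform_mult: "hcomp (Suc n) (lform u * f) = lform u * hcomp n f"
  using hcomp_homogeneous_mult(1)[OF lform_homogeneous, of n u f] by simp

lemma exists_dot3_one:
  fixes x :: "'k::field vec3"
  assumes "x \<noteq> (\<lambda>_. 0)"
  obtains l where "dot3 l x = 1"
proof -
  consider "x Gx \<noteq> 0" | "x Gy \<noteq> 0" | "x Gz \<noteq> 0" using assms by (auto simp: vec3_nonzero_iff)
  then show thesis
  proof cases
    case 1
    then show ?thesis by (intro that[of "vec3 (1 / x Gx) 0 0"]) (simp add: dot3_def)
  next
    case 2
    then show ?thesis by (intro that[of "vec3 0 (1 / x Gy) 0"]) (simp add: dot3_def)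
  next
    case 3
    then show ?thesis by (intro that[of "vec3 0 0 (1 / x Gz)"]) (simp add: dot3_def)
  qed
qed

text \<open>This is Cramer's rule as a vector identity, in which the term with
  \<open>dot3 w (cross3 u v)\<close> drops out.\<close>

lemma span_if_cross3:
  fixes u v w :: "'k::field vec3"
  assumes "cross3 u v \<noteq> (\<lambda>_. 0)" "dot3 w (cross3 u v) = 0"
  shows "\<exists>s t. \<forall>a. w a = s * u a + t * v a"
proof -
  obtain l where l: "dot3 l (cross3 u v) = 1" using exists_dot3_one[OF assms(1)] .
  have "dot3 l (cross3 u v) * w a =
      dot3 l (cross3 w v) * u a + dot3 l (cross3 u w) * v a + dot3 w (cross3 u v) * l a" for a
    by (cases a) (simp_all add: dot3_def cross3_simps algebra_simps)
  then have "w a = dot3 l (cross3 w v) * u a + dot3 l (cross3 u w) * v a" for a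
    using l assms(2) by simp
  then show ?thesis by blast
qed

text \<open>The witness comes from the expansion of the double product of \<open>h\<close> with
  \<open>cross3 x l\<close>, normalized by \<open>dot3 l h = 1\<close>.\<close>

lemma cross3_surj:
  fixes h x :: "'k::field vec3"
  assumes "h \<noteq> (\<lambda>_. 0)" "dot3 h x = 0"
  shows "\<exists>k. cross3 h k = x"
proof -
  obtain l where l: "dot3 l h = 1" using exists_dot3_one[OF assms(1)] .
  have "cross3 h (cross3 x l) a = dot3 l h * x a - dot3 h x * l a" for a
    by (cases a) (simp_all add: dot3_def cross3_simps algebra_simps)
  then show ?thesis using l assms(2) by (intro exI[of _ "cross3 x l"]) auto
qed

text \<open>
  The relations are the partial derivatives of a cyclically invariant cubic tensor. Hence this one
  matrix describes both the linear forms \<open>srel p q r j (x, _)\<close> at a point \<open>x\<close>, for the rows \<open>j\<close>, and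
  the columns of a combination of the relations with coefficients \<open>x\<close>.
\<close>

definition row3 :: "'k::field \<Rightarrow> 'k \<Rightarrow> 'k \<Rightarrow> 'k vec3 \<Rightarrow> gen \<Rightarrow> 'k vec3" where
  "row3 p q r x j = (case j of Gx \<Rightarrow> vec3 (r * x Gx) (q * x Gz) (p * x Gy)
     | Gy \<Rightarrow> vec3 (p * x Gz) (r * x Gy) (q * x Gx) | Gz \<Rightarrow> vec3 (q * x Gy) (p * x Gx) (r * x Gz))"

lemma row3_simps:
  "row3 p q r x Gx = vec3 (r * x Gx) (q * x Gz) (p * x Gy)"
  "row3 p q r x Gy = vec3 (p * x Gz) (r * x Gy) (q * x Gx)"
  "row3 p q r x Gz = vec3 (q * x Gy) (p * x Gx) (r * x Gz)"
  by (simp_all add: row3_def)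

definition nondegenerate :: "'k::field \<Rightarrow> 'k \<Rightarrow> 'k \<Rightarrow> bool" where
  "nondegenerate p q r \<longleftrightarrow>
    ((p \<noteq> 0 \<and> q \<noteq> 0) \<or> (p \<noteq> 0 \<and> r \<noteq> 0) \<or> (q \<noteq> 0 \<and> r \<noteq> 0)) \<and> \<not> (p ^ 3 = q ^ 3 \<and> q ^ 3 = r ^ 3)"

text \<open>The three equations are vanishing 2x2 minors at a point with coordinates
  \<open>a\<close>, \<open>b\<close>, \<open>c\<close>. Multiplied by \<open>q\<close>,
  \<open>p\<close> and \<open>r\<close> they get the same left side, so \<open>b c\<close> times
  each of the three cubes is the same.\<close>

lemma minors_aux:
  assumes nd: "nondegenerate p q (r :: 'k::field)" and a: "a \<noteq> 0"
    and eq: "p * r * a^2 = q^2 * (b * c)" "q * r * a^2 = p^2 * (b * c)" "p * q * a^2 = r^2 * (b * c)"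
  shows False
proof (cases "b * c = 0")
  case True
  then have "p * r = 0" "q * r = 0" "p * q = 0" using eq a unfolding True by simp_all
  then show False using nd by (auto simp: nondegenerate_def)
next
  case False
  have 1: "(b * c) * q ^ 3 = p * q * r * a^2"
    using arg_cong[OF eq(1), of "\<lambda>z. q * z"] by (auto simp: power2_eq_square power3_eq_cube algebra_simps)
  have 2: "(b * c) * p ^ 3 = p * q * r * a^2"
    using arg_cong[OF eq(2), of "\<lambda>z. p * z"] by (auto simp: power2_eq_square power3_eq_cube algebra_simps)
  have 3: "(b * c) * r ^ 3 = p * q * r * a^2"
    using arg_cong[OF eq(3), of "\<lambda>z. r * z"] by (auto simp: power2_eq_square power3_eq_cube algebra_simps)
  have "p ^ 3 = q ^ 3" "q ^ 3 = r ^ 3"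
    using mult_left_cancel[OF False] 1 2 3 by metis+
  then show False using nd unfolding nondegenerate_def by blast
qed

lemma rank_row3:
  assumes nd: "nondegenerate p q (r :: 'k::field)" and x: "x \<noteq> (\<lambda>_. 0)"
  shows "cross3 (row3 p q r x Gx) (row3 p q r x Gy) \<noteq> (\<lambda>_. 0) \<or>
    cross3 (row3 p q r x Gx) (row3 p q r x Gz) \<noteq> (\<lambda>_. 0) \<or>
    cross3 (row3 p q r x Gy) (row3 p q r x Gz) \<noteq> (\<lambda>_. 0)"
proof (rule ccontr)
  assume "\<not> ?thesis"
  then have z: "cross3 (row3 p q r x Gx) (row3 p q r x Gy) = (\<lambda>_. 0)"
    "cross3 (row3 p q r x Gx) (row3 p q r x Gz) = (\<lambda>_. 0)"
    "cross3 (row3 p q r x Gy) (row3 p q r x Gz) = (\<lambda>_. 0)"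
    by simp_all
  have e0: "p * r * x Gy^2 = q^2 * (x Gx * x Gz)"
    using fun_cong[OF z(1), of Gx] by (simp add: cross3_simps row3_simps power2_eq_square algebra_simps)
  have e1: "q * r * x Gx^2 = p^2 * (x Gy * x Gz)"
    using fun_cong[OF z(1), of Gy] by (simp add: cross3_simps row3_simps power2_eq_square algebra_simps)
  have e2: "p * q * x Gz^2 = r^2 * (x Gx * x Gy)"
    using fun_cong[OF z(1), of Gz] by (simp add: cross3_simps row3_simps power2_eq_square algebra_simps)
  have e3: "q * r * x Gz^2 = p^2 * (x Gx * x Gy)"
    using fun_cong[OF z(2), of Gx] by (simp add: cross3_simps row3_simps power2_eq_square algebra_simps)
  have e4: "p * q * x Gy^2 = r^2 * (x Gx * x Gz)"
    using fun_cong[OF z(2), of Gy] by (simp add: cross3_simps row3_simps power2_eq_square algebra_simps)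
  have e5: "p * r * x Gx^2 = q^2 * (x Gy * x Gz)"
    using fun_cong[OF z(2), of Gz] by (simp add: cross3_simps row3_simps power2_eq_square algebra_simps)
  have e6: "p * q * x Gx^2 = r^2 * (x Gy * x Gz)"
    using fun_cong[OF z(3), of Gx] by (simp add: cross3_simps row3_simps power2_eq_square algebra_simps)
  have e7: "p * r * x Gz^2 = q^2 * (x Gx * x Gy)"
    using fun_cong[OF z(3), of Gy] by (simp add: cross3_simps row3_simps power2_eq_square algebra_simps)
  have e8: "q * r * x Gy^2 = p^2 * (x Gx * x Gz)"
    using fun_cong[OF z(3), of Gz] by (simp add: cross3_simps row3_simps power2_eq_square algebra_simps)
  consider "x Gx \<noteq> 0" | "x Gy \<noteq> 0" | "x Gz \<noteq> 0" using x by (auto simp: vec3_nonzero_iff)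
  then show False
  proof cases
    case 1
    then show False by (rule minors_aux[OF nd _ e5 e1 e6])
  next
    case 2
    then show False by (rule minors_aux[OF nd _ e0 e8 e4])
  next
    case 3
    then show False by (rule minors_aux[OF nd _ e7 e3 e2])
  qed
qed

text \<open>\<open>y\<close> is the cross product of two independent rows, so a form vanishing at
  \<open>y\<close> is a combination of these rows. On the cubic \<open>det3\<close> it is the point
  at which all relations with first argument \<open>x\<close> vanish; off the cubic the rows span
  all forms and the same choice works.\<close>

lemma row3_annihilator:
  assumes nd: "nondegenerate p q (r :: 'k::field)" and x: "x \<noteq> (\<lambda>_. 0)"
  obtains y where "y \<noteq> (\<lambda>_. 0)"
    "\<And>w. dot3 w y = 0 \<Longrightarrow> \<exists>i j s t. w = (\<lambda>a. s * row3 p q r x i a + t * row3 p q r x j a)"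
proof -
  obtain i j where ij: "cross3 (row3 p q r x i) (row3 p q r x j) \<noteq> (\<lambda>_. 0)"
    using rank_row3[OF assms] by blast
  show thesis
  proof (rule that[OF ij])
    fix w assume "dot3 w (cross3 (row3 p q r x i) (row3 p q r x j)) = 0"
    then show "\<exists>i j s t. w = (\<lambda>a. s * row3 p q r x i a + t * row3 p q r x j a)"
      using span_if_cross3[OF ij] by (metis ext)
  qed
qed

text \<open>This is the determinant of the matrix with rows \<open>row3 p q r x\<close>.\<close>

definition det3 :: "'k::field \<Rightarrow> 'k \<Rightarrow> 'k \<Rightarrow> 'k vec3 \<Rightarrow> 'k" where
  "det3 p q r x = (p^3 + q^3 + r^3) * (x Gx * x Gy * x Gz) - p * q * r * (x Gx ^ 3 + x Gy ^ 3 + x Gz ^ 3)"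

text \<open>\<open>c\<close> is a left kernel vector of the singular matrix at \<open>x\<close>,
  found as the cross product of two independent columns. In other words, the combination of
  relations with coefficients \<open>c\<close> vanishes when its first factor is evaluated at
  \<open>x\<close>.\<close>

lemma row3_kernel:
  assumes nd: "nondegenerate p q (r :: 'k::field)" and x: "x \<noteq> (\<lambda>_. 0)" and det: "det3 p q r x = 0"
  shows "\<exists>c. c \<noteq> (\<lambda>_. 0) \<and> (\<forall>b. dot3 (row3 p q r c b) x = 0)"
proof -
  define col where "col b = (\<lambda>j. row3 p q r x j b)" for b
  have d: "(p^3 + q^3 + r^3) * (x Gx * x Gy * x Gz) - p * q * r * (x Gx ^ 3 + x Gy ^ 3 + x Gz ^ 3) = 0"
    using det by (simp add: det3_def)
  \<comment> \<open>The minors of pairs of columns are those of pairs of rows, up to sign and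
    order.\<close>
  have "\<exists>b b'. cross3 (col b) (col b') \<noteq> (\<lambda>_. 0)"
  proof (rule ccontr)
    assume "\<not> ?thesis"
    then have "cross3 (col b) (col b') = (\<lambda>_. 0)" for b b' by blast
    from this[of Gx Gy] this[of Gx Gz] this[of Gy Gz]
    show False using rank_row3[OF nd x]
      by (simp add: vec3_eq_iff cross3_simps row3_simps col_def algebra_simps) 
  qed
  then obtain b b' where nz: "cross3 (col b) (col b') \<noteq> (\<lambda>_. 0)" by blast
  have "dot3 (row3 p q r (cross3 (col b) (col b')) e) x = 0" for e
    using d by (cases b; cases b'; cases e)
      (simp_all add: dot3_def cross3_simps row3_simps col_def power3_eq_cube algebra_simps)
  then show ?thesis using nz by blast
qed

text \<open>The coefficient of \<open>s^3\<close> is the value of the cubic form at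
  \<open>u\<close>, which is assumed non-zero; so the polynomial in \<open>s\<close> is not
  constant.\<close>

lemma cubic_root:
  fixes \<alpha> \<beta> :: "'k::alg_closed_field"
  assumes "\<alpha> * (u1 * u2 * u3) - \<beta> * (u1 ^ 3 + u2 ^ 3 + u3 ^ 3) \<noteq> 0"
  shows "\<exists>s. \<alpha> * ((s * u1 + v1) * (s * u2 + v2) * (s * u3 + v3)) -
    \<beta> * ((s * u1 + v1) ^ 3 + (s * u2 + v2) ^ 3 + (s * u3 + v3) ^ 3) = 0"
proof -
  define P where "P = [:\<alpha>:] * ([:v1, u1:] * [:v2, u2:] * [:v3, u3:]) -
    [:\<beta>:] * ([:v1, u1:] ^ 3 + [:v2, u2:] ^ 3 + [:v3, u3:] ^ 3)"
  have "coeff P 3 = \<alpha> * (u1 * u2 * u3) - \<beta> * (u1 ^ 3 + u2 ^ 3 + u3 ^ 3)"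
    by (simp add: P_def power3_eq_cube numeral_3_eq_3 algebra_simps)
  then have "degree P > 0" using assms le_degree[of P 3] by simp
  then obtain s where "poly P s = 0" using alg_closed_imp_poly_has_root by blast
  then show ?thesis by (intro exI[of _ s]) (simp add: P_def algebra_simps)
qed

lemma point_on_line:
  fixes p q r :: "'k::alg_closed_field"
  assumes h: "h \<noteq> (\<lambda>_. 0)"
  shows "\<exists>x. x \<noteq> (\<lambda>_. 0) \<and> dot3 h x = 0 \<and> det3 p q r x = 0"
proof -
  \<comment> \<open>\<open>u\<close> and \<open>v\<close> span the line. The coordinate
    \<open>a\<close>, where \<open>u\<close> vanishes but \<open>v\<close> does not, keeps every
    \<open>s u + v\<close> from being zero.\<close>
  have *: "\<exists>x. x \<noteq> (\<lambda>_. 0) \<and> dot3 h x = 0 \<and> det3 p q r x = 0"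
    if uv: "dot3 h u = 0" "dot3 h v = 0" "u \<noteq> (\<lambda>_. 0)" "u a = 0" "v a \<noteq> 0" for u v a
  proof (cases "det3 p q r u = 0")
    case True
    then show ?thesis using uv by blast
  next
    case False
    then obtain s where s: "det3 p q r (\<lambda>a. s * u a + v a) = 0"
      using cubic_root[of "p^3 + q^3 + r^3" "u Gx" "u Gy" "u Gz" "p * q * r" "v Gx" "v Gy" "v Gz"]
      by (auto simp: det3_def)
    have "dot3 h (\<lambda>a. s * u a + v a) = s * dot3 h u + dot3 h v" by (simp add: dot3_def algebra_simps)
    then have "dot3 h (\<lambda>a. s * u a + v a) = 0" using uv by simp
    moreover have "(\<lambda>a. s * u a + v a) \<noteq> (\<lambda>_. 0)" using uv(4,5) by (metis add_0 mult_zero_right)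
    ultimately show ?thesis using s by blast
  qed
  consider "h Gx \<noteq> 0" | "h Gy \<noteq> 0" | "h Gz \<noteq> 0" using h by (auto simp: vec3_nonzero_iff)
  then show ?thesis
  proof cases
    case 1
    then show ?thesis using *[of "vec3 (- h Gy) (h Gx) 0" "vec3 (- h Gz) 0 (h Gx)" Gz]
      by (simp add: dot3_def vec3_nonzero_iff)
  next
    case 2
    then show ?thesis using *[of "vec3 (h Gy) (- h Gx) 0" "vec3 0 (- h Gz) (h Gy)" Gz]
      by (simp add: dot3_def vec3_nonzero_iff)
  next
    case 3
    then show ?thesis using *[of "vec3 (h Gz) 0 (- h Gx)" "vec3 0 (h Gz) (- h Gy)" Gy]
      by (simp add: dot3_def vec3_nonzero_iff)
  qed
qed

section \<open>Bounds for point modules and line modules\<close>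

definition gen_rel :: "'k::field \<Rightarrow> 'k \<Rightarrow> 'k \<Rightarrow> gen \<Rightarrow> (gen, 'k) free_alg" where
  "gen_rel p q r j = srel p q r (case j of Gx \<Rightarrow> 0 | Gy \<Rightarrow> 1 | Gz \<Rightarrow> 2)"

lemma gen_rel_in: "gen_rel p q r j \<in> rel_ideal (sklyanin p q r)"
  by (simp add: gen_rel_def srel_in_rel_ideal)

text \<open>The quotient of \<open>T\<close> by this space is \<open>A/(hA + kA)\<close> for any two
  forms \<open>h\<close>, \<open>k\<close> that span the forms vanishing at \<open>x\<close>. Naming
  it by the point makes the evaluation of relations at \<open>x\<close> available.\<close>

definition point_space :: "'k::field \<Rightarrow> 'k \<Rightarrow> 'k \<Rightarrow> 'k vec3 \<Rightarrow> (gen, 'k) free_alg set" where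
  "point_space p q r x = fa.span ({lform v * g | v g. dot3 v x = 0} \<union> rel_ideal (sklyanin p q r))"

lemma point_space_form: "dot3 v x = 0 \<Longrightarrow> lform v * g \<in> point_space p q r x"
  unfolding point_space_def by (intro fa.span_base) auto

lemma point_space_ideal: "f \<in> rel_ideal (sklyanin p q r) \<Longrightarrow> f \<in> point_space p q r x"
  unfolding point_space_def by (intro fa.span_base) auto

lemmas point_space_closed =
  fa.span_add[of _ "{lform v * g | v g. dot3 v x = 0} \<union> rel_ideal (sklyanin p q r)" for p q r x, folded point_space_def]
  fa.span_diff[of _ "{lform v * g | v g. dot3 v x = 0} \<union> rel_ideal (sklyanin p q r)" for p q r x, folded point_space_def]
  fa.span_scale[of _ "{lform v * g | v g. dot3 v x = 0} \<union> rel_ideal (sklyanin p q r)" for p q r x, folded point_space_def]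

lemma point_space_0: "0 \<in> point_space p q r x"
  unfolding point_space_def by (rule fa.span_zero)

text \<open>This is the letter \<open>a\<close> minus \<open>x a\<close> times \<open>l\<close>,
  which vanishes at \<open>x\<close> if \<open>l\<close> has value 1 there. So modulo forms
  vanishing at \<open>x\<close> every letter is a multiple of \<open>l\<close>.\<close>

definition drop_point :: "'k::field vec3 \<Rightarrow> 'k vec3 \<Rightarrow> gen \<Rightarrow> 'k vec3" where
  "drop_point l x a = (\<lambda>b. (if a = b then 1 else 0) - x a * l b)"

lemma dot3_drop_point: "dot3 l x = 1 \<Longrightarrow> dot3 (drop_point l x a) x = 0"
proof -
  assume l: "dot3 l x = 1"
  have "dot3 (drop_point l x a) x = x a - x a * dot3 l x"
    by (cases a) (simp_all add: dot3_def drop_point_def algebra_simps)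
  then show ?thesis using l by simp
qed

lemma var_drop_point: "var a = lform (drop_point l x a) + cst (x a) * lform l"
  by (cases a) (simp_all add: lform_def drop_point_def cst_cst_mult algebra_simps single_diff single_uminus)

text \<open>Replacing the first factors of a relation by their multiples of \<open>l\<close> leaves
  \<open>l\<close> times a form, namely the row at \<open>x\<close>.\<close>

lemma lform_row3:
  assumes l: "dot3 l x = 1"
  shows "lform l * (lform (row3 p q r x j) * g) \<in> point_space p q r x"
proof -
  define S where "S a = (case (a, j) of (Gx, Gx) \<Rightarrow> cst r * vx | (Gx, Gy) \<Rightarrow> cst q * vz | (Gx, Gz) \<Rightarrow> cst p * vy
    | (Gy, Gx) \<Rightarrow> cst p * vz | (Gy, Gy) \<Rightarrow> cst r * vy | (Gy, Gz) \<Rightarrow> cst q * vx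
    | (Gz, Gx) \<Rightarrow> cst q * vy | (Gz, Gy) \<Rightarrow> cst p * vx | (Gz, Gz) \<Rightarrow> cst r * vz)" for a
  have row: "lform (row3 p q r x j) = cst (x Gx) * S Gx + cst (x Gy) * S Gy + cst (x Gz) * S Gz"
    by (cases j) (simp_all add: S_def row3_simps lform_def cst_cst_mult algebra_simps)
  have rel: "gen_rel p q r j = vx * S Gx + vy * S Gy + vz * S Gz"
    by (cases j) (simp_all add: S_def gen_rel_def srel_def var_cst_left_commute algebra_simps)
  have eq: "lform l * (lform (row3 p q r x j) * g) = gen_rel p q r j * g -
    (lform (drop_point l x Gx) * (S Gx * g) + lform (drop_point l x Gy) * (S Gy * g) +
     lform (drop_point l x Gz) * (S Gz * g))"
  proof -
    have "var a * S a = lform (drop_point l x a) * S a + cst (x a) * (lform l * S a)" for a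
      by (subst var_drop_point[of a l x]) (simp add: distrib_right mult.assoc)
    then have "gen_rel p q r j = (lform (drop_point l x Gx) * S Gx + lform (drop_point l x Gy) * S Gy +
     lform (drop_point l x Gz) * S Gz) + lform l * lform (row3 p q r x j)"
      unfolding rel row by (simp add: distrib_left cst_left_commute algebra_simps)
    then show ?thesis by (simp add: algebra_simps)
  qed
  show ?thesis unfolding eq
    by (intro point_space_closed point_space_form dot3_drop_point[OF l] point_space_ideal
        rel_ideal_mult_right gen_rel_in)
qed

lemma lform_linear: "lform (\<lambda>a. s * u a + t * v a) = cst s * lform u + cst t * lform v"
  by (simp add: lform_def single_add cst_cst_mult algebra_simps)

text \<open>Modulo forms vanishing at \<open>x\<close>, an element of degree \<open>n + 1\<close> is
  \<open>l g\<close> with \<open>g\<close> of degree \<open>n\<close>, and \<open>l\<close> carries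
  the \<open>point_space\<close> of the next point \<open>y\<close> into that of \<open>x\<close>.
  So a generator at \<open>y\<close> yields one at \<open>x\<close>. The point moves in every step,
  hence the induction is over all points.\<close>

lemma point_module:
  fixes p q r :: "'k::field"
  assumes nd: "nondegenerate p q r" and "x \<noteq> (\<lambda>_. 0)"
  shows "\<exists>s. \<forall>f\<in>homogeneous n. \<exists>c. f - cst c * s \<in> point_space p q r x"
  using assms(2)
proof (induction n arbitrary: x)
  case 0
  show ?case
  proof (rule exI[of _ 1], rule ballI)
    fix f :: "(gen, 'k) free_alg" assume "f \<in> homogeneous 0"
    then have "f = cst (Poly_Mapping.lookup f [])" by (rule homogeneous_0_cst)
    then have "f - cst (Poly_Mapping.lookup f []) * 1 = 0" by simp
    then show "\<exists>c. f - cst c * 1 \<in> point_space p q r x" using point_space_0 by metis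
  qed
next
  case (Suc n)
  obtain y where y: "y \<noteq> (\<lambda>_. 0)"
    "\<And>w. dot3 w y = 0 \<Longrightarrow> \<exists>i j s t. w = (\<lambda>a. s * row3 p q r x i a + t * row3 p q r x j a)"
    using row3_annihilator[OF nd Suc.prems] by blast
  obtain l where l: "dot3 l x = 1" using exists_dot3_one[OF Suc.prems] .
  obtain s where s: "\<And>f. f \<in> homogeneous n \<Longrightarrow> \<exists>c. f - cst c * s \<in> point_space p q r y"
    using Suc.IH[OF y(1)] by blast
  have push: "lform l * f \<in> point_space p q r x" if "f \<in> point_space p q r y" for f
    using that unfolding point_space_def[of p q r y]
  proof (induction rule: fa.span_induct_alt)
    case base
    show ?case by (simp add: point_space_0)
  next
    case (step c f g)
    have "lform l * f \<in> point_space p q r x"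
    proof (cases "f \<in> rel_ideal (sklyanin p q r)")
      case True
      then show ?thesis by (intro point_space_ideal rel_ideal_mult_left)
    next
      case False
      then obtain w g' where w: "f = lform w * g'" "dot3 w y = 0" using step(1) by auto
      then obtain i j s t where "w = (\<lambda>a. s * row3 p q r x i a + t * row3 p q r x j a)" using y(2) by blast
      then have "f = cst s * (lform (row3 p q r x i) * g') + cst t * (lform (row3 p q r x j) * g')"
        unfolding w(1) by (simp only: lform_linear distrib_right mult.assoc)
      then have "lform l * f = cst s * (lform l * (lform (row3 p q r x i) * g')) +
          cst t * (lform l * (lform (row3 p q r x j) * g'))"
        by (simp only: distrib_left cst_left_commute)
      then show ?thesis using lform_row3[OF l] by (simp only: point_space_closed)
    qed
    then show ?case using step(2) by (simp only: distrib_left cst_left_commute point_space_closed)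
  qed
  show ?case
  proof (rule exI[of _ "lform l * s"], rule ballI)
    fix f :: "(gen, 'k) free_alg" assume f: "f \<in> homogeneous (Suc n)"
    define g where "g = cst (x Gx) * left_quot Gx f + cst (x Gy) * left_quot Gy f + cst (x Gz) * left_quot Gz f"
    have "g \<in> homogeneous n"
      unfolding g_def by (intro homogeneous_add homogeneous_cst_mult homogeneous_Suc_expand(2)[OF f])
    then obtain c where c: "g - cst c * s \<in> point_space p q r y" using s by blast
    have "var a * left_quot a f = lform (drop_point l x a) * left_quot a f + lform l * (cst (x a) * left_quot a f)" for a
      by (subst var_drop_point[of a l x]) (simp only: distrib_right mult.assoc cst_left_commute)
    then have "f = (lform (drop_point l x Gx) * left_quot Gx f + lform (drop_point l x Gy) * left_quot Gy f +
        lform (drop_point l x Gz) * left_quot Gz f) + lform l * g"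
      using homogeneous_Suc_expand(1)[OF f] unfolding g_def sum_gen by (simp add: distrib_left algebra_simps)
    then have "f - cst c * (lform l * s) = (lform (drop_point l x Gx) * left_quot Gx f +
        lform (drop_point l x Gy) * left_quot Gy f + lform (drop_point l x Gz) * left_quot Gz f) + lform l * (g - cst c * s)"
      by (simp add: right_diff_distrib cst_left_commute)
    also have "\<dots> \<in> point_space p q r x"
      by (intro point_space_closed point_space_form dot3_drop_point[OF l] push c)
    finally show "\<exists>c. f - cst c * (lform l * s) \<in> point_space p q r x" by blast
  qed
qed

lemma lform_cst_left_commute: "lform v * (cst c * g) = cst c * (lform v * g)"
  by (rule cst_left_commute)

lemma point_space_two_forms:
  assumes h: "cross3 h k = x" and x: "x \<noteq> (\<lambda>_. 0)" and f: "f \<in> point_space p q r x"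
  shows "\<exists>g1 g2 i. i \<in> rel_ideal (sklyanin p q r) \<and> f = lform h * g1 + lform k * g2 + i"
  using f unfolding point_space_def
proof (induction rule: fa.span_induct_alt)
  case base
  show ?case by (intro exI[of _ 0] conjI) simp_all
next
  case (step c u g)
  let ?I = "rel_ideal (sklyanin p q r)"
  obtain g1 g2 i where g: "i \<in> ?I" "g = lform h * g1 + lform k * g2 + i" using step(2) by blast
  show ?case
  proof (cases "u \<in> ?I")
    case True
    have "cst c * u + g = lform h * g1 + lform k * g2 + (cst c * u + i)" by (simp add: g)
    moreover have "cst c * u + i \<in> ?I" using True g(1) by blast
    ultimately show ?thesis by blast
  next
    case False
    then obtain v g' where v: "u = lform v * g'" "dot3 v x = 0" using step(1) by auto
    then obtain s t where "\<forall>a. v a = s * h a + t * k a" using span_if_cross3[of h k v] h x by auto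
    then have "v = (\<lambda>a. s * h a + t * k a)" by (intro ext) simp
    then have "cst c * u = lform h * (cst (c * s) * g') + lform k * (cst (c * t) * g')"
      unfolding v(1) by (simp add: lform_linear distrib_left distrib_right mult.assoc cst_cst_mult lform_cst_left_commute)
    then have "cst c * u + g = lform h * (cst (c * s) * g' + g1) + lform k * (cst (c * t) * g' + g2) + i"
      by (simp add: g distrib_left algebra_simps)
    then show ?thesis using g(1) by blast
  qed
qed

text \<open>The quotient is described by representatives: \<open>S\<close> spans degree
  \<open>n\<close> modulo \<open>hT + I\<close>. Homogeneity of \<open>S\<close> is not recorded;
  components are taken when dimensions are counted.\<close>

lemma line_module:
  fixes p q r :: "'k::alg_closed_field"
  assumes nd: "nondegenerate p q r" and "h \<noteq> (\<lambda>_. 0)"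
  shows "\<exists>S. finite S \<and> card S \<le> n + 1 \<and>
    (\<forall>f\<in>homogeneous n. \<exists>u\<in>fa.span S. \<exists>g. f - u - lform h * g \<in> rel_ideal (sklyanin p q r))"
  using assms(2)
proof (induction n arbitrary: h)
  case 0
  have "\<exists>u\<in>fa.span {1}. \<exists>g. f - u - lform h * g \<in> rel_ideal (sklyanin p q r)"
    if f: "f \<in> homogeneous 0" for f :: "(gen, 'k) free_alg"
  proof -
    have eq: "f = cst (Poly_Mapping.lookup f []) * 1" using homogeneous_0_cst[OF f] by simp
    have "cst (Poly_Mapping.lookup f []) * 1 \<in> fa.span {1 :: (gen, 'k) free_alg}"
      by (intro fa.span_scale fa.span_base) simp
    then have "f \<in> fa.span {1}" using eq by metis
    then show ?thesis by (intro bexI[of _ f] exI[of _ 0]) simp_all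
  qed
  then show ?case by (intro exI[of _ "{1}"]) simp
next
  case (Suc n)
  let ?I = "rel_ideal (sklyanin p q r)"
  obtain x where x: "x \<noteq> (\<lambda>_. 0)" "dot3 h x = 0" "det3 p q r x = 0"
    using point_on_line[OF Suc.prems] by blast
  obtain k where k: "cross3 h k = x" using cross3_surj[OF Suc.prems x(2)] by blast
  obtain c where c: "c \<noteq> (\<lambda>_. 0)" "\<And>b. dot3 (row3 p q r c b) x = 0"
    using row3_kernel[OF nd x(1,3)] by blast
  have "\<exists>s t. \<forall>a. row3 p q r c b a = s * h a + t * k a" for b
    by (rule span_if_cross3) (use k x(1) c(2) in auto)
  then obtain s t where st: "\<And>b a. row3 p q r c b a = s b * h a + t b * k a" by metis
  \<comment> \<open>Otherwise all rows at \<open>c\<close> would be multiples of \<open>h\<close>,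
    contrary to rank at least 2.\<close>
  have t: "t \<noteq> (\<lambda>_. 0)"
  proof
    assume "t = (\<lambda>_. 0)"
    then have row: "row3 p q r c b = (\<lambda>a. s b * h a)" for b using st by auto
    have "cross3 (\<lambda>a. s b * h a) (\<lambda>a. s b' * h a) = (\<lambda>_. 0)" for b b'
      by (simp add: vec3_eq_iff cross3_simps)
    then show False using rank_row3[OF nd c(1)] unfolding row by blast
  qed
  \<comment> \<open>The combination of relations with coefficients \<open>c\<close> is the sum of
    its columns times the letters. Each column is a combination of \<open>h\<close> and
    \<open>k\<close>; collecting these as left factors gives \<open>h s + k t\<close>.\<close>
  have rel: "lform h * lform s + lform k * lform t =
    cst (c Gx) * gen_rel p q r Gx + cst (c Gy) * gen_rel p q r Gy + cst (c Gz) * gen_rel p q r Gz"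
  proof -
    have "lform h * lform s + lform k * lform t =
      lform (row3 p q r c Gx) * vx + lform (row3 p q r c Gy) * vy + lform (row3 p q r c Gz) * vz"
    proof -
      have row: "row3 p q r c b = (\<lambda>a. s b * h a + t b * k a)" for b using st by auto
      show ?thesis unfolding row lform_linear lform_def[of s] lform_def[of t]
        by (simp add: distrib_left distrib_right lform_cst_left_commute mult.assoc add_ac)
    qed
    also have "\<dots> = cst (c Gx) * gen_rel p q r Gx + cst (c Gy) * gen_rel p q r Gy + cst (c Gz) * gen_rel p q r Gz"
      by (simp add: row3_simps lform_def gen_rel_def srel_def distrib_left distrib_right cst_cst_mult mult.assoc
          mult.commute add_ac)
    finally show ?thesis .
  qed
  then have relI: "lform h * lform s + lform k * lform t \<in> ?I"
    unfolding rel by (intro rel_ideal_add rel_ideal_mult_left gen_rel_in)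
  obtain s0 where s0: "\<And>f. f \<in> homogeneous (Suc n) \<Longrightarrow> \<exists>c. f - cst c * s0 \<in> point_space p q r x"
    using point_module[OF nd x(1), of "Suc n"] by blast
  obtain S where S: "finite S" "card S \<le> n + 1"
    "\<And>f. f \<in> homogeneous n \<Longrightarrow> \<exists>u\<in>fa.span S. \<exists>g. f - u - lform t * g \<in> ?I"
    using Suc.IH[OF t] by blast
  \<comment> \<open>One generator accounts for \<open>A/(hA + kA)\<close>. The rest is
    \<open>k\<close> times \<open>A\<close>, where \<open>k t\<close> equals \<open>- h s\<close>
    modulo \<open>I\<close>, so generators of \<open>A/tA\<close> multiplied by \<open>k\<close>
    suffice.\<close>
  define S' where "S' = insert (hcomp (Suc n) s0) ((*) (lform k) ` S)"
  have kS: "lform k * u \<in> fa.span S'" if "u \<in> fa.span S" for u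
    using that
  proof (induction rule: fa.span_induct_alt)
    case (step d u g)
    then show ?case unfolding distrib_left lform_cst_left_commute
      by (intro fa.span_add fa.span_scale) (auto simp: S'_def intro: fa.span_base)
  qed (simp add: fa.span_zero)
  show ?case
  proof (intro exI[of _ S'] conjI ballI)
    show "finite S'" using S(1) by (simp add: S'_def)
    have "card S' \<le> Suc (card ((*) (lform k) ` S))" unfolding S'_def by (rule card_insert_le_m1) simp_all
    also have "\<dots> \<le> Suc (card S)" using card_image_le[OF S(1)] by simp
    finally show "card S' \<le> Suc n + 1" using S(2) by simp
    fix f :: "(gen, 'k) free_alg" assume f: "f \<in> homogeneous (Suc n)"
    obtain d where "f - cst d * s0 \<in> point_space p q r x" using s0[OF f] by blast
    then obtain g1 g2 i where i: "i \<in> ?I" "f - cst d * s0 = lform h * g1 + lform k * g2 + i"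
      using point_space_two_forms[OF k x(1)] by blast
    have "hcomp (Suc n) (f - cst d * s0) = lform h * hcomp n g1 + lform k * hcomp n g2 + hcomp (Suc n) i"
      unfolding i(2) by (simp add: hcomp_Suc_lform_mult)
    then have f_eq: "f - cst d * hcomp (Suc n) s0 = lform h * hcomp n g1 + lform k * hcomp n g2 + hcomp (Suc n) i"
      using f by (simp add: homogeneous_iff_hcomp)
    obtain u g3 where u: "u \<in> fa.span S" "hcomp n g2 - u - lform t * g3 \<in> ?I"
      using S(3)[OF hcomp_in_homogeneous] by blast
    let ?v = "cst d * hcomp (Suc n) s0 + lform k * u"
    let ?g = "hcomp n g1 - lform s * g3"
    have "f - ?v - lform h * ?g = lform k * (hcomp n g2 - u - lform t * g3) +
        (lform h * lform s + lform k * lform t) * g3 + hcomp (Suc n) i"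
      using f_eq by (simp add: algebra_simps)
    also have "\<dots> \<in> ?I"
      by (intro rel_ideal_add rel_ideal_mult_left[OF u(2)] rel_ideal_mult_right[OF relI]
          hcomp_rel_ideal[OF sklyanin_quadratic i(1)])
    finally have "f - ?v - lform h * ?g \<in> ?I" .
    moreover have "?v \<in> fa.span S'"
      by (intro fa.span_add fa.span_scale kS u(1)) (auto simp: S'_def intro: fa.span_base)
    ultimately show "\<exists>u\<in>fa.span S'. \<exists>g. f - u - lform h * g \<in> ?I" by blast
  qed
qed

section \<open>Counting dimensions\<close>

lemma dim_le_card_add:
  fixes U W :: "('x::finite, 'k::field) free_alg set"
  assumes "finite S" "W \<subseteq> homogeneous n" "\<And>f. f \<in> U \<Longrightarrow> \<exists>u\<in>fa.span S. f - u \<in> W"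
  shows "fa.dim U \<le> card S + fa.dim W"
proof -
  obtain B where B: "B \<subseteq> W" "fa.independent B" "W \<subseteq> fa.span B" "card B = fa.dim W"
    by (rule fa.basis_exists)
  have finB: "finite B"
    using fa.independent_span_bound[OF finite_word_words B(2)] B(1) assms(2) span_words by blast
  have "U \<subseteq> fa.span (S \<union> B)"
  proof
    fix f assume "f \<in> U"
    then obtain u where u: "u \<in> fa.span S" "f - u \<in> W" using assms(3) by blast
    have "u \<in> fa.span (S \<union> B)" using u(1) fa.span_mono[of S "S \<union> B"] by blast
    moreover have "f - u \<in> fa.span (S \<union> B)" using u(2) B(3) fa.span_mono[of B "S \<union> B"] by blast
    ultimately have "u + (f - u) \<in> fa.span (S \<union> B)" by (rule fa.span_add)
    then show "f \<in> fa.span (S \<union> B)" by simp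
  qed
  then have "fa.dim U \<le> card (S \<union> B)" using assms(1) finB by (intro fa.dim_le_card) auto
  also have "\<dots> \<le> card S + card B" by (rule card_Un_le)
  finally show ?thesis using B(4) by simp
qed

lemma linear_mult_left: "Vector_Spaces.linear (\<lambda>c f. cst c * f) (\<lambda>c f. cst c * f) ((*) (e :: ('x, 'k::field) free_alg))"
  by unfold_locales (simp_all add: distrib_left cst_left_commute[of e])

lemma subspace_mult_left:
  assumes "fa.subspace U"
  shows "fa.subspace ((*) (e :: ('x, 'k::field) free_alg) ` U)"
proof -
  interpret l: Vector_Spaces.linear "\<lambda>c f. cst c * f" "\<lambda>c f. cst c * f" "(*) e"
    by (rule linear_mult_left)
  show ?thesis by (rule l.subspace_image[OF assms])
qed

lemma mult_left_homogeneous: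
  "e \<in> homogeneous d \<Longrightarrow> U \<subseteq> homogeneous n \<Longrightarrow> (*) e ` U \<subseteq> homogeneous (d + n)"
  by (auto intro: homogeneous_mult)

lemma dim_mult_left:
  fixes U :: "('x::finite, 'k::field) free_alg set"
  assumes "\<And>f. e * f = 0 \<Longrightarrow> f = 0" "fa.subspace U" "U \<subseteq> homogeneous n"
  shows "fa.dim ((*) e ` U) = fa.dim U"
proof (rule fa.dim_inj_image[OF linear_mult_left _ assms(2) homogeneous_subset_span[OF assms(3)] finite_word_words])
  show "inj ((*) e)"
  proof (rule injI)
    fix f g assume "e * f = e * g"
    then have "e * (f - g) = 0" by (simp add: right_diff_distrib)
    then show "f = g" using assms(1) by fastforce
  qed
qed

text \<open>For right-independent \<open>e\<close> this is a copy of the triples over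
  \<open>U\<close> inside \<open>T\<close>, so that sums and intersections of modules of triples
  become those of subspaces of \<open>T\<close>.\<close>

definition sum3 :: "(nat \<Rightarrow> ('x, 'k::field) free_alg) \<Rightarrow> ('x, 'k) free_alg set \<Rightarrow> ('x, 'k) free_alg set" where
  "sum3 e U = {e 0 * f + e 1 * g + e 2 * h | f g h. f \<in> U \<and> g \<in> U \<and> h \<in> U}"

lemma sum3_eq: "sum3 e U = {x + y | x y. x \<in> {x + y | x y. x \<in> (*) (e 0) ` U \<and> y \<in> (*) (e 1) ` U} \<and> y \<in> (*) (e 2) ` U}"
  unfolding sum3_def by blast

lemma subspace_sum3: "fa.subspace U \<Longrightarrow> fa.subspace (sum3 e U)"
  unfolding sum3_eq by (intro fa.subspace_sums subspace_mult_left)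

lemma sum3_homogeneous:
  "(\<And>j. e j \<in> homogeneous d) \<Longrightarrow> U \<subseteq> homogeneous n \<Longrightarrow> sum3 e U \<subseteq> homogeneous (d + n)"
  unfolding sum3_def by (auto intro!: homogeneous_add homogeneous_mult)

lemma dim_sum3:
  fixes U :: "('x::finite, 'k::field) free_alg set"
  assumes e: "\<And>j. e j \<in> homogeneous d"
    and inj: "\<And>f g h. e 0 * f + e 1 * g + e 2 * h = 0 \<Longrightarrow> f = 0 \<and> g = 0 \<and> h = (0 :: ('x, 'k) free_alg)"
    and U: "fa.subspace U" "U \<subseteq> homogeneous n"
  shows "fa.dim (sum3 e U) = 3 * fa.dim U"
proof -
  note sub = subspace_mult_left[OF U(1)]
  note hom = mult_left_homogeneous[OF e U(2)]
  let ?A = "\<lambda>j. (*) (e j) ` U"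
  let ?B = "{x + y | x y. x \<in> ?A 0 \<and> y \<in> ?A 1}"
  have dims: "fa.dim (?A 0) = fa.dim U" "fa.dim (?A 1) = fa.dim U" "fa.dim (?A 2) = fa.dim U"
  proof -
    have "f = 0" if "e 0 * f = 0" for f using inj[of f 0 0] that by simp
    then show "fa.dim (?A 0) = fa.dim U" by (rule dim_mult_left[OF _ U])
    have "f = 0" if "e 1 * f = 0" for f using inj[of 0 f 0] that by simp
    then show "fa.dim (?A 1) = fa.dim U" by (rule dim_mult_left[OF _ U])
    have "f = 0" if "e 2 * f = 0" for f using inj[of 0 0 f] that by simp
    then show "fa.dim (?A 2) = fa.dim U" by (rule dim_mult_left[OF _ U])
  qed
  have homB: "?B \<subseteq> homogeneous (d + n)" using hom by (auto intro!: homogeneous_add)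
  have "fa.dim ?B = fa.dim (?A 0) + fa.dim (?A 1)"
  proof (rule fa.dim_direct_sum[OF sub sub homogeneous_subset_span[OF hom] homogeneous_subset_span[OF hom] finite_word_words])
    show "?A 0 \<inter> ?A 1 \<subseteq> {0}"
    proof
      fix z assume "z \<in> ?A 0 \<inter> ?A 1"
      then obtain f g where fg: "z = e 0 * f" "z = e 1 * g" by blast
      have "e 0 * f + e 1 * (- g) + e 2 * 0 = 0" using fg by simp
      then have "f = 0" using inj by blast
      then show "z \<in> {0}" using fg(1) by simp
    qed
  qed
  moreover have "fa.dim (sum3 e U) = fa.dim ?B + fa.dim (?A 2)"
    unfolding sum3_eq
  proof (rule fa.dim_direct_sum[OF fa.subspace_sums[OF sub sub] sub homogeneous_subset_span[OF homB]
        homogeneous_subset_span[OF hom] finite_word_words])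
    show "?B \<inter> ?A 2 \<subseteq> {0}"
    proof
      fix z assume "z \<in> ?B \<inter> ?A 2"
      then obtain f g h where fgh: "z = e 0 * f + e 1 * g" "z = e 2 * h" by blast
      have "e 0 * f + e 1 * g + e 2 * (- h) = 0" using fgh by simp
      then have "f = 0 \<and> g = 0 \<and> - h = 0" by (rule inj)
      then show "z \<in> {0}" using fgh(1) by simp
    qed
  qed
  ultimately show ?thesis using dims by simp
qed

text \<open>Each word of length 2 is assigned to exactly one relation, with coefficient
  \<open>p\<close>, \<open>q\<close> or \<open>r\<close>. Dividing by its two letters isolates that
  coefficient times \<open>f\<close>, \<open>g\<close> or \<open>h\<close>.\<close>

lemma srel_inj:
  assumes nz: "p \<noteq> 0 \<or> q \<noteq> 0 \<or> (r :: 'k::field) \<noteq> 0"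
    and eq: "srel p q r 0 * f + srel p q r 1 * g + srel p q r 2 * h = 0"
  shows "f = 0 \<and> g = 0 \<and> h = 0"
proof -
  have "left_quot b (left_quot a (srel p q r 0 * f + srel p q r 1 * g + srel p q r 2 * h)) = 0" for a b
    unfolding eq by simp
  then have *: "left_quot b (left_quot a (srel p q r 0 * f)) + left_quot b (left_quot a (srel p q r 1 * g)) +
    left_quot b (left_quot a (srel p q r 2 * h)) = 0" for a b by simp
  have "cst r * f = 0" "cst r * g = 0" "cst r * h = 0"
    using *[of Gx Gx] *[of Gy Gy] *[of Gz Gz] by (simp_all add: srel_def distrib_right mult.assoc)
  moreover have "cst p * f = 0" "cst p * g = 0" "cst p * h = 0"
    using *[of Gz Gy] *[of Gx Gz] *[of Gy Gx] by (simp_all add: srel_def distrib_right mult.assoc)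
  moreover have "cst q * f = 0" "cst q * g = 0" "cst q * h = 0"
    using *[of Gy Gz] *[of Gz Gx] *[of Gx Gy] by (simp_all add: srel_def distrib_right mult.assoc)
  ultimately show ?thesis using nz by (auto simp: fa.scale_eq_0_iff)
qed

lemma vars_inj:
  assumes "var (gen_nth 0) * f + var (gen_nth 1) * g + var (gen_nth 2) * h = 0"
  shows "f = 0 \<and> g = 0 \<and> h = (0 :: (gen, 'k::field) free_alg)"
  using arg_cong[OF assms, of "left_quot Gx"] arg_cong[OF assms, of "left_quot Gy"]
    arg_cong[OF assms, of "left_quot Gz"] by simp

section \<open>The Koszul complex inside the free algebra\<close>

definition cubic_tensor :: "'k::field \<Rightarrow> 'k \<Rightarrow> 'k \<Rightarrow> (gen, 'k) free_alg" where
  "cubic_tensor p q r = srel p q r 0 * vx + srel p q r 1 * vy + srel p q r 2 * vz"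

text \<open>The words with coefficient \<open>p\<close> form the cyclic orbit of \<open>xyz\<close>,
  those with \<open>q\<close> the orbit of \<open>xzy\<close>, and the cubes with \<open>r\<close>
  are fixed by rotation.\<close>

lemma cubic_tensor_cyclic: "cubic_tensor p q r = vx * srel p q r 0 + vy * srel p q r 1 + vz * srel p q r 2"
  by (simp add: cubic_tensor_def srel_def free_alg_simps add_ac)

lemma cubic_tensor_homogeneous: "cubic_tensor p q r \<in> homogeneous 3"
proof -
  have "srel p q r j * var a \<in> homogeneous (2 + 1)" for j a
    by (intro homogeneous_mult srel_homogeneous homogeneous_var)
  then show ?thesis unfolding cubic_tensor_def by (intro homogeneous_add) simp_all
qed

abbreviation vars3 :: "nat \<Rightarrow> (gen, 'k::field) free_alg" where "vars3 j \<equiv> var (gen_nth j)"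

lemma ideal_comp_sum:
  "ideal_comp (sklyanin p q r) (Suc (Suc n)) =
    {x + y | x y. x \<in> sum3 vars3 (ideal_comp (sklyanin p q r) (Suc n)) \<and> y \<in> sum3 (srel p q r) (homogeneous n)}"
    (is "?L = ?R")
proof (intro equalityI subsetI)
  let ?I = "rel_ideal (sklyanin p q r)"
  fix f assume "f \<in> ?L"
  then have f: "f \<in> ?I" "hcomp (Suc (Suc n)) f = f"
    by (auto simp: ideal_comp_def homogeneous_iff_hcomp)
  obtain g h where g: "\<And>a. g a \<in> ?I"
    and eq: "f = (\<Sum>a\<in>UNIV. var a * g a) + (\<Sum>j<3. srel p q r j * h j)"
    using rel_ideal_decomp[OF f(1)[unfolded sklyanin_srel]] unfolding sklyanin_srel by blast
  have 1: "hcomp (Suc n) (g a) \<in> ideal_comp (sklyanin p q r) (Suc n)" for a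
    using hcomp_rel_ideal[OF sklyanin_quadratic g] by (simp add: ideal_comp_def)
  have 2: "hcomp (Suc (Suc n)) (srel p q r j * h j) = srel p q r j * hcomp n (h j)" for j
    using hcomp_homogeneous_mult(1)[OF srel_homogeneous, of n] by simp
  have "f = (\<Sum>a\<in>UNIV. var a * hcomp (Suc n) (g a)) + (\<Sum>j<3. srel p q r j * hcomp n (h j))"
    using arg_cong[OF eq, of "hcomp (Suc (Suc n))"] by (simp add: f(2) hcomp_sum 2)
  then have "f = (vars3 0 * hcomp (Suc n) (g Gx) + vars3 1 * hcomp (Suc n) (g Gy) + vars3 2 * hcomp (Suc n) (g Gz)) +
     (srel p q r 0 * hcomp n (h 0) + srel p q r 1 * hcomp n (h 1) + srel p q r 2 * hcomp n (h 2))"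
    by (simp add: sum_gen sum_lessThan_3)
  moreover have "vars3 0 * hcomp (Suc n) (g Gx) + vars3 1 * hcomp (Suc n) (g Gy) + vars3 2 * hcomp (Suc n) (g Gz)
      \<in> sum3 vars3 (ideal_comp (sklyanin p q r) (Suc n))"
    unfolding sum3_def using 1 by blast
  moreover have "srel p q r 0 * hcomp n (h 0) + srel p q r 1 * hcomp n (h 1) + srel p q r 2 * hcomp n (h 2)
      \<in> sum3 (srel p q r) (homogeneous n)"
    unfolding sum3_def using hcomp_in_homogeneous by blast
  ultimately show "f \<in> ?R" by blast
next
  let ?I = "rel_ideal (sklyanin p q r)"
  fix f assume "f \<in> ?R"
  then obtain x y where xy: "f = x + y" "x \<in> sum3 vars3 (ideal_comp (sklyanin p q r) (Suc n))"
    "y \<in> sum3 (srel p q r) (homogeneous n)" by blast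
  have "x \<in> ?I" using xy(2) unfolding sum3_def ideal_comp_def
    by (auto intro!: rel_ideal_add rel_ideal_mult_left)
  moreover have "y \<in> ?I" using xy(3) unfolding sum3_def
    by (auto intro!: rel_ideal_add rel_ideal_mult_right srel_in_rel_ideal)
  moreover have "x \<in> homogeneous (1 + Suc n)"
    using sum3_homogeneous[OF homogeneous_var ideal_comp_homogeneous] xy(2) by blast
  moreover have "y \<in> homogeneous (2 + n)"
    using sum3_homogeneous[of "srel p q r", OF srel_homogeneous subset_refl] xy(3) by blast
  ultimately show "f \<in> ?L" by (auto simp: xy(1) ideal_comp_def)
qed

text \<open>
  Cycles and boundaries in the second free module of the Koszul complex. A triple \<open>h\<close> is represented
  by \<open>\<Sum>j<3. srel p q r j * h j\<close>, which makes everything a subspace of the free algebra.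
\<close>

definition koszul_cycles :: "'k::field \<Rightarrow> 'k \<Rightarrow> 'k \<Rightarrow> nat \<Rightarrow> (gen, 'k) free_alg set" where
  "koszul_cycles p q r n =
    sum3 vars3 (ideal_comp (sklyanin p q r) (Suc (Suc n))) \<inter> sum3 (srel p q r) (homogeneous (Suc n))"

definition koszul_boundaries :: "'k::field \<Rightarrow> 'k \<Rightarrow> 'k \<Rightarrow> nat \<Rightarrow> (gen, 'k) free_alg set" where
  "koszul_boundaries p q r n =
    {x + y | x y. x \<in> sum3 (srel p q r) (ideal_comp (sklyanin p q r) (Suc n)) \<and>
      y \<in> (*) (cubic_tensor p q r) ` homogeneous n}"

lemma koszul_cycles_subspace: "fa.subspace (koszul_cycles p q r n)"
  unfolding koszul_cycles_def
  by (intro fa.subspace_inter subspace_sum3 ideal_comp_subspace homogeneous_subspace)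

lemma koszul_boundaries_subspace: "fa.subspace (koszul_boundaries p q r n)"
  unfolding koszul_boundaries_def
  by (intro fa.subspace_sums subspace_sum3 subspace_mult_left ideal_comp_subspace homogeneous_subspace)

lemma koszul_cycles_homogeneous: "koszul_cycles p q r n \<subseteq> homogeneous (n + 3)"
  using sum3_homogeneous[of "srel p q r", OF srel_homogeneous subset_refl, of "Suc n"]
  by (auto simp: koszul_cycles_def add.commute numeral_3_eq_3)

text \<open>Degree \<open>n + 3\<close> of the ideal is \<open>V I + R T\<close>, and the cycles are
  the intersection of the two parts: the sum of the \<open>r_j h_j\<close> is also the sum of the
  letters times the entries of \<open>smat\<close> applied to \<open>h\<close>, so it lies in
  \<open>V I\<close> exactly when these entries lie in \<open>I\<close>.\<close>

lemma dim_koszul_cycles: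
  fixes p q r :: "'k::field"
  assumes nz: "p \<noteq> 0 \<or> q \<noteq> 0 \<or> r \<noteq> 0"
  shows "fa.dim (ideal_comp (sklyanin p q r) (n + 3)) + fa.dim (koszul_cycles p q r n) =
    3 * fa.dim (ideal_comp (sklyanin p q r) (n + 2)) + 3 ^ (n + 2)"
proof -
  let ?I = "ideal_comp (sklyanin p q r)"
  let ?V = "sum3 vars3 (?I (Suc (Suc n)))" and ?S = "sum3 (srel p q r) (homogeneous (Suc n))"
  have hV: "?V \<subseteq> homogeneous (n + 3)"
    using sum3_homogeneous[OF homogeneous_var ideal_comp_homogeneous, of gen_nth "sklyanin p q r" "Suc (Suc n)"]
    by (simp add: add.commute numeral_3_eq_3)
  have hS: "?S \<subseteq> homogeneous (n + 3)"
    using sum3_homogeneous[of "srel p q r", OF srel_homogeneous subset_refl, of "Suc n"]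
    by (simp add: add.commute numeral_3_eq_3)
  have "?I (n + 3) = {x + y | x y. x \<in> ?V \<and> y \<in> ?S}"
    using ideal_comp_sum[of p q r "Suc n"] by (simp add: numeral_3_eq_3)
  then have "fa.dim (?I (n + 3)) + fa.dim (koszul_cycles p q r n) = fa.dim ?V + fa.dim ?S"
    unfolding koszul_cycles_def
    using fa.dim_sum_Int_fin[OF subspace_sum3[OF ideal_comp_subspace] subspace_sum3[OF homogeneous_subspace]
        homogeneous_subset_span[OF hV] homogeneous_subset_span[OF hS] finite_word_words] by simp
  also have "fa.dim ?V = 3 * fa.dim (?I (Suc (Suc n)))"
    by (rule dim_sum3[OF homogeneous_var vars_inj ideal_comp_subspace ideal_comp_homogeneous])
  also have "fa.dim ?S = 3 * fa.dim (homogeneous (Suc n) :: (gen, 'k) free_alg set)"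
    by (rule dim_sum3[OF srel_homogeneous srel_inj[OF nz] homogeneous_subspace subset_refl])
  finally show ?thesis by (simp add: dim_homogeneous card_gen)
qed

text \<open>Written with relations on the left, \<open>cubic_tensor\<close> times \<open>y\<close>
  is in \<open>R T\<close>; written with letters on the left, it is in \<open>V I\<close>. Both
  forms of the tensor are used.\<close>

lemma koszul_boundaries_subset: "koszul_boundaries p q r n \<subseteq> koszul_cycles p q r n"
proof
  let ?I = "ideal_comp (sklyanin p q r)" and ?J = "rel_ideal (sklyanin p q r)"
  fix f assume "f \<in> koszul_boundaries p q r n"
  then obtain x y where xy: "f = x + cubic_tensor p q r * y" "x \<in> sum3 (srel p q r) (?I (Suc n))" "y \<in> homogeneous n"
    unfolding koszul_boundaries_def by blast
  obtain g0 g1 g2 where g: "x = srel p q r 0 * g0 + srel p q r 1 * g1 + srel p q r 2 * g2"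
    "g0 \<in> ?I (Suc n)" "g1 \<in> ?I (Suc n)" "g2 \<in> ?I (Suc n)"
    using xy(2) unfolding sum3_def by blast
  have "f = srel p q r 0 * (g0 + vx * y) + srel p q r 1 * (g1 + vy * y) + srel p q r 2 * (g2 + vz * y)"
    unfolding xy(1) g(1) cubic_tensor_def by (simp add: algebra_simps)
  moreover have "g0 + vx * y \<in> homogeneous (Suc n)" "g1 + vy * y \<in> homogeneous (Suc n)" "g2 + vz * y \<in> homogeneous (Suc n)"
    using g xy(3) by (auto simp: ideal_comp_def)
  ultimately have 1: "f \<in> sum3 (srel p q r) (homogeneous (Suc n))" unfolding sum3_def by blast
  let ?m = "\<lambda>i. smat p q r i 0 * g0 + smat p q r i 1 * g1 + smat p q r i 2 * g2 + srel p q r i * y"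
  have "srel p q r j = vx * smat p q r 0 j + vy * smat p q r 1 j + vz * smat p q r 2 j" if "j < 3" for j
    using srel_smat[OF that, of p q r] by (simp add: sum_lessThan_3)
  from this[of 0] this[of 1] this[of 2]
  have "f = vars3 0 * ?m 0 + vars3 1 * ?m 1 + vars3 2 * ?m 2"
    unfolding xy(1) g(1) cubic_tensor_cyclic by (simp add: algebra_simps)
  moreover have "?m i \<in> ?I (Suc (Suc n))" for i
  proof -
    have "smat p q r i j * g \<in> homogeneous (1 + Suc n)" if "g \<in> ?I (Suc n)" for j g
      using that by (intro homogeneous_mult smat_homogeneous) (auto simp: ideal_comp_def)
    moreover have "srel p q r i * y \<in> homogeneous (2 + n)"
      by (intro homogeneous_mult srel_homogeneous xy(3))
    ultimately have "?m i \<in> homogeneous (Suc (Suc n))"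
      using g(2-4) by (intro homogeneous_add) simp_all
    moreover have "?m i \<in> ?J"
      using g by (intro rel_ideal_add rel_ideal_mult_left rel_ideal_mult_right srel_in_rel_ideal) (auto simp: ideal_comp_def)
    ultimately show ?thesis by (simp add: ideal_comp_def)
  qed
  ultimately have "f \<in> sum3 vars3 (?I (Suc (Suc n)))" unfolding sum3_def by blast
  then show "f \<in> koszul_cycles p q r n" using 1 by (simp add: koszul_cycles_def)
qed

text \<open>This is injectivity, in degree \<open>n\<close>, of the last map of the complex, which
  sends \<open>f\<close> to the triple of its products with the letters.\<close>

definition zero_socle :: "'k::field \<Rightarrow> 'k \<Rightarrow> 'k \<Rightarrow> nat \<Rightarrow> bool" where
  "zero_socle p q r n \<longleftrightarrow> (\<forall>f\<in>homogeneous n. (\<forall>a. var a * f \<in> rel_ideal (sklyanin p q r)) \<longrightarrow>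
    f \<in> rel_ideal (sklyanin p q r))"

lemma dim_koszul_boundaries:
  fixes p q r :: "'k::field"
  assumes nz: "p \<noteq> 0 \<or> q \<noteq> 0 \<or> r \<noteq> 0" and socle: "zero_socle p q r n"
  shows "3 * fa.dim (ideal_comp (sklyanin p q r) (n + 1)) + 3 ^ n \<le>
    fa.dim (koszul_boundaries p q r n) + fa.dim (ideal_comp (sklyanin p q r) n)"
proof -
  let ?I = "ideal_comp (sklyanin p q r)"
  let ?S = "sum3 (srel p q r) (?I (Suc n))" and ?w = "cubic_tensor p q r"
  let ?W = "(*) ?w ` homogeneous n"
  have hS: "?S \<subseteq> homogeneous (n + 3)"
    using sum3_homogeneous[of "srel p q r", OF srel_homogeneous ideal_comp_homogeneous, of "sklyanin p q r" "Suc n"]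
    by (simp add: add.commute numeral_3_eq_3)
  have hW: "?W \<subseteq> homogeneous (n + 3)"
    using mult_left_homogeneous[OF cubic_tensor_homogeneous subset_refl, of p q r n] by (simp add: add.commute)
  have w_rel: "?w * f = srel p q r 0 * (vx * f) + srel p q r 1 * (vy * f) + srel p q r 2 * (vz * f)" for f
    by (simp add: cubic_tensor_def distrib_right mult.assoc)
  have w_inj: "f = 0" if "?w * f = 0" for f
    using srel_inj[OF nz, of "vx * f" "vy * f" "vz * f"] that var_mult_inj[of Gx f 0] by (simp add: w_rel)
  have dimW: "fa.dim ?W = 3 ^ n"
    by (simp add: dim_mult_left[OF w_inj homogeneous_subspace subset_refl] dim_homogeneous card_gen)
  have dimS: "fa.dim ?S = 3 * fa.dim (?I (Suc n))"
    by (rule dim_sum3[OF srel_homogeneous srel_inj[OF nz] ideal_comp_subspace ideal_comp_homogeneous])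
  \<comment> \<open>If the tensor times \<open>f\<close> is also the sum of the
    \<open>r_j g_j\<close> with \<open>g_j\<close> in \<open>I\<close>, independence of the
    relations forces \<open>g_j\<close> to be the letter \<open>v_j\<close> times \<open>f\<close>.
    The zero socle then puts \<open>f\<close> into \<open>I\<close>.\<close>
  have "?S \<inter> ?W \<subseteq> (*) ?w ` ?I n"
  proof
    fix z assume "z \<in> ?S \<inter> ?W"
    then obtain f g0 g1 g2 where z: "f \<in> homogeneous n" "z = ?w * f"
      "z = srel p q r 0 * g0 + srel p q r 1 * g1 + srel p q r 2 * g2"
      "g0 \<in> ?I (Suc n)" "g1 \<in> ?I (Suc n)" "g2 \<in> ?I (Suc n)"
      unfolding sum3_def by blast
    have "srel p q r 0 * (vx * f - g0) + srel p q r 1 * (vy * f - g1) + srel p q r 2 * (vz * f - g2) =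
      ?w * f - (srel p q r 0 * g0 + srel p q r 1 * g1 + srel p q r 2 * g2)"
      unfolding w_rel by (simp add: right_diff_distrib)
    also have "\<dots> = 0" using z(2,3) by simp
    finally have "vx * f - g0 = 0 \<and> vy * f - g1 = 0 \<and> vz * f - g2 = 0" by (rule srel_inj[OF nz])
    then have "vx * f = g0" "vy * f = g1" "vz * f = g2" by simp_all
    then have "var a * f \<in> rel_ideal (sklyanin p q r)" for a
      using z(4-6) by (cases a) (simp_all add: ideal_comp_def)
    then have "f \<in> ?I n" using socle z(1) by (simp add: zero_socle_def ideal_comp_def)
    then show "z \<in> (*) ?w ` ?I n" using z(2) by blast
  qed
  then have "fa.dim (?S \<inter> ?W) \<le> fa.dim ((*) ?w ` ?I n)"
    by (rule dim_mono_homogeneous) (rule mult_left_homogeneous[OF cubic_tensor_homogeneous ideal_comp_homogeneous])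
  also have "\<dots> = fa.dim (?I n)"
    by (rule dim_mult_left[OF w_inj ideal_comp_subspace ideal_comp_homogeneous])
  finally have "fa.dim (?S \<inter> ?W) \<le> fa.dim (?I n)" .
  moreover have "fa.dim (koszul_boundaries p q r n) + fa.dim (?S \<inter> ?W) = fa.dim ?S + fa.dim ?W"
    unfolding koszul_boundaries_def
    by (rule fa.dim_sum_Int_fin[OF subspace_sum3[OF ideal_comp_subspace] subspace_mult_left[OF homogeneous_subspace]
        homogeneous_subset_span[OF hS] homogeneous_subset_span[OF hW] finite_word_words])
  ultimately show ?thesis using dimW dimS by simp
qed

text \<open>With \<open>a n\<close> for the dimension of degree \<open>n\<close> of the quotient,
  this reads \<open>a (n+3) + 3 a (n+1) \<ge> 3 a (n+2) + a n\<close>. It expresses that there are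
  at least as many cycles as boundaries.\<close>

lemma ideal_comp_recursion:
  fixes p q r :: "'k::field"
  assumes nz: "p \<noteq> 0 \<or> q \<noteq> 0 \<or> r \<noteq> 0" and socle: "zero_socle p q r n"
  shows "fa.dim (ideal_comp (sklyanin p q r) (n + 3)) + 3 * fa.dim (ideal_comp (sklyanin p q r) (n + 1)) + 3 ^ n
    \<le> 3 * fa.dim (ideal_comp (sklyanin p q r) (n + 2)) + 3 ^ (n + 2) + fa.dim (ideal_comp (sklyanin p q r) n)"
  using dim_koszul_cycles[OF nz, of n] dim_koszul_boundaries[OF assms]
    dim_mono_homogeneous[OF koszul_boundaries_subset koszul_cycles_homogeneous, of p q r n] by simp

lemma dim_ideal_comp_0: "fa.dim (ideal_comp (sklyanin p q r) 0) = 0"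
  and dim_ideal_comp_1: "fa.dim (ideal_comp (sklyanin p q r) 1) = 0"
  and dim_ideal_comp_2: "fa.dim (ideal_comp (sklyanin p q r) 2) \<le> 3"
proof -
  have "ideal_comp (sklyanin p q r) n \<subseteq> fa.span {}" if "n < 2" for n
  proof
    fix f assume "f \<in> ideal_comp (sklyanin p q r) n"
    then have "hcomp n f = 0" "hcomp n f = f"
      using hcomp_rel_ideal_less[OF sklyanin_quadratic _ that, of f] by (auto simp: ideal_comp_def homogeneous_iff_hcomp)
    then show "f \<in> fa.span {}" by simp
  qed
  from fa.dim_le_card[OF this[of 0]] fa.dim_le_card[OF this[of 1]]
  show "fa.dim (ideal_comp (sklyanin p q r) 0) = 0" "fa.dim (ideal_comp (sklyanin p q r) 1) = 0" by simp_all
  have "fa.dim (ideal_comp (sklyanin p q r) 2) \<le> card (srel p q r ` {..<3})"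
    by (rule fa.dim_le_card[OF ideal_comp_2_span]) simp
  also have "\<dots> \<le> 3" using card_image_le[of "{..<3}" "srel p q r"] by simp
  finally show "fa.dim (ideal_comp (sklyanin p q r) 2) \<le> 3" .
qed

text \<open>The third difference of a quadratic polynomial vanishes.\<close>

lemma choose_recursion:
  "((n + 5) choose 2) + 3 * ((n + 3) choose 2) = 3 * ((n + 4) choose 2) + ((n + 2) choose 2)"
  by (simp add: numeral_eq_Suc)

lemma nondegenerate_nonzero: "nondegenerate p q r \<Longrightarrow> p \<noteq> 0 \<or> q \<noteq> 0 \<or> r \<noteq> 0"
  by (auto simp: nondegenerate_def)

text \<open>\<open>lower\<close> is the upper bound for the quotient, and the recursion supplies the
  opposite one. The zero socle is demanded only up to degree \<open>n - 3\<close>, which leaves room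
  for an induction on the degree.\<close>

lemma dim_recursion_eq:
  fixes p q r :: "'k::field"
  assumes nz: "p \<noteq> 0 \<or> q \<noteq> 0 \<or> r \<noteq> 0" and socle: "\<And>m. m + 3 \<le> n \<Longrightarrow> zero_socle p q r m"
    and IH: "\<And>m. m < n \<Longrightarrow> fa.dim (ideal_comp (sklyanin p q r) m) + ((m + 2) choose 2) = 3 ^ m"
    and lower: "3 ^ n \<le> fa.dim (ideal_comp (sklyanin p q r) n) + ((n + 2) choose 2)"
  shows "fa.dim (ideal_comp (sklyanin p q r) n) + ((n + 2) choose 2) = 3 ^ n"
proof -
  consider "n = 0" | "n = 1" | "n = 2" | m where "n = m + 3"
    by (metis One_nat_def Suc_1 add.commute add_2_eq_Suc' numeral_3_eq_3 add_Suc_right not0_implies_Suc add_0_right)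
  then show ?thesis
  proof cases
    case 1
    then show ?thesis by (simp add: dim_ideal_comp_0 choose_two)
  next
    case 2
    then show ?thesis by (simp add: dim_ideal_comp_1[unfolded One_nat_def] choose_two)
  next
    case 3
    then show ?thesis using lower dim_ideal_comp_2[of p q r] by (simp add: choose_two)
  next
    case (4 m)
    have "fa.dim (ideal_comp (sklyanin p q r) n) + ((n + 2) choose 2) \<le> 3 ^ n"
    proof -
      have e: "m + 2 + 2 = m + 4" "m + 1 + 2 = m + 3" "m + 3 + 2 = m + 5" by simp_all
      have pw: "3 ^ (m + 2) = 9 * (3 ^ m :: nat)" "3 ^ (m + 1) = 3 * (3 ^ m :: nat)" "3 ^ (m + 3) = 27 * (3 ^ m :: nat)"
        by (simp_all add: power_add)
      have lt: "m + 2 < n" "m + 1 < n" "m < n" using 4 by simp_all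
      show ?thesis
        using ideal_comp_recursion[OF nz socle[of m]] IH[OF lt(1)] IH[OF lt(2)] IH[OF lt(3)] choose_recursion[of m]
        unfolding 4 e pw by linarith
    qed
    then show ?thesis using lower by simp
  qed
qed

section \<open>Injectivity of left multiplication by \<open>x\<close>\<close>

definition x_torsion :: "'k::field \<Rightarrow> 'k \<Rightarrow> 'k \<Rightarrow> nat \<Rightarrow> (gen, 'k) free_alg set" where
  "x_torsion p q r n = {f \<in> homogeneous n. vx * f \<in> rel_ideal (sklyanin p q r)}"

lemma x_torsion_subspace: "fa.subspace (x_torsion p q r n)"
  by (rule fa.subspaceI) (auto simp: x_torsion_def distrib_left var_cst_left_commute)

lemma ideal_comp_subset_x_torsion: "ideal_comp (sklyanin p q r) n \<subseteq> x_torsion p q r n"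
  by (auto simp: ideal_comp_def x_torsion_def)

text \<open>By \<open>line_module\<close> for the form \<open>x\<close>, the sum of
  \<open>x T\<close> and \<open>I\<close> has codimension at most \<open>n + 2\<close> in degree
  \<open>n + 1\<close>. The two summands meet in \<open>x\<close> times the torsion.\<close>

lemma dim_x_torsion:
  fixes p q r :: "'k::alg_closed_field"
  assumes nd: "nondegenerate p q r"
  shows "3 ^ (n + 1) + fa.dim (x_torsion p q r n) \<le>
    fa.dim (ideal_comp (sklyanin p q r) (n + 1)) + 3 ^ n + (n + 2)"
proof -
  let ?I = "ideal_comp (sklyanin p q r)"
  let ?X = "(*) vx ` homogeneous n :: (gen, 'k) free_alg set"
  define W where "W = {x + y | x y. x \<in> ?X \<and> y \<in> ?I (Suc n)}"
  have x: "lform (vec3 1 0 0) = (vx :: (gen, 'k) free_alg)" by (simp add: lform_def)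
  have "vec3 1 0 0 \<noteq> (\<lambda>_. 0 :: 'k)" by (simp add: vec3_nonzero_iff)
  from line_module[OF nd this, of "Suc n"] obtain S where S: "finite S" "card S \<le> n + 2"
    "\<And>f. f \<in> homogeneous (Suc n) \<Longrightarrow> \<exists>u\<in>fa.span S. \<exists>g. f - u - vx * g \<in> rel_ideal (sklyanin p q r)"
    unfolding x by auto
  have hX: "?X \<subseteq> homogeneous (Suc n)"
    using mult_left_homogeneous[OF homogeneous_var subset_refl, of Gx n] by simp
  have homW: "W \<subseteq> homogeneous (Suc n)"
    using hX ideal_comp_homogeneous unfolding W_def by blast
  have inj: "f = 0" if "vx * f = 0" for f :: "(gen, 'k) free_alg"
    using that var_mult_inj[of Gx f 0] by simp
  have span_hcomp: "hcomp (Suc n) u \<in> fa.span (hcomp (Suc n) ` S)" if "u \<in> fa.span S" for u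
    using that
  proof (induction rule: fa.span_induct_alt)
    case (step c v w)
    then show ?case unfolding hcomp_add hcomp_cst_mult
      by (intro fa.span_add fa.span_scale) (auto intro: fa.span_base)
  qed (simp add: fa.span_zero)
  have "fa.dim (homogeneous (Suc n) :: (gen, 'k) free_alg set) \<le> card (hcomp (Suc n) ` S) + fa.dim W"
  proof (rule dim_le_card_add[OF finite_imageI[OF S(1)] homW])
    fix f :: "(gen, 'k) free_alg" assume f: "f \<in> homogeneous (Suc n)"
    obtain u g where u: "u \<in> fa.span S" "f - u - vx * g \<in> rel_ideal (sklyanin p q r)"
      using S(3)[OF f] by blast
    have "hcomp (Suc n) (f - u - vx * g) \<in> ?I (Suc n)"
      unfolding ideal_comp_def using hcomp_rel_ideal[OF sklyanin_quadratic u(2)] by blast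
    moreover have "f - hcomp (Suc n) u = vx * hcomp n g + hcomp (Suc n) (f - u - vx * g)"
      using f by (simp add: homogeneous_iff_hcomp)
    ultimately have "f - hcomp (Suc n) u \<in> W" unfolding W_def using hcomp_in_homogeneous by blast
    then show "\<exists>u\<in>fa.span (hcomp (Suc n) ` S). f - u \<in> W" using span_hcomp[OF u(1)] by blast
  qed
  then have "3 ^ (n + 1) \<le> n + 2 + fa.dim W"
    using card_image_le[OF S(1), of "hcomp (Suc n)"] S(2) by (simp add: dim_homogeneous card_gen)
  moreover have "fa.dim W + fa.dim (?X \<inter> ?I (Suc n)) = fa.dim ?X + fa.dim (?I (Suc n))"
    unfolding W_def
    by (rule fa.dim_sum_Int_fin[OF subspace_mult_left[OF homogeneous_subspace] ideal_comp_subspace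
        homogeneous_subset_span[OF hX] homogeneous_subset_span[OF ideal_comp_homogeneous] finite_word_words])
  moreover have "?X \<inter> ?I (Suc n) = (*) vx ` x_torsion p q r n"
    by (auto simp: x_torsion_def ideal_comp_def)
  moreover have "fa.dim ((*) vx ` x_torsion p q r n) = fa.dim (x_torsion p q r n)"
    by (rule dim_mult_left[OF inj x_torsion_subspace]) (auto simp: x_torsion_def)
  moreover have "fa.dim ?X = 3 ^ n"
    by (simp add: dim_mult_left[OF inj homogeneous_subspace subset_refl] dim_homogeneous card_gen)
  ultimately show ?thesis by simp
qed

text \<open>Injectivity below degree \<open>n\<close> gives a zero socle there and hence, by both
  bounds, the dimension in degree \<open>n + 1\<close>. This dimension makes
  \<open>dim_x_torsion\<close> sharp, so left multiplication by \<open>x\<close> is injective in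
  degree \<open>n\<close> as well.\<close>

lemma closed_field_case:
  fixes p q r :: "'k::alg_closed_field"
  assumes nd: "nondegenerate p q r"
  shows "(\<forall>m\<le>n. fa.dim (ideal_comp (sklyanin p q r) m) + ((m + 2) choose 2) = 3 ^ m) \<and>
    (\<forall>m<n. x_torsion p q r m = ideal_comp (sklyanin p q r) m)"
proof (induction n)
  case 0
  show ?case by (simp add: dim_ideal_comp_0 choose_two)
next
  case (Suc n)
  let ?I = "ideal_comp (sklyanin p q r)"
  have dim: "fa.dim (?I m) + ((m + 2) choose 2) = 3 ^ m" if "m \<le> n" for m using Suc that by blast
  have socle: "zero_socle p q r m" if "m < n" for m
    using Suc that unfolding zero_socle_def x_torsion_def ideal_comp_def by blast
  have choose: "((n + 1 + 2) choose 2) = ((n + 2) choose 2) + (n + 2)"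
    by (simp add: numeral_2_eq_2)
  have le: "fa.dim (?I n) \<le> fa.dim (x_torsion p q r n)"
    by (rule dim_mono_homogeneous[OF ideal_comp_subset_x_torsion]) (auto simp: x_torsion_def)
  have dim_Suc: "fa.dim (?I (n + 1)) + ((n + 1 + 2) choose 2) = 3 ^ (n + 1)"
  proof (rule dim_recursion_eq[OF nondegenerate_nonzero[OF nd]])
    show "3 ^ (n + 1) \<le> fa.dim (?I (n + 1)) + ((n + 1 + 2) choose 2)"
      using dim_x_torsion[OF nd, of n] le dim[of n] choose by linarith
  qed (use socle dim in auto)
  have "fa.dim (x_torsion p q r n) \<le> fa.dim (?I n)"
    using dim_x_torsion[OF nd, of n] dim_Suc dim[of n] choose by linarith
  then have "?I n = x_torsion p q r n"
    by (intro fa.subspace_dim_eq_fin[OF ideal_comp_subspace x_torsion_subspace ideal_comp_subset_x_torsion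
        homogeneous_subset_span finite_word_words]) (auto simp: x_torsion_def)
  then show ?case using Suc dim_Suc by (auto simp: le_Suc_eq less_Suc_eq)
qed

section \<open>Descent from the algebraic closure\<close>

lemma lookup_map_zero: "g 0 = 0 \<Longrightarrow> Poly_Mapping.lookup (Poly_Mapping.map g f) w = g (Poly_Mapping.lookup f w)"
  by (simp add: Poly_Mapping.map.rep_eq when_def)

text \<open>Additivity alone is assumed since this is applied to the embedding into the closure and
  also to a linear retraction, which need not be multiplicative.\<close>

lemma map_additive:
  fixes g :: "'k::field \<Rightarrow> 'l::field"
  assumes add: "\<And>a b. g (a + b) = g a + g b"
  shows "Poly_Mapping.map g (f + h) = Poly_Mapping.map g f + Poly_Mapping.map g h"
    "Poly_Mapping.map g 0 = 0"
    "Poly_Mapping.map g (Poly_Mapping.single w c) = Poly_Mapping.single w (g c)"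
    "Poly_Mapping.map g (var a * f') = var a * Poly_Mapping.map g f'"
    "Poly_Mapping.map g (f' * var a) = Poly_Mapping.map g f' * var a"
    "Poly_Mapping.map g (hcomp n f') = hcomp n (Poly_Mapping.map g f')"
proof -
  have g0: "g 0 = 0" by (metis add add_0 add_cancel_right_right)
  show 1: "Poly_Mapping.map g (f + h) = Poly_Mapping.map g f + Poly_Mapping.map g h" for f h
    by (rule poly_mapping_eqI) (simp add: lookup_map_zero[of g, OF g0] lookup_add add)
  show 2: "Poly_Mapping.map g 0 = 0"
    by (rule poly_mapping_eqI) (simp add: lookup_map_zero[of g, OF g0] g0)
  show 3: "Poly_Mapping.map g (Poly_Mapping.single w c) = Poly_Mapping.single w (g c)" for w c
    using g0 by simp
  show "Poly_Mapping.map g (var a * f') = var a * Poly_Mapping.map g f'"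
    by (induction f' rule: free_alg_induct) (simp_all add: 1 2 3 distrib_left var_def g0)
  show "Poly_Mapping.map g (f' * var a) = Poly_Mapping.map g f' * var a"
    by (induction f' rule: free_alg_induct) (simp_all add: 1 2 3 distrib_right var_def g0)
  show "Poly_Mapping.map g (hcomp n f') = hcomp n (Poly_Mapping.map g f')"
    by (rule poly_mapping_eqI) (simp add: lookup_map_zero[of g, OF g0] lookup_hcomp g0)
qed

abbreviation extend_scalars :: "('x, 'k::field) free_alg \<Rightarrow> ('x, 'k alg_closure) free_alg" where
  "extend_scalars \<equiv> Poly_Mapping.map to_ac"

lemmas extend_scalars_simps = map_additive[of to_ac, OF to_ac_add]

lemma extend_scalars_cst_mult: "extend_scalars (cst c * f) = cst (to_ac c) * extend_scalars f"
  by (induction f rule: free_alg_induct) (simp_all add: extend_scalars_simps distrib_left)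

lemma extend_scalars_srel: "extend_scalars (srel p q (r :: 'k::field) j) = srel (to_ac p) (to_ac q) (to_ac r) j"
proof -
  have "extend_scalars (var a :: (gen, 'k) free_alg) = var a" for a
    by (simp add: var_def extend_scalars_simps)
  then show ?thesis by (simp add: srel_def extend_scalars_simps extend_scalars_cst_mult)
qed

lemma extend_scalars_rel_ideal:
  assumes "f \<in> rel_ideal (sklyanin p q r)"
  shows "extend_scalars f \<in> rel_ideal (sklyanin (to_ac p) (to_ac q) (to_ac r))"
proof -
  let ?J = "{f. extend_scalars f \<in> rel_ideal (sklyanin (to_ac p) (to_ac q) (to_ac r))}"
  have "f \<in> ?J"
    using assms
    by (rule rel_ideal_minimal)
      (auto simp: extend_scalars_simps extend_scalars_cst_mult sklyanin_srel[of p q r] extend_scalars_srel srel_in_rel_ideal)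
  then show ?thesis by simp
qed

text \<open>The relations have coefficients in the small field, and letters map to letters; so the
  span of the extended ideal contains the generators and is closed under letters on both
  sides.\<close>

lemma rel_ideal_closure_span:
  assumes "f \<in> rel_ideal (sklyanin (to_ac p) (to_ac q) (to_ac r))"
  shows "f \<in> fa.span (extend_scalars ` rel_ideal (sklyanin p q r))"
  using assms
proof (rule rel_ideal_minimal)
  let ?E = "extend_scalars ` rel_ideal (sklyanin p q r)"
  show "sklyanin (to_ac p) (to_ac q) (to_ac r) \<subseteq> fa.span ?E"
    by (auto simp: sklyanin_srel[of "to_ac p"] extend_scalars_srel[symmetric] intro!: fa.span_base srel_in_rel_ideal)
  fix f :: "(gen, 'a alg_closure) free_alg" and a
  assume f: "f \<in> fa.span ?E"
  have base: "var a * x \<in> fa.span ?E" "x * var a \<in> fa.span ?E" if x: "x \<in> ?E" for x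
  proof -
    obtain u where u: "u \<in> rel_ideal (sklyanin p q r)" "x = extend_scalars u" using x by blast
    show "var a * x \<in> fa.span ?E" "x * var a \<in> fa.span ?E"
      unfolding u(2) extend_scalars_simps[symmetric] using u(1) by (auto intro!: fa.span_base)
  qed
  show "var a * f \<in> fa.span ?E"
    using f
  proof (induction rule: fa.span_induct_alt)
    case (step c x y)
    then show ?case using base
      by (simp add: distrib_left var_cst_left_commute fa.span_add fa.span_scale)
  qed (simp add: fa.span_zero)
  show "f * var a \<in> fa.span ?E"
    using f
  proof (induction rule: fa.span_induct_alt)
    case (step c x y)
    then show ?case using base
      by (simp add: distrib_right mult.assoc fa.span_add fa.span_scale)
  qed (simp add: fa.span_zero)
qed (auto intro: fa.span_zero fa.span_add fa.span_scale)

text \<open>A basis over the small field spans over the closure. In terms of the quotient this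
  carries the upper bound down to the small field.\<close>

lemma dim_ideal_comp_closure:
  "fa.dim (ideal_comp (sklyanin (to_ac p) (to_ac q) (to_ac r)) n) \<le> fa.dim (ideal_comp (sklyanin p q r) n)"
proof -
  let ?I = "ideal_comp (sklyanin p q r) n" and ?J = "ideal_comp (sklyanin (to_ac p) (to_ac q) (to_ac r)) n"
  obtain B where B: "B \<subseteq> ?I" "fa.independent B" "?I \<subseteq> fa.span B" "card B = fa.dim ?I"
    by (rule fa.basis_exists)
  have finB: "finite B"
    using fa.independent_span_bound[OF finite_word_words B(2)] B(1) ideal_comp_homogeneous span_words by blast
  have ext: "extend_scalars f \<in> fa.span (extend_scalars ` B)" if "f \<in> fa.span B" for f
    using that
  proof (induction rule: fa.span_induct_alt)
    case (step c x y)
    then show ?case unfolding extend_scalars_simps(1) extend_scalars_cst_mult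
      by (intro fa.span_add fa.span_scale) (auto intro: fa.span_base)
  qed (simp add: fa.span_zero extend_scalars_simps)
  have hc: "hcomp n f \<in> fa.span (extend_scalars ` B)" if "f \<in> fa.span (extend_scalars ` rel_ideal (sklyanin p q r))" for f
    using that
  proof (induction rule: fa.span_induct_alt)
    case (step c x y)
    then obtain u where u: "u \<in> rel_ideal (sklyanin p q r)" "x = extend_scalars u" by auto
    have "hcomp n u \<in> ?I" unfolding ideal_comp_def using hcomp_rel_ideal[OF sklyanin_quadratic u(1)] by blast
    then have "hcomp n x \<in> fa.span (extend_scalars ` B)"
      unfolding u(2) extend_scalars_simps(6)[symmetric] using B(3) ext by blast
    then show ?case using step(2) unfolding hcomp_add hcomp_cst_mult by (intro fa.span_add fa.span_scale)
  qed (simp add: fa.span_zero)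
  have "?J \<subseteq> fa.span (extend_scalars ` B)"
  proof
    fix f assume "f \<in> ?J"
    then have "f \<in> rel_ideal (sklyanin (to_ac p) (to_ac q) (to_ac r))" "hcomp n f = f"
      by (auto simp: ideal_comp_def homogeneous_iff_hcomp)
    then show "f \<in> fa.span (extend_scalars ` B)" using hc[OF rel_ideal_closure_span] by metis
  qed
  then have "fa.dim ?J \<le> card (extend_scalars ` B)" using finB by (intro fa.dim_le_card) auto
  also have "\<dots> \<le> fa.dim ?I" using card_image_le[OF finB] B(4) by metis
  finally show ?thesis .
qed

text \<open>The closure is a vector space over the small field through \<open>to_ac\<close>; a
  functional prescribed as 1 on the independent set consisting of 1 extends to it.\<close>

lemma closure_retraction:
  "\<exists>\<pi> :: 'k::field alg_closure \<Rightarrow> 'k.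
    (\<forall>a b. \<pi> (a + b) = \<pi> a + \<pi> b) \<and> (\<forall>c a. \<pi> (to_ac c * a) = c * \<pi> a) \<and> \<pi> 1 = 1"
proof -
  interpret vector_space_pair "\<lambda>c (a :: 'k alg_closure). to_ac c * a" "(*) :: 'k \<Rightarrow> 'k \<Rightarrow> 'k"
    by unfold_locales (simp_all add: algebra_simps)
  have "vs1.independent {1 :: 'k alg_closure}" by (subst vs1.dependent_single) simp
  then obtain \<pi> where \<pi>: "Vector_Spaces.linear (\<lambda>c (a :: 'k alg_closure). to_ac c * a) (*) \<pi>" "\<forall>x\<in>{1}. \<pi> x = (1 :: 'k)"
    using linear_independent_extend[of "{1}" "\<lambda>_. 1"] by blast
  interpret \<pi>: Vector_Spaces.linear "\<lambda>c (a :: 'k alg_closure). to_ac c * a" "(*)" \<pi> by (rule \<pi>(1))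
  show ?thesis using \<pi>(2) by (intro exI[of _ \<pi>]) (auto simp: \<pi>.add \<pi>.scale)
qed

text \<open>Applied to coefficients, the retraction turns a combination of extended elements with
  coefficients \<open>c\<close> into the combination of the original elements with coefficients
  \<open>\<pi> c\<close>. So it maps the big ideal into the small one, and it undoes
  \<open>extend_scalars\<close>.\<close>

lemma rel_ideal_descent:
  fixes p q r :: "'k::field"
  assumes "extend_scalars f \<in> rel_ideal (sklyanin (to_ac p) (to_ac q) (to_ac r))"
  shows "f \<in> rel_ideal (sklyanin p q r)"
proof -
  obtain \<pi> :: "'k alg_closure \<Rightarrow> 'k" where \<pi>: "\<And>a b. \<pi> (a + b) = \<pi> a + \<pi> b"
    "\<And>c a. \<pi> (to_ac c * a) = c * \<pi> a" "\<pi> 1 = 1"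
    using closure_retraction by blast
  note \<pi>_simps = map_additive[of \<pi>, OF \<pi>(1)]
  have \<pi>_ext: "Poly_Mapping.map \<pi> (cst c * extend_scalars u) = cst (\<pi> c) * u" for c u
  proof (induction u rule: free_alg_induct)
    case (add w d u)
    then show ?case using \<pi>(2)[of d c]
      by (simp add: extend_scalars_simps \<pi>_simps distrib_left mult.commute)
  qed (simp add: extend_scalars_simps \<pi>_simps)
  have "Poly_Mapping.map \<pi> g \<in> rel_ideal (sklyanin p q r)"
    if "g \<in> fa.span (extend_scalars ` rel_ideal (sklyanin p q r))" for g
    using that
  proof (induction rule: fa.span_induct_alt)
    case (step c x y)
    then show ?case by (auto simp: \<pi>_simps \<pi>_ext intro!: rel_ideal_add rel_ideal_mult_left)
  qed (simp add: \<pi>_simps)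
  then have "Poly_Mapping.map \<pi> (extend_scalars f) \<in> rel_ideal (sklyanin p q r)"
    using rel_ideal_closure_span[OF assms] by blast
  then show ?thesis using \<pi>_ext[of 1 f] by (simp add: \<pi>(3))
qed

lemma nondegenerate_closure: "nondegenerate (to_ac p) (to_ac q) (to_ac r) \<longleftrightarrow> nondegenerate p q r"
proof -
  have "to_ac a ^ 3 = to_ac b ^ 3 \<longleftrightarrow> a ^ 3 = b ^ 3" for a b :: 'a
    unfolding to_ac_power[symmetric] by (rule to_ac_eq_iff)
  then show ?thesis by (simp add: nondegenerate_def)
qed

section \<open>The nondegenerate case\<close>

lemma nondegenerate_zero_socle:
  assumes nd: "nondegenerate p q (r :: 'k::field)"
  shows "zero_socle p q r n"
  unfolding zero_socle_def
proof (intro ballI impI)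
  fix f :: "(gen, 'k) free_alg"
  assume f: "f \<in> homogeneous n" "\<forall>a. var a * f \<in> rel_ideal (sklyanin p q r)"
  let ?p = "to_ac p" and ?q = "to_ac q" and ?r = "to_ac r"
  have "vx * extend_scalars f \<in> rel_ideal (sklyanin ?p ?q ?r)"
    using extend_scalars_rel_ideal[of "vx * f" p q r] f(2) by (simp add: extend_scalars_simps)
  moreover have "extend_scalars f \<in> homogeneous n"
    using arg_cong[OF f(1)[unfolded homogeneous_iff_hcomp], of extend_scalars]
    unfolding extend_scalars_simps(6) homogeneous_iff_hcomp .
  ultimately have "extend_scalars f \<in> x_torsion ?p ?q ?r n" by (simp add: x_torsion_def)
  then have "extend_scalars f \<in> ideal_comp (sklyanin ?p ?q ?r) n"
    using conjunct2[OF closed_field_case[OF nondegenerate_closure[THEN iffD2, OF nd], of "Suc n"]] by blast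
  then show "f \<in> rel_ideal (sklyanin p q r)"
    unfolding ideal_comp_def by (rule rel_ideal_descent[OF IntD1])
qed

lemma nondegenerate_dim:
  assumes nd: "nondegenerate p q (r :: 'k::field)"
  shows "fa.dim (ideal_comp (sklyanin p q r) n) + ((n + 2) choose 2) = 3 ^ n"
proof (induction n rule: less_induct)
  case (less n)
  show ?case
  proof (rule dim_recursion_eq[OF nondegenerate_nonzero[OF nd] nondegenerate_zero_socle[OF nd] less])
    have "fa.dim (ideal_comp (sklyanin (to_ac p) (to_ac q) (to_ac r)) n) + ((n + 2) choose 2) = 3 ^ n"
      using conjunct1[OF closed_field_case[OF nondegenerate_closure[THEN iffD2, OF nd], of n]] by blast
    then show "3 ^ n \<le> fa.dim (ideal_comp (sklyanin p q r) n) + ((n + 2) choose 2)"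
      using dim_ideal_comp_closure[of p q r n] by linarith
  qed
qed

lemma nondegenerate_PHS: "nondegenerate p q r \<Longrightarrow> PHS (sklyanin p q r)"
  using nondegenerate_dim unfolding PHS_iff[OF sklyanin_quadratic] by blast

text \<open>All dimensions are known at this point, and \<open>choose_recursion\<close> turns the
  recursion into an equality, leaving no room between boundaries and cycles.\<close>

lemma nondegenerate_cycles:
  assumes nd: "nondegenerate p q (r :: 'k::field)"
  shows "koszul_cycles p q r n = koszul_boundaries p q r n"
proof -
  have nz: "p \<noteq> 0 \<or> q \<noteq> 0 \<or> r \<noteq> 0" by (rule nondegenerate_nonzero[OF nd])
  have e: "n + 2 + 2 = n + 4" "n + 1 + 2 = n + 3" "n + 3 + 2 = n + 5" by simp_all
  have pw: "3 ^ (n + 2) = 9 * (3 ^ n :: nat)" "3 ^ (n + 1) = 3 * (3 ^ n :: nat)" "3 ^ (n + 3) = 27 * (3 ^ n :: nat)"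
    by (simp_all add: power_add)
  have "fa.dim (koszul_cycles p q r n) \<le> fa.dim (koszul_boundaries p q r n)"
    using dim_koszul_cycles[OF nz, of n] dim_koszul_boundaries[OF nz nondegenerate_zero_socle[OF nd], of n]
      nondegenerate_dim[OF nd, of n] nondegenerate_dim[OF nd, of "n + 1"] nondegenerate_dim[OF nd, of "n + 2"]
      nondegenerate_dim[OF nd, of "n + 3"] choose_recursion[of n]
    unfolding e pw by linarith
  then have "koszul_boundaries p q r n = koszul_cycles p q r n"
    by (intro fa.subspace_dim_eq_fin[OF koszul_boundaries_subspace koszul_cycles_subspace koszul_boundaries_subset
        homogeneous_subset_span[OF koszul_cycles_homogeneous] finite_word_words])
  then show ?thesis by simp
qed

text \<open>The triple \<open>f\<close> is encoded as the sum of the \<open>r_j f_j\<close>, which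
  is a cycle and hence a boundary; cancelling the independent relations gives \<open>f_j\<close> as
  \<open>v_j h\<close> plus an element of \<open>I\<close>.\<close>

lemma nondegenerate_exact_homogeneous:
  assumes nd: "nondegenerate p q (r :: 'k::field)"
    and f: "\<And>j. f j \<in> homogeneous n" "\<And>i. i < 3 \<Longrightarrow> (\<Sum>j<3. smat p q r i j * f j) \<in> rel_ideal (sklyanin p q r)"
  shows "\<exists>g. \<forall>j<3. f j - vars3 j * g \<in> rel_ideal (sklyanin p q r)"
proof -
  let ?I = "rel_ideal (sklyanin p q r)"
  note nz = nondegenerate_nonzero[OF nd]
  define c where "c i = (\<Sum>j<3. smat p q r i j * f j)" for i
  have "(\<Sum>i<3. vars3 i * c i) = (\<Sum>j<3. srel p q r j * f j)"
    unfolding c_def sum_distrib_left by (rule gen_nth_smat)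
  then have eq: "vars3 0 * c 0 + vars3 1 * c 1 + vars3 2 * c 2 = srel p q r 0 * f 0 + srel p q r 1 * f 1 + srel p q r 2 * f 2"
    by (simp add: sum_lessThan_3)
  have c: "c i \<in> ideal_comp (sklyanin p q r) (Suc n)" if "i < 3" for i
  proof -
    have "smat p q r i j * f j \<in> homogeneous (1 + n)" for j
      by (intro homogeneous_mult smat_homogeneous f(1))
    then have "c i \<in> homogeneous (Suc n)" unfolding c_def by (intro homogeneous_sum) simp
    then show ?thesis using f(2)[OF that] by (simp add: ideal_comp_def c_def)
  qed
  show ?thesis
  proof (cases n)
    \<comment> \<open>\<open>koszul_cycles\<close> starts with triples of degree 1. For constant
      triples the entries \<open>c i\<close> have degree 1, where the ideal is zero.\<close>
    case 0
    have "c i = 0" if "i < 3" for i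
    proof -
      have "c i \<in> ?I" "hcomp 1 (c i) = c i" using c[OF that] 0 by (auto simp: ideal_comp_def homogeneous_iff_hcomp)
      then show ?thesis using hcomp_rel_ideal_less[OF sklyanin_quadratic, of "c i" p q r 1] by simp
    qed
    then have "srel p q r 0 * f 0 + srel p q r 1 * f 1 + srel p q r 2 * f 2 = 0" using eq by simp
    then have "f 0 = 0 \<and> f 1 = 0 \<and> f 2 = 0" by (rule srel_inj[OF nz])
    then show ?thesis by (intro exI[of _ 0]) (simp add: all_less_3)
  next
    case (Suc m)
    let ?z = "srel p q r 0 * f 0 + srel p q r 1 * f 1 + srel p q r 2 * f 2"
    have "?z \<in> koszul_cycles p q r m"
      unfolding koszul_cycles_def
    proof
      show "?z \<in> sum3 (srel p q r) (homogeneous (Suc m))"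
        unfolding sum3_def using f(1) Suc by blast
      show "?z \<in> sum3 vars3 (ideal_comp (sklyanin p q r) (Suc (Suc m)))"
        unfolding sum3_def eq[symmetric] using c[of 0] c[of 1] c[of 2] Suc by auto
    qed
    then have "?z \<in> koszul_boundaries p q r m" by (simp add: nondegenerate_cycles[OF nd])
    then obtain g0 g1 g2 h where g: "g0 \<in> ?I" "g1 \<in> ?I" "g2 \<in> ?I"
      and z: "?z = srel p q r 0 * g0 + srel p q r 1 * g1 + srel p q r 2 * g2 + cubic_tensor p q r * h"
      unfolding koszul_boundaries_def sum3_def ideal_comp_def by blast
    have "srel p q r 0 * (f 0 - g0 - vx * h) + srel p q r 1 * (f 1 - g1 - vy * h) + srel p q r 2 * (f 2 - g2 - vz * h) =
      ?z - (srel p q r 0 * g0 + srel p q r 1 * g1 + srel p q r 2 * g2 + cubic_tensor p q r * h)"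
      unfolding cubic_tensor_def by (simp add: right_diff_distrib distrib_right mult.assoc)
    also have "\<dots> = 0" using z by simp
    finally have "f 0 - g0 - vx * h = 0 \<and> f 1 - g1 - vy * h = 0 \<and> f 2 - g2 - vz * h = 0"
      by (rule srel_inj[OF nz])
    then have "f 0 - vx * h = g0" "f 1 - vy * h = g1" "f 2 - vz * h = g2" by (simp_all add: algebra_simps)
    then show ?thesis using g by (intro exI[of _ h]) (simp add: all_less_3)
  qed
qed

lemma nondegenerate_exact:
  assumes nd: "nondegenerate p q (r :: 'k::field)"
    and f: "\<And>i. i < 3 \<Longrightarrow> (\<Sum>j<3. smat p q r i j * f j) \<in> rel_ideal (sklyanin p q r)"
  shows "\<exists>g. \<forall>j<3. f j - vars3 j * g \<in> rel_ideal (sklyanin p q r)"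
proof -
  let ?I = "rel_ideal (sklyanin p q r)"
  have "\<exists>g. \<forall>j<3. hcomp n (f j) - vars3 j * g \<in> ?I" for n
  proof (rule nondegenerate_exact_homogeneous[OF nd, where n = n])
    fix i :: nat assume i: "i < 3"
    have "hcomp (1 + n) (smat p q r i j * f j) = smat p q r i j * hcomp n (f j)" for j
      by (rule hcomp_homogeneous_mult(1)[OF smat_homogeneous])
    then have "(\<Sum>j<3. smat p q r i j * hcomp n (f j)) = hcomp (1 + n) (\<Sum>j<3. smat p q r i j * f j)"
      by (simp add: hcomp_sum)
    then show "(\<Sum>j<3. smat p q r i j * hcomp n (f j)) \<in> ?I"
      using hcomp_rel_ideal[OF sklyanin_quadratic f[OF i]] by metis
  qed simp
  then obtain g where g: "\<And>n j. j < 3 \<Longrightarrow> hcomp n (f j) - vars3 j * g n \<in> ?I" by metis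
  define N where "N = (\<Union>j<3. {n. hcomp n (f j) \<noteq> 0})"
  have finN: "finite N" by (simp add: N_def hcomp_vanish)
  have "f j - vars3 j * (\<Sum>n\<in>N. g n) \<in> ?I" if "j < 3" for j
  proof -
    have "f j = (\<Sum>n\<in>N. hcomp n (f j))"
      by (rule sum_hcomp[symmetric, OF finN]) (use that in \<open>auto simp: N_def\<close>)
    then have "f j - vars3 j * (\<Sum>n\<in>N. g n) = (\<Sum>n\<in>N. hcomp n (f j) - vars3 j * g n)"
      by (simp add: sum_subtractf sum_distrib_left)
    then show ?thesis using g[OF that] by (metis (no_types, lifting) rel_ideal_sum)
  qed
  then show ?thesis by blast
qed

text \<open>The letters form the row at step 0 and the column at step 2, with \<open>smat\<close> in
  between.\<close>

definition sklyanin_mat :: "'k::field \<Rightarrow> 'k \<Rightarrow> 'k \<Rightarrow> nat \<Rightarrow> nat \<Rightarrow> nat \<Rightarrow> (gen, 'k) free_alg" where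
  "sklyanin_mat p q r m i j = (if m = 0 then vars3 j else if m = 1 then smat p q r i j else vars3 i)"

lemma nondegenerate_koszul:
  assumes nd: "nondegenerate p q (r :: 'k::field)"
  shows "koszul (sklyanin p q r)"
proof -
  let ?I = "rel_ideal (sklyanin p q r)"
  \<comment> \<open>The ranks are 1, 3, 3, 1, followed by zeros.\<close>
  define n :: "nat \<Rightarrow> nat" where "n m = (if m = 0 \<or> m = 3 then 1 else if m < 3 then 3 else 0)" for m
  have n: "n 0 = 1" "n 1 = 3" "n 2 = 3" "n 3 = 1" "n (Suc 0) = 3" "n (Suc (Suc 0)) = 3" "n (Suc (Suc (Suc 0))) = 1"
    "n (Suc (Suc (Suc (Suc l)))) = 0" for l
    by (simp_all add: n_def)
  show ?thesis
  proof (rule koszul_matrices[where D = "sklyanin_mat p q r" and n = n])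
    show "sklyanin p q r \<subseteq> homogeneous 2" by (rule sklyanin_quadratic)
    show "sklyanin_mat p q r m i j \<in> homogeneous 1" for m i j
      by (simp add: sklyanin_mat_def smat_homogeneous del: One_nat_def)
    show "n 0 = 1" by (rule n)
    show "\<exists>g. f - (\<Sum>j<n 1. sklyanin_mat p q r 0 0 j * g j) \<in> ?I" if "Poly_Mapping.lookup f [] = 0" for f
      using gen_cover[OF that] by (simp add: n sklyanin_mat_def)
    show "(\<Sum>j<n (m + 1). sklyanin_mat p q r m i j * sklyanin_mat p q r (m + 1) j k) \<in> ?I"
      if "i < n m" "k < n (m + 2)" for m i k
    proof -
      consider "m = 0" | "m = 1" | l where "m = Suc (Suc l)" by (metis One_nat_def not0_implies_Suc)
      then show ?thesis
      proof cases
        case 1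
        then have "(\<Sum>j<3. vars3 j * smat p q r j k) = srel p q r k"
          using that(2) srel_smat[of k p q r] by (simp add: n)
        then show ?thesis using 1 srel_in_rel_ideal[of p q r k] by (simp add: n sklyanin_mat_def)
      next
        case 2
        then have "i < 3" using that(1) by (simp add: n)
        then have "(\<Sum>j<3. smat p q r i j * vars3 j) = srel p q r i"
          by (auto simp: sum_lessThan_3 smat_def srel_def mult.assoc add_ac dest!: less_3_cases)
        then show ?thesis using 2 srel_in_rel_ideal[of p q r i] by (simp add: n sklyanin_mat_def)
      next
        case 3
        then show ?thesis using that(2) by (simp add: n)
      qed
    qed
    fix m and f :: "nat \<Rightarrow> (gen, 'k) free_alg"
    assume *: "\<And>i. i < n m \<Longrightarrow> (\<Sum>j<n (m + 1). sklyanin_mat p q r m i j * f j) \<in> ?I"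
    consider "m = 0" | "m = 1" | "m = 2" | l where "m = Suc (Suc (Suc l))"
      by (metis One_nat_def Suc_1 not0_implies_Suc)
    then show "\<exists>g. \<forall>j<n (m + 1). f j - (\<Sum>k<n (m + 2). sklyanin_mat p q r (m + 1) j k * g k) \<in> ?I"
    proof cases
      case 1
      then show ?thesis using *[of 0] sklyanin_exact_first[of f p q r] by (simp add: n sklyanin_mat_def)
    next
      case 2
      then have "(\<Sum>j<3. smat p q r i j * f j) \<in> ?I" if "i < 3" for i
        using *[of i] that by (simp add: n sklyanin_mat_def numeral_2_eq_2)
      then obtain g where "\<forall>j<3. f j - vars3 j * g \<in> ?I" using nondegenerate_exact[OF nd] by blast
      then show ?thesis using 2
        by (intro exI[of _ "\<lambda>_. g"]) (simp add: n sklyanin_mat_def numeral_2_eq_2 numeral_3_eq_3)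
    next
      case 3
      have "vars3 i * f 0 \<in> ?I" if "i < 3" for i
        using *[of i] that 3 by (simp add: n sklyanin_mat_def numeral_2_eq_2 numeral_3_eq_3)
      from this[of 0] this[of 1] this[of 2] have v: "var a * f 0 \<in> ?I" for a by (cases a) simp_all
      have "var a * hcomp l (f 0) \<in> ?I" for a l
        using hcomp_rel_ideal[OF sklyanin_quadratic v[of a], of "Suc l"] by simp
      then have "hcomp l (f 0) \<in> ?I" for l
        using nondegenerate_zero_socle[OF nd, of l] unfolding zero_socle_def by blast
      then have "f 0 \<in> ?I" using rel_ideal_iff_hcomp[OF sklyanin_quadratic] by blast
      then show ?thesis using 3 by (simp add: n numeral_2_eq_2)
    next
      case 4
      then show ?thesis by (simp add: n)
    qed
  qed
qed

lemma sklyanin_koszul_PHS: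
  "koszul (sklyanin p q r) \<and> (PHS (sklyanin p q r) \<longleftrightarrow> nondegenerate p q r)"
proof -
  have "koszul (sklyanin p q r) \<and> \<not> PHS (sklyanin p q r)" if deg: "\<not> nondegenerate p q r"
  proof -
    \<comment> \<open>If the three cubes agree and \<open>r = 0\<close>, all parameters vanish,
      which is the first alternative; so the last one may include
      \<open>r \<noteq> 0\<close>.\<close>
    consider "p = 0" "q = 0" "r = 0" | "p \<noteq> 0" "q = 0" "r = 0" | "p = 0" "q \<noteq> 0" "r = 0"
      | "p = 0" "q = 0" "r \<noteq> 0" | "r \<noteq> 0" "p ^ 3 = q ^ 3" "q ^ 3 = r ^ 3"
      using deg unfolding nondegenerate_def by (cases "r = 0"; cases "p = 0"; cases "q = 0") auto
    then show ?thesis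
      by cases (simp_all add: koszul_free not_PHS_free monomial_case_p monomial_case_q monomial_case_r
          equal_cubes_case)
  qed
  then show ?thesis using nondegenerate_koszul nondegenerate_PHS by blast
qed

theorem theorem1p1:
  fixes p q r :: "'k::field"
  assumes "CHAR('k) \<noteq> 3"
  shows "koszul (sklyanin p q r) \<and>
    (PHS (sklyanin p q r) \<longleftrightarrow>
      ((p \<noteq> 0 \<and> q \<noteq> 0) \<or> (p \<noteq> 0 \<and> r \<noteq> 0) \<or> (q \<noteq> 0 \<and> r \<noteq> 0)) \<and>
      \<not> (p ^ 3 = q ^ 3 \<and> q ^ 3 = r ^ 3))"
  using sklyanin_koszul_PHS[of p q r] unfolding nondegenerate_def .

end
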